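(* Fix a primitive odd quadratic Dirichlet character $\psi$ modulo $b$. There exist infinitely many (primitive) even quadratic Dirichlet characters $\chi$ modulo $q$ (with $q\to\infty$) such that for every integer $a$ coprime to $b$, \[ \sum_{n < \alpha q} \chi(n) = \psi(a) \frac{\sqrt{q}}{\pi\sqrt{b}}\big(1 + o(1)\big)\log \log q \] for some real $\alpha$ satisfying $|\alpha - a/b| \ll 1/\log q$, where $o(1)\to 0$ as $q\to\infty$.
   Context: A character is odd if $\chi(-1)=-1$ and even if $\chi(-1)=1$; quadratic means real-valued nonprincipal of order $2$. *)

theory Defs
  imports Complex_Main
begin

text \<open>
  A Dirichlet character modulo \<open>q\<close>, extended to all integers by zero off the residue classes
  coprime to \<open>q\<close>. On the coprime classes, multiplicativity and nonvanishing say that it is a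
  homomorphism into the nonzero complex numbers.
\<close>

definition dirichlet_char :: "nat \<Rightarrow> (int \<Rightarrow> complex) \<Rightarrow> bool" where
  "dirichlet_char q \<chi> \<longleftrightarrow>
     q > 0 \<and>
     (\<forall>n. \<chi> (n + int q) = \<chi> n) \<and>
     (\<forall>m n. \<chi> (m * n) = \<chi> m * \<chi> n) \<and>
     (\<forall>n. \<chi> n \<noteq> 0 \<longleftrightarrow> coprime n (int q))"

definition principal_char :: "nat \<Rightarrow> int \<Rightarrow> complex" where
  "principal_char q n = (if coprime n (int q) then 1 else 0)"

definition induced_from :: "nat \<Rightarrow> (int \<Rightarrow> complex) \<Rightarrow> nat \<Rightarrow> bool" where
  "induced_from q \<chi> d \<longleftrightarrow>
     d dvd q \<and>
     (\<exists>\<chi>'. dirichlet_char d \<chi>' \<and> (\<forall>n. coprime n (int q) \<longrightarrow> \<chi> n = \<chi>' n))"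

definition primitive_char :: "nat \<Rightarrow> (int \<Rightarrow> complex) \<Rightarrow> bool" where
  "primitive_char q \<chi> \<longleftrightarrow>
     dirichlet_char q \<chi> \<and> (\<forall>d. induced_from q \<chi> d \<longrightarrow> d = q)"

text \<open>Being nonprincipal with principal square is having order exactly \<open>2\<close>.\<close>

definition quadratic_char :: "nat \<Rightarrow> (int \<Rightarrow> complex) \<Rightarrow> bool" where
  "quadratic_char q \<chi> \<longleftrightarrow>
     dirichlet_char q \<chi> \<and>
     (\<forall>n. \<chi> n \<in> \<real>) \<and>
     \<chi> \<noteq> principal_char q \<and>
     (\<lambda>n. \<chi> n ^ 2) = principal_char q"

definition odd_char :: "(int \<Rightarrow> complex) \<Rightarrow> bool" where
  "odd_char \<chi> \<longleftrightarrow> \<chi> (- 1) = - 1"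

definition even_char :: "(int \<Rightarrow> complex) \<Rightarrow> bool" where
  "even_char \<chi> \<longleftrightarrow> \<chi> (- 1) = 1"

text \<open>
  The sum of \<open>\<chi> n\<close> over \<open>n < x\<close>. For \<open>x > 0\<close> the second sum is empty and this is
  the sum over the integers \<open>1 \<le> n < x\<close>. For \<open>x \<le> 0\<close> it is the usual oriented sum, as for
  integrals, i.e. the extension that makes the difference of the values at \<open>x \<le> y\<close> equal to the
  sum over \<open>x \<le> n < y\<close>; for a nonprincipal character modulo \<open>q\<close> it is the \<open>q\<close>-periodic extension.
\<close>

definition char_sum_below :: "(int \<Rightarrow> complex) \<Rightarrow> real \<Rightarrow> complex" where
  "char_sum_below \<chi> x = (\<Sum>n\<in>{1..<\<lceil>x\<rceil>}. \<chi> n) - (\<Sum>n\<in>{\<lceil>x\<rceil>..0}. \<chi> n)"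

end

theory Submission
  imports Defs "HOL-Number_Theory.Number_Theory" "HOL-Computational_Algebra.Squarefree"
begin

text \<open>
  For an even primitive quadratic \<open>\<chi>\<close> modulo \<open>q\<close>, the sum of \<open>\<chi> n\<close> over \<open>n < \<alpha> q\<close> is essentially
  \<open>\<tau>(\<chi>) / \<pi>\<close> times the sum of \<open>\<chi> k sin (2 \<pi> k \<alpha>) / k\<close>. Averaging over \<open>\<alpha>\<close> in a window of width about \<open>1 / N\<close>
  around \<open>a / b\<close> removes the terms with \<open>k > N\<close> up to a bounded error, and because the character sum
  moves in unit steps it comes within \<open>1\<close> of its average inside the window. If \<open>\<chi> k = \<psi> k\<close>
  for all \<open>k \<le> N\<close>, then what remains is the sum of the \<open>b\<close>-periodic function \<open>\<psi> k sin (2 \<pi> k a / b)\<close>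
  divided by \<open>k\<close>, which is its mean value times \<open>ln N\<close> up to a bounded error; the mean is \<open>\<psi> a \<tau>(\<psi>) / (\<i> b)\<close>.

  Such a \<open>\<chi>\<close> is \<open>\<psi>\<close> times the Jacobi symbol modulo the squarefree part \<open>s\<close> of \<open>2 M\<^sup>2 - 1\<close>, where \<open>M\<close> is
  \<open>b\<close> times the product of the primes up to \<open>N\<close>: quadratic reciprocity makes this symbol odd and trivial on
  \<open>{1..N}\<close>, and \<open>M \<le> b 4\<^sup>N\<close> gives \<open>ln q = O(N)\<close>. The sign of \<open>\<tau>(\<chi>) \<tau>(\<psi>) / \<i>\<close> depends only on the sign
  of the Gauss sum modulo \<open>s\<close>, which is decided by an elementary estimate of a quadratic exponential sum.
\<close>

subsection \<open>Complete residue systems\<close>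

text \<open>The identity \<open>\<tau>(\<chi>)\<^sup>2 = q\<close> gives the size of the main term
  but not its sign, which the theorem fixes. The sign of \<open>\<tau>(\<psi>)\<close> stays
  unknown: it enters once through \<open>\<tau>(\<chi>)\<close> and once through the mean of the
  periodic function, and cancels by \<open>\<tau>(\<psi>)\<^sup>2 = -b\<close>. The Gauss sum modulo
  \<open>s\<close> has only two possible values, so it is enough to show that its imaginary part
  exceeds \<open>-\<surd>s\<close>. This is done at the frequency inverse to 4 modulo
  \<open>s\<close>, where the symbol is 1 and the phases vary slowly. The form
  \<open>2 M\<^sup>2 - 1\<close> serves several demands at once: \<open>M\<close> is even, so it is
  7 modulo 8, \<open>s\<close> is 3 modulo 4 and the symbol is odd; it is -1 modulo the primes of
  \<open>M\<close>, which decides reciprocity; it makes 2 a square modulo each prime of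
  \<open>s\<close>; and, as \<open>b\<close> divides \<open>M\<close>, it forces
  \<open>\<psi> s = -1\<close>. The cut-off finally used is of order \<open>ln q\<close> for the
  actual \<open>q\<close>, which may be far below its upper bound. Then
  \<open>ln N = ln (ln q) + O(1)\<close>, the window has relative width \<open>O(1 / ln q)\<close>,
  and all errors are \<open>O(\<surd>q)\<close>, smaller than the main term by a factor
  \<open>ln (ln q)\<close>.\<close>

lemma sum_complete_residues:
  fixes f :: "int \<Rightarrow> 'a::comm_monoid_add" and q :: nat
  assumes "q > 0" and per: "\<And>n. f (n mod int q) = f n"
    and inj: "inj_on (\<lambda>x. g x mod int q) A" and card: "card A = q"
  shows "(\<Sum>x\<in>A. f (g x)) = (\<Sum>k\<in>{0..<int q}. f k)"
proof -
  have sub: "(\<lambda>x. g x mod int q) ` A \<subseteq> {0..<int q}" using \<open>q > 0\<close> by auto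
  have "card ((\<lambda>x. g x mod int q) ` A) = card {0..<int q}"
    using card_image[OF inj] card by simp
  hence eq: "(\<lambda>x. g x mod int q) ` A = {0..<int q}"
    using card_subset_eq[OF _ sub] by simp
  have "(\<Sum>k\<in>{0..<int q}. f k) = (\<Sum>x\<in>A. f (g x mod int q))"
    unfolding eq[symmetric] by (rule sum.reindex_cong[OF inj refl refl])
  thus ?thesis by (simp add: per)
qed

lemma sum_residues_affine:
  fixes f :: "int \<Rightarrow> 'a::comm_monoid_add" and q :: nat
  assumes "q > 0" and per: "\<And>n. f (n mod int q) = f n" and u: "coprime u (int q)"
  shows "(\<Sum>k\<in>{0..<int q}. f (u * k + c)) = (\<Sum>k\<in>{0..<int q}. f k)"
proof (rule sum_complete_residues[where f = f and g = "\<lambda>k. u * k + c", OF assms(1,2)])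
  show "inj_on (\<lambda>k. (u * k + c) mod int q) {0..<int q}"
  proof (rule inj_onI)
    fix x y assume xy: "x \<in> {0..<int q}" "y \<in> {0..<int q}"
      and "(u * x + c) mod int q = (u * y + c) mod int q"
    hence "[u * x = u * y] (mod int q)"
      by (simp add: cong_def[symmetric] cong_add_rcancel)
    hence "[x = y] (mod int q)" using u cong_mult_lcancel by blast
    thus "x = y" using xy by (simp add: cong_def)
  qed
qed auto

text \<open>Modulo \<open>r\<close> the term \<open>y * int r\<close> disappears and
  \<open>int s\<close> is invertible, so \<open>x\<close> is determined; \<open>y\<close> is
  determined symmetrically modulo \<open>s\<close>.\<close>

lemma sum_residues_CRT:
  fixes f :: "int \<Rightarrow> 'a::comm_monoid_add" and r s :: nat
  assumes "r > 0" "s > 0" and per: "\<And>n. f (n mod int (r * s)) = f n" and co: "coprime r s"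
  shows "(\<Sum>x\<in>{0..<int r}. \<Sum>y\<in>{0..<int s}. f (x * int s + y * int r))
           = (\<Sum>k\<in>{0..<int (r * s)}. f k)"
proof -
  let ?g = "\<lambda>(x, y). x * int s + y * int r"
  have "inj_on (\<lambda>z. ?g z mod int (r * s)) ({0..<int r} \<times> {0..<int s})"
  proof (rule inj_onI, safe)
    fix x y x' y'
    assume xy: "x \<in> {0..<int r}" "y \<in> {0..<int s}" "x' \<in> {0..<int r}" "y' \<in> {0..<int s}"
      and "(x * int s + y * int r) mod int (r * s) = (x' * int s + y' * int r) mod int (r * s)"
    hence c: "[x * int s + y * int r = x' * int s + y' * int r] (mod (int r * int s))"
      by (simp add: cong_def)
    have "[x * int s + y * int r = x' * int s + y' * int r] (mod int r)"
      using c cong_modulus_mult by blast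
    hence "[x * int s = x' * int s] (mod int r)"
      by (simp add: cong_def)
    hence "[x = x'] (mod int r)" using co cong_mult_rcancel[of "int s" "int r"]
      by (simp add: coprime_commute)
    thus "x = x'" using xy by (simp add: cong_def)
    have "[x * int s + y * int r = x' * int s + y' * int r] (mod int s)"
      using c cong_modulus_mult by (metis mult.commute)
    hence "[y * int r = y' * int r] (mod int s)"
      by (simp add: cong_def)
    hence "[y = y'] (mod int s)" using co cong_mult_rcancel[of "int r" "int s"]
      by simp
    thus "y = y'" using xy by (simp add: cong_def)
  qed
  from sum_complete_residues[where f = f, OF _ per this] show ?thesis
    using assms(1,2) by (simp add: sum.cartesian_product case_prod_unfold)
qed

subsection \<open>Dirichlet characters\<close>

lemma dirichlet_char_mod:
  assumes "dirichlet_char q \<chi>"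
  shows "\<chi> (n mod int q) = \<chi> n"
proof -
  have per: "\<chi> (n + int q) = \<chi> n" for n using assms by (simp add: dirichlet_char_def)
  have 1: "\<chi> (n + int j * int q) = \<chi> n" for n j
  proof (induction j)
    case (Suc j)
    have "\<chi> (n + int (Suc j) * int q) = \<chi> ((n + int j * int q) + int q)"
      by (simp add: algebra_simps)
    thus ?case using per Suc by simp
  qed simp
  have 2: "\<chi> (n + j * int q) = \<chi> n" for n j
  proof (cases "j \<ge> 0")
    case True thus ?thesis using 1[of n "nat j"] by simp
  next
    case False thus ?thesis using 1[of "n + j * int q" "nat (-j)"] by simp
  qed
  show ?thesis using 2[of "n mod int q" "n div int q"] by (simp add: mod_div_mult_eq)
qed

lemma dirichlet_char_cong:
  assumes "dirichlet_char q \<chi>" "[m = n] (mod int q)"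
  shows "\<chi> m = \<chi> n"
  using assms dirichlet_char_mod[OF assms(1), of m] dirichlet_char_mod[OF assms(1), of n]
  by (simp add: cong_def)

lemma dirichlet_char_one:
  assumes "dirichlet_char q \<chi>"
  shows "\<chi> 1 = 1"
proof -
  have "\<chi> (1 * 1) = \<chi> 1 * \<chi> 1" "\<chi> 1 \<noteq> 0"
    using assms unfolding dirichlet_char_def by (metis, simp)
  thus ?thesis by simp
qed

lemma quadratic_char_values:
  assumes "quadratic_char q \<chi>"
  shows "\<chi> n = (if coprime n (int q) then if Re (\<chi> n) = 1 then 1 else -1 else 0)"
proof -
  have "\<chi> n ^ 2 = principal_char q n" using assms unfolding quadratic_char_def by metis
  moreover have "\<chi> n \<noteq> 0 \<longleftrightarrow> coprime n (int q)"
    using assms unfolding quadratic_char_def dirichlet_char_def by blast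
  ultimately show ?thesis
    by (auto simp: principal_char_def power2_eq_1_iff)
qed

lemma exists_coprime_cong:
  fixes n :: int and d q :: nat
  assumes "coprime n (int d)" "q > 0"
  shows "\<exists>m. [m = n] (mod int d) \<and> coprime m (int q)"
proof -
  \<comment> \<open>For each prime \<open>p\<close> of \<open>q\<close> exactly one of
    \<open>n\<close> and \<open>d * t\<close> is a multiple of \<open>p\<close>: if \<open>p\<close>
    divides \<open>n\<close>, it divides neither \<open>d\<close> (coprime to \<open>n\<close>) nor
    \<open>t\<close>; otherwise it divides \<open>t\<close>.\<close>
  define t where "t = (\<Prod>p\<in>{p \<in> prime_factors q. \<not> int p dvd n}. p)"
  have "coprime (n + int d * int t) (int q)"
  proof (rule ccontr)
    assume "\<not> coprime (n + int d * int t) (int q)"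
    then obtain c where c: "c dvd n + int d * int t" "c dvd int q" "\<not> is_unit c"
      by (rule not_coprimeE)
    have "c \<noteq> 0" using c(2) \<open>q > 0\<close> by auto
    then obtain p' where p': "p' dvd c" "prime p'" using prime_divisorE c(3) by blast
    define p where "p = nat p'"
    have p: "prime p" "int p = p'" using p' by (auto simp: p_def prime_ge_0_int)
    have dv: "int p dvd n + int d * int t" "int p dvd int q"
      using p' c p(2) dvd_trans by blast+
    have pf: "p \<in> prime_factors q"
      using p(1) dv(2) \<open>q > 0\<close> by (simp add: in_prime_factors_iff)
    show False
    proof (cases "int p dvd n")
      case True
      hence "int p dvd int d * int t" using dv(1) dvd_add_right_iff by blast
      hence "p dvd d \<or> p dvd t"
        using p(1) by (metis int_dvd_int_iff of_nat_mult prime_dvd_mult_iff)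
      moreover have "\<not> p dvd d"
        using True assms(1) p(1) by (meson coprime_common_divisor int_dvd_int_iff not_prime_unit prime_nat_int_transfer)
      moreover have "\<not> p dvd t"
      proof
        assume "p dvd t"
        then obtain r where r: "r \<in> prime_factors q" "\<not> int r dvd n" "p dvd r"
          unfolding t_def using p(1) by (subst (asm) prime_dvd_prod_iff) auto
        hence "p = r" using p(1) primes_dvd_imp_eq by (auto simp: in_prime_factors_iff)
        thus False using r True by simp
      qed
      ultimately show False by blast
    next
      case False
      hence "p dvd t" unfolding t_def using pf by (intro dvd_prodI) auto
      hence "int p dvd int d * int t" by simp
      thus False using dv(1) False dvd_add_left_iff by blast
    qed
  qed
  thus ?thesis by (intro exI[of _ "n + int d * int t"]) (simp add: cong_def)
qed

text \<open>A character that is 1 on all units congruent to 1 modulo \<open>d\<close> depends only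
  on the class modulo \<open>d\<close>: compare \<open>m\<close> and \<open>m'\<close> by
  multiplying both with an inverse of \<open>m'\<close> modulo \<open>q\<close>. The inducing
  character evaluates \<open>\<chi>\<close> at a chosen lift coprime to \<open>q\<close>.\<close>

lemma induced_fromI:
  assumes \<chi>: "dirichlet_char q \<chi>" and d: "d dvd q"
    and triv: "\<And>u. coprime u (int q) \<Longrightarrow> [u = 1] (mod int d) \<Longrightarrow> \<chi> u = 1"
  shows "induced_from q \<chi> d"
proof -
  have q: "q > 0" and mult: "\<And>m n. \<chi> (m * n) = \<chi> m * \<chi> n"
    and nz: "\<And>n. \<chi> n \<noteq> 0 \<longleftrightarrow> coprime n (int q)"
    using \<chi> by (auto simp: dirichlet_char_def)
  have dpos: "d > 0" using d q by (auto intro: Nat.gr0I)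
  have welldef: "\<chi> m = \<chi> m'"
    if mm': "[m = m'] (mod int d)" "coprime m (int q)" "coprime m' (int q)" for m m'
  proof -
    obtain v where v: "[m' * v = 1] (mod int q)" using mm'(3) cong_solve_coprime_int by blast
    hence "coprime v (int q)"
      using coprime_iff_invertible_int by (metis mult.commute)
    moreover have vd: "[m' * v = 1] (mod int d)" using v d by (meson cong_dvd_modulus int_dvd_int_iff)
    moreover have "[m * v = 1] (mod int d)"
      using vd mm'(1) by (meson cong_scalar_right cong_trans)
    ultimately have "\<chi> (m * v) = 1" "\<chi> (m' * v) = 1"
      using triv mm' by (metis coprime_mult_left_iff)+
    thus ?thesis using mult by (metis mult_cancel_right mult_zero_right zero_neq_one)
  qed
  define lift where "lift n = (SOME m. [m = n] (mod int d) \<and> coprime m (int q))" for n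
  have lift: "[lift n = n] (mod int d)" "coprime (lift n) (int q)" if "coprime n (int d)" for n
    using someI_ex[OF exists_coprime_cong[OF that q]] unfolding lift_def by auto
  define \<chi>' where "\<chi>' n = (if coprime n (int d) then \<chi> (lift n) else 0)" for n
  have val: "\<chi>' n = \<chi> m" if "[m = n] (mod int d)" "coprime m (int q)" "coprime n (int d)" for m n
    using that lift[of n] welldef[of "lift n" m] unfolding \<chi>'_def by (metis cong_sym cong_trans)
  have cod: "coprime n (int d)" if "coprime n (int q)" for n
    using that d by (meson coprime_divisors dvd_refl int_dvd_int_iff)
  have "dirichlet_char d \<chi>'" unfolding dirichlet_char_def
  proof (intro conjI allI)
    fix n
    have co: "coprime (n + int d) (int d) \<longleftrightarrow> coprime n (int d)"
      by (metis coprime_iff_gcd_eq_1 gcd_add1)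
    show "\<chi>' (n + int d) = \<chi>' n"
    proof (cases "coprime n (int d)")
      case True
      have "[lift n = n + int d] (mod int d)" using lift[OF True] by (simp add: cong_def)
      from val[OF this] show ?thesis using True co lift[OF True] \<chi>'_def by simp
    qed (simp add: \<chi>'_def co)
    show "\<chi>' n \<noteq> 0 \<longleftrightarrow> coprime n (int d)" using lift[of n] nz by (auto simp: \<chi>'_def)
  next
    fix m n
    show "\<chi>' (m * n) = \<chi>' m * \<chi>' n"
    proof (cases "coprime m (int d) \<and> coprime n (int d)")
      case True
      hence "\<chi>' (m * n) = \<chi> (lift m * lift n)"
        using lift by (intro val cong_mult) auto
      thus ?thesis using True mult by (simp add: \<chi>'_def)
    qed (auto simp: \<chi>'_def)
  qed (use dpos in auto)
  moreover have "\<forall>n. coprime n (int q) \<longrightarrow> \<chi> n = \<chi>' n" using val cod by (metis cong_refl)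
  ultimately show ?thesis unfolding induced_from_def using d by blast
qed

text \<open>Primitivity enters the later arguments in this form: as a unit in the kernel of
  reduction modulo \<open>d\<close> that \<open>\<chi>\<close> detects.\<close>

lemma primitive_char_nontrivial:
  assumes "primitive_char q \<chi>" "d dvd q" "d \<noteq> q"
  obtains u where "coprime u (int q)" "[u = 1] (mod int d)" "\<chi> u \<noteq> 1"
  using assms induced_fromI unfolding primitive_char_def by metis

lemma induced_from_trivial:
  assumes "induced_from q \<chi> d" "coprime u (int q)" "[u = 1] (mod int d)"
  shows "\<chi> u = 1"
proof -
  obtain \<chi>' where \<chi>': "dirichlet_char d \<chi>'" "\<And>n. coprime n (int q) \<Longrightarrow> \<chi> n = \<chi>' n"
    using assms(1) unfolding induced_from_def by blast
  thus ?thesis using assms(2) dirichlet_char_cong[OF \<chi>'(1) assms(3)] dirichlet_char_one[OF \<chi>'(1)]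
    by simp
qed

subsection \<open>Gauss sums\<close>

definition add_char :: "nat \<Rightarrow> int \<Rightarrow> complex" where
  "add_char q n = cis (2 * pi * real_of_int n / real q)"

lemma add_char_add: "add_char q (m + n) = add_char q m * add_char q n"
  by (simp add: add_char_def cis_mult ring_distribs add_divide_distrib)

lemma add_char_0 [simp]: "add_char q 0 = 1"
  by (simp add: add_char_def)

lemma add_char_eq_1_iff:
  assumes "q > 0"
  shows "add_char q n = 1 \<longleftrightarrow> int q dvd n"
proof
  assume "add_char q n = 1"
  hence "cos (2 * pi * real_of_int n / real q) = 1"
    by (metis add_char_def cis.simps(1) one_complex.simps(1))
  then obtain j :: int where "2 * pi * real_of_int n / real q = of_int j * (2 * pi)"
    using cos_one_2pi_int by auto
  hence "real_of_int n = of_int (j * int q)" using assms by (simp add: field_simps)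
  hence "n = j * int q" by linarith
  thus "int q dvd n" by simp
next
  assume "int q dvd n"
  then obtain j where "n = int q * j" by auto
  thus "add_char q n = 1" using assms cis_multiple_2pi[of "of_int j"]
    by (simp add: add_char_def mult.assoc)
qed

lemma add_char_cong:
  assumes "q > 0" "[m = n] (mod int q)"
  shows "add_char q m = add_char q n"
proof -
  have "add_char q (m - n) = 1"
    using assms by (simp add: add_char_eq_1_iff cong_iff_dvd_diff)
  thus ?thesis using add_char_add[of q "m - n" n] by simp
qed

lemma add_char_mult_cancel: "r > 0 \<Longrightarrow> add_char (r * s) (x * int r) = add_char s x"
  by (simp add: add_char_def mult.assoc)

text \<open>Shifting \<open>k\<close> by 1 permutes the residues and multiplies the sum by
  \<open>add_char q n\<close>, so the sum vanishes unless that factor is 1.\<close>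

lemma sum_add_char:
  assumes "q > 0"
  shows "(\<Sum>k\<in>{0..<int q}. add_char q (k * n)) = (if int q dvd n then of_nat q else 0)"
proof -
  let ?T = "\<Sum>k\<in>{0..<int q}. add_char q (k * n)"
  have per: "add_char q ((k mod int q) * n) = add_char q (k * n)" for k
    by (rule add_char_cong[OF assms]) (simp add: cong_def mod_simps)
  have "(\<Sum>k\<in>{0..<int q}. add_char q ((1 * k + 1) * n)) = ?T"
    by (rule sum_residues_affine) (use assms per in auto)
  moreover have "(\<Sum>k\<in>{0..<int q}. add_char q ((1 * k + 1) * n)) = ?T * add_char q n"
    by (simp add: ring_distribs add_char_add sum_distrib_right)
  ultimately have "?T * (add_char q n - 1) = 0" by (simp add: algebra_simps)
  thus ?thesis
    using add_char_eq_1_iff[OF assms, of n] add_char_eq_1_iff[OF assms, of "k * n" for k] by auto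
qed

definition gauss_sum :: "nat \<Rightarrow> (int \<Rightarrow> complex) \<Rightarrow> int \<Rightarrow> complex" where
  "gauss_sum q \<chi> n = (\<Sum>k\<in>{0..<int q}. \<chi> k * add_char q (k * n))"

lemma gauss_sum_dilate:
  assumes "dirichlet_char q \<chi>" "coprime u (int q)"
  shows "gauss_sum q \<chi> n = \<chi> u * gauss_sum q \<chi> (u * n)"
proof -
  have q: "q > 0" using assms by (simp add: dirichlet_char_def)
  have "gauss_sum q \<chi> n = (\<Sum>k\<in>{0..<int q}. \<chi> (u * k + 0) * add_char q ((u * k + 0) * n))"
    unfolding gauss_sum_def
  proof (rule sum_residues_affine[symmetric, OF q _ assms(2)])
    fix k
    have "add_char q ((k mod int q) * n) = add_char q (k * n)"
      by (rule add_char_cong[OF q]) (simp add: cong_def mod_simps)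
    thus "\<chi> (k mod int q) * add_char q (k mod int q * n) = \<chi> k * add_char q (k * n)"
      using dirichlet_char_mod[OF assms(1)] by simp
  qed
  also have "\<dots> = \<chi> u * gauss_sum q \<chi> (u * n)"
    using assms(1) by (simp add: gauss_sum_def dirichlet_char_def sum_distrib_left mult_ac)
  finally show ?thesis .
qed

lemma gauss_sum_coprime:
  assumes "quadratic_char q \<chi>" "coprime n (int q)"
  shows "gauss_sum q \<chi> n = \<chi> n * gauss_sum q \<chi> 1"
proof -
  have d: "dirichlet_char q \<chi>" using assms(1) by (simp add: quadratic_char_def)
  have "\<chi> n * \<chi> n = 1" using quadratic_char_values[OF assms(1), of n] assms(2) by (auto split: if_splits)
  thus ?thesis using gauss_sum_dilate[OF d assms(2), of 1]
    by (simp add: mult.assoc[symmetric])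
qed

text \<open>If \<open>n\<close> shares a factor \<open>g\<close> with \<open>q\<close>, both sides
  vanish: some unit \<open>u\<close> congruent to 1 modulo \<open>q div g\<close> has
  \<open>\<chi> u \<noteq> 1\<close>, yet multiplication by \<open>u\<close> fixes \<open>n\<close>
  modulo \<open>q\<close>, so dilation gives the Gauss sum as \<open>\<chi> u\<close> times
  itself.\<close>

lemma gauss_sum_primitive:
  assumes "primitive_char q \<chi>" "quadratic_char q \<chi>"
  shows "gauss_sum q \<chi> n = \<chi> n * gauss_sum q \<chi> 1"
proof (cases "coprime n (int q)")
  case True
  thus ?thesis using gauss_sum_coprime assms by blast
next
  case False
  have d: "dirichlet_char q \<chi>" using assms(1) by (simp add: primitive_char_def)
  have q: "q > 0" using d by (simp add: dirichlet_char_def)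
  define g where "g = nat (gcd n (int q))"
  have g: "int g dvd n" "g dvd q" "g > 0" "g \<noteq> 1"
    using q False unfolding g_def
    by (auto simp: coprime_iff_gcd_eq_1 nat_dvd_iff)
  define d' where "d' = q div g"
  have q_eq: "q = d' * g" using g by (simp add: d'_def)
  have d': "d' dvd q" "d' \<noteq> q" using q_eq g q by auto
  obtain u where u: "coprime u (int q)" "[u = 1] (mod int d')" "\<chi> u \<noteq> 1"
    using primitive_char_nontrivial[OF assms(1) d'] by blast
  have "gauss_sum q \<chi> (u * n) = gauss_sum q \<chi> n"
  proof -
    have "int d' * int g dvd (u - 1) * n"
      using u(2) g(1) by (intro mult_dvd_mono) (simp add: cong_iff_dvd_diff)
    hence "[u * n = n] (mod int q)" by (simp add: cong_iff_dvd_diff q_eq algebra_simps)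
    hence "add_char q (k * (u * n)) = add_char q (k * n)" for k
      using q by (intro add_char_cong cong_mult) auto
    thus ?thesis by (simp add: gauss_sum_def)
  qed
  hence "gauss_sum q \<chi> n = \<chi> u * gauss_sum q \<chi> n"
    using gauss_sum_dilate[OF d u(1), of n] by simp
  hence "gauss_sum q \<chi> n = 0" using u(3) by simp
  moreover have "\<chi> n = 0" using d False by (auto simp: dirichlet_char_def)
  ultimately show ?thesis by simp
qed

text \<open>The sum of \<open>gauss_sum q \<chi> n * add_char q (- n)\<close> over all residues
  \<open>n\<close> is evaluated twice: \<open>gauss_sum_primitive\<close> turns it into
  \<open>\<chi> (- 1) * ?\<tau> ^ 2\<close>, while orthogonality in \<open>n\<close> keeps only
  \<open>k = 1\<close> and gives \<open>q\<close>.\<close>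

lemma gauss_sum_square:
  assumes "primitive_char q \<chi>" "quadratic_char q \<chi>"
  shows "gauss_sum q \<chi> 1 ^ 2 = \<chi> (- 1) * of_nat q"
proof -
  let ?\<tau> = "gauss_sum q \<chi> 1"
  have d: "dirichlet_char q \<chi>" using assms(1) by (simp add: primitive_char_def)
  have q: "q > 0" using d by (simp add: dirichlet_char_def)
  have "\<chi> (-1) * \<chi> (-1) = \<chi> ((-1) * (-1))" using d unfolding dirichlet_char_def by metis
  hence sq: "\<chi> (-1) * \<chi> (-1) = 1" using dirichlet_char_one[OF d] by simp
  have "(\<Sum>n\<in>{0..<int q}. gauss_sum q \<chi> n * add_char q (n * (-1))) = ?\<tau> * gauss_sum q \<chi> (- 1)"
    by (subst gauss_sum_primitive[OF assms])
       (simp add: gauss_sum_def[of q \<chi> "-1"] sum_distrib_left mult_ac)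
  also have "\<dots> = \<chi> (-1) * ?\<tau> ^ 2"
    using gauss_sum_primitive[OF assms, of "-1"] by (simp add: power2_eq_square)
  finally have "\<chi> (-1) * ?\<tau> ^ 2 = (\<Sum>n\<in>{0..<int q}. gauss_sum q \<chi> n * add_char q (n * (-1)))" ..
  also have "\<dots> = (\<Sum>n\<in>{0..<int q}. \<Sum>k\<in>{0..<int q}. \<chi> k * add_char q (n * (k - 1)))"
  proof -
    have "add_char q (k * n) * add_char q (n * (-1)) = add_char q (n * (k - 1))" for k n
      by (simp add: add_char_add[symmetric] algebra_simps)
    thus ?thesis by (simp only: gauss_sum_def sum_distrib_right mult.assoc)
  qed
  also have "\<dots> = (\<Sum>k\<in>{0..<int q}. \<chi> k * (\<Sum>n\<in>{0..<int q}. add_char q (n * (k - 1))))"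
    by (subst sum.swap) (simp add: sum_distrib_left)
  \<comment> \<open>The representative \<open>1 mod int q\<close> also covers \<open>q = 1\<close>,
    where 1 itself is outside the range of \<open>k\<close>.\<close>
  also have "\<dots> = (\<Sum>k\<in>{0..<int q}. \<chi> k * (if k = 1 mod int q then of_nat q else 0))"
  proof (rule sum.cong[OF refl])
    fix k assume k: "k \<in> {0..<int q}"
    have "int q dvd k - 1 \<longleftrightarrow> k = 1 mod int q"
      using k by (simp add: mod_eq_dvd_iff[symmetric])
    thus "\<chi> k * (\<Sum>n\<in>{0..<int q}. add_char q (n * (k - 1))) = \<chi> k * (if k = 1 mod int q then of_nat q else 0)"
      using sum_add_char[OF q, of "k - 1"] by simp
  qed
  also have "\<dots> = \<chi> (1 mod int q) * of_nat q"
    using q by (simp add: sum.delta if_distrib cong: if_cong)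
  also have "\<dots> = of_nat q" using dirichlet_char_mod[OF d, of 1] dirichlet_char_one[OF d] by simp
  finally have "\<chi> (-1) * (\<chi> (-1) * ?\<tau> ^ 2) = \<chi> (-1) * of_nat q" by simp
  thus ?thesis using sq by (simp add: mult.assoc[symmetric])
qed

text \<open>With \<open>k = x * s + y * r\<close> the exponential splits into one modulo
  \<open>r\<close> in \<open>x\<close> and one modulo \<open>s\<close> in \<open>y\<close>, while
  \<open>\<chi> k = \<chi> (x * s)\<close> and \<open>\<xi> k = \<xi> (y * r)\<close>. The factors
  \<open>\<chi> (int s)\<close> and \<open>\<xi> (int r)\<close> are recorded exactly because they
  contribute to the sign later.\<close>

lemma gauss_sum_mult:
  assumes d: "dirichlet_char r \<chi>" "dirichlet_char s \<xi>" and co: "coprime r s"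
  shows "gauss_sum (r * s) (\<lambda>n. \<chi> n * \<xi> n) c =
           \<chi> (int s) * \<xi> (int r) * gauss_sum r \<chi> c * gauss_sum s \<xi> c"
proof -
  have pos: "r > 0" "s > 0" using d by (simp_all add: dirichlet_char_def)
  have mult: "\<chi> (m * n) = \<chi> m * \<chi> n" "\<xi> (m * n) = \<xi> m * \<xi> n" for m n
    using d by (simp_all add: dirichlet_char_def)
  let ?f = "\<lambda>k. \<chi> k * \<xi> k * add_char (r * s) (k * c)"
  have "gauss_sum (r * s) (\<lambda>n. \<chi> n * \<xi> n) c
      = (\<Sum>x\<in>{0..<int r}. \<Sum>y\<in>{0..<int s}. ?f (x * int s + y * int r))"
    unfolding gauss_sum_def
  proof (rule sum_residues_CRT[symmetric, OF pos _ co])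
    fix n
    have c: "[n mod int (r * s) = n] (mod int r)" "[n mod int (r * s) = n] (mod int s)"
      by (simp_all add: cong_def mod_mod_cancel)
    show "?f (n mod int (r * s)) = ?f n"
      using dirichlet_char_cong[OF d(1) c(1)] dirichlet_char_cong[OF d(2) c(2)]
        add_char_cong[of "r * s" "(n mod int (r * s)) * c" "n * c"] pos
      by (simp add: cong_def mod_simps)
  qed
  also have "\<dots> = (\<Sum>x\<in>{0..<int r}. \<Sum>y\<in>{0..<int s}. (\<chi> x * add_char r (x * c) * \<chi> (int s)) *
       (\<xi> y * add_char s (y * c) * \<xi> (int r)))"
  proof (intro sum.cong refl)
    fix x y
    have "\<chi> (x * int s + y * int r) = \<chi> (x * int s)" "\<xi> (x * int s + y * int r) = \<xi> (y * int r)"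
      by (rule dirichlet_char_cong[OF d(1)], simp add: cong_def)
         (rule dirichlet_char_cong[OF d(2)], simp add: cong_def)
    moreover have "add_char (r * s) ((x * int s + y * int r) * c) = add_char r (x * c) * add_char s (y * c)"
      using add_char_mult_cancel[of r s "y * c"] add_char_mult_cancel[of s r "x * c"] pos
      by (simp add: add_char_add ring_distribs mult_ac)
    ultimately show "?f (x * int s + y * int r) = (\<chi> x * add_char r (x * c) * \<chi> (int s)) *
       (\<xi> y * add_char s (y * c) * \<xi> (int r))" by (simp add: mult mult_ac)
  qed
  also have "\<dots> = (\<Sum>x\<in>{0..<int r}. \<chi> x * add_char r (x * c) * \<chi> (int s)) *
       (\<Sum>y\<in>{0..<int s}. \<xi> y * add_char s (y * c) * \<xi> (int r))"
    by (simp add: sum_product)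
  also have "\<dots> = \<chi> (int s) * \<xi> (int r) * gauss_sum r \<chi> c * gauss_sum s \<xi> c"
    by (simp add: gauss_sum_def sum_distrib_right[symmetric])
  finally show ?thesis .
qed

subsection \<open>Products of Legendre symbols\<close>

context
  fixes p :: nat
  assumes p: "prime p" "2 < p"
begin

lemma Legendre_cong: "[a = b] (mod int p) \<Longrightarrow> Legendre a (int p) = Legendre b (int p)"
  by (simp add: Legendre_def QuadRes_def cong_def)

lemma Legendre_eq_0_iff: "Legendre a (int p) = 0 \<longleftrightarrow> int p dvd a"
  by (simp add: Legendre_def cong_0_iff)

lemma Legendre_values: "Legendre a (int p) \<in> {-1, 0, 1}"
  by (simp add: Legendre_def)

text \<open>Turns the congruences of Euler's criterion into equalities: two such values differ by at
  most 2, and \<open>p > 2\<close>.\<close>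

lemma eq_of_cong_small:
  assumes "a \<in> {-1, 0, 1::int}" "b \<in> {-1, 0, 1}" "[a = b] (mod int p)"
  shows "a = b"
proof (rule ccontr)
  assume "a \<noteq> b"
  have "int p dvd a - b" using assms(3) by (simp add: cong_iff_dvd_diff)
  hence "int p \<le> \<bar>a - b\<bar>" using \<open>a \<noteq> b\<close> by (intro zdvd_imp_le) (auto simp: dvd_abs_iff)
  thus False using assms(1,2) p(2) by auto
qed

lemma Legendre_mult: "Legendre (a * b) (int p) = Legendre a (int p) * Legendre b (int p)"
proof (rule eq_of_cong_small)
  show "Legendre (a * b) (int p) \<in> {-1, 0, 1}" by (rule Legendre_values)
  show "Legendre a (int p) * Legendre b (int p) \<in> {-1, 0, 1}"
    using Legendre_values[of a] Legendre_values[of b] by auto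
  have "[Legendre (a * b) (int p) = a ^ ((p - 1) div 2) * b ^ ((p - 1) div 2)] (mod int p)"
    using euler_criterion[OF p, of "a * b"] by (simp add: power_mult_distrib)
  moreover have "[Legendre a (int p) * Legendre b (int p) = a ^ ((p - 1) div 2) * b ^ ((p - 1) div 2)] (mod int p)"
    by (intro cong_mult euler_criterion p)
  ultimately show "[Legendre (a * b) (int p) = Legendre a (int p) * Legendre b (int p)] (mod int p)"
    by (meson cong_sym cong_trans)
qed

lemma Legendre_minus_one: "Legendre (-1) (int p) = (-1) ^ ((p - 1) div 2)"
  by (rule eq_of_cong_small[OF Legendre_values _ euler_criterion[OF p]])
     (cases "even ((p - 1) div 2)", auto)

lemma Legendre_square: "\<not> int p dvd a \<Longrightarrow> Legendre (a ^ 2) (int p) = 1"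
  using p(1) by (auto simp: Legendre_def QuadRes_def cong_0_iff prime_dvd_power_iff intro: cong_refl)

lemma Legendre_one: "Legendre 1 (int p) = 1"
  using Legendre_square[of 1] p by auto

text \<open>If \<open>y\<close> is a root and \<open>a\<close> is not a multiple of
  \<open>p\<close>, any root \<open>n\<close> makes \<open>p\<close> divide
  \<open>(n - y) * (n + y)\<close>, which leaves \<open>y\<close> and \<open>p - y\<close>; these
  differ because \<open>p\<close> is odd.\<close>

lemma card_square_roots:
  "int (card {n \<in> {0..<int p}. n ^ 2 mod int p = a mod int p}) = 1 + Legendre a (int p)"
proof -
  let ?R = "{n \<in> {0..<int p}. n ^ 2 mod int p = a mod int p}"
  have pr: "prime (int p)" using p by simp
  consider "int p dvd a" | "\<not> int p dvd a" "\<not> QuadRes (int p) a" | "\<not> int p dvd a" "QuadRes (int p) a"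
    by blast
  thus ?thesis
  proof cases
    case 1
    have "n = 0" if "n \<in> ?R" for n
    proof -
      have "int p dvd n ^ 2" using that 1 by (auto simp: dvd_eq_mod_eq_0)
      hence "int p dvd n" using pr prime_dvd_power by blast
      thus ?thesis using that by (auto simp: zdvd_not_zless dest: zdvd_imp_le)
    qed
    moreover have "0 \<in> ?R" using 1 p by (simp add: dvd_eq_mod_eq_0)
    ultimately have "?R = {0}" by blast
    thus ?thesis using 1 Legendre_eq_0_iff[of a] by simp
  next
    case 2
    hence "?R = {}" by (auto simp: QuadRes_def cong_def)
    thus ?thesis using 2 by (simp only:) (simp add: Legendre_def cong_0_iff)
  next
    case 3
    then obtain y0 where "[y0 ^ 2 = a] (mod int p)" by (auto simp: QuadRes_def)
    define y where "y = y0 mod int p"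
    have y: "[y ^ 2 = a] (mod int p)" "y \<in> {0..<int p}"
      using \<open>[y0 ^ 2 = a] (mod int p)\<close> p by (auto simp: y_def cong_def power_mod)
    have "\<not> int p dvd y"
      using cong_dvd_iff[OF y(1)] 3(1) by (auto simp: power2_eq_square)
    hence "y \<noteq> 0" by auto
    have "odd p" using p prime_odd_nat by blast
    hence ne: "y \<noteq> int p - y" by (metis add_diff_cancel_left' diff_add_cancel even_of_nat even_add)
    have "n = y \<or> n = int p - y" if n: "n \<in> ?R" for n
    proof -
      have "[n ^ 2 = y ^ 2] (mod int p)" using n y(1) by (simp add: cong_def)
      hence "int p dvd (n - y) * (n + y)"
        by (simp add: cong_iff_dvd_diff power2_eq_square algebra_simps)
      hence "int p dvd n - y \<or> int p dvd n + y" using pr prime_dvd_mult_iff by blast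
      thus ?thesis
      proof
        assume "int p dvd n - y"
        hence "n mod int p = y mod int p" by (simp add: mod_eq_dvd_iff)
        thus ?thesis using n y by simp
      next
        assume "int p dvd n + y"
        hence "n mod int p = (int p - y) mod int p"
          by (simp add: mod_eq_dvd_iff algebra_simps dvd_diff_right_iff)
        moreover have "(int p - y) mod int p = int p - y" using y \<open>y \<noteq> 0\<close> by (intro mod_pos_pos_trivial) auto
        ultimately show ?thesis using n by auto
      qed
    qed
    moreover have "y \<in> ?R" using y by (simp add: cong_def)
    moreover have "int p - y \<in> ?R"
    proof -
      have "(int p - y) ^ 2 - y ^ 2 = int p * (int p - 2 * y)" by (simp add: power2_eq_square algebra_simps)
      hence "[(int p - y) ^ 2 = y ^ 2] (mod int p)" by (simp add: cong_iff_dvd_diff)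
      hence "[(int p - y) ^ 2 = a] (mod int p)" using y(1) cong_trans by blast
      thus ?thesis using y \<open>y \<noteq> 0\<close> by (simp add: cong_def)
    qed
    ultimately have "?R = {y, int p - y}" by blast
    thus ?thesis using 3 ne by (simp only:) (simp add: Legendre_def cong_0_iff)
  qed
qed

text \<open>Otherwise squaring would be surjective on the residues, hence injective, but 1 and
  \<open>p - 1\<close> have the same square.\<close>

lemma exists_nonresidue: "\<exists>u. Legendre u (int p) = -1"
proof (rule ccontr)
  assume no: "\<nexists>u. Legendre u (int p) = -1"
  let ?f = "\<lambda>n. n ^ 2 mod int p"
  have "\<exists>n\<in>{0..<int p}. ?f n = a" if a: "a \<in> {0..<int p}" for a
  proof -
    have "Legendre a (int p) \<ge> 0" using no Legendre_values[of a] by auto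
    hence "card {n \<in> {0..<int p}. n ^ 2 mod int p = a mod int p} \<noteq> 0"
      using card_square_roots[of a] by linarith
    hence "{n \<in> {0..<int p}. n ^ 2 mod int p = a mod int p} \<noteq> {}" by (metis card.empty)
    thus ?thesis using a by auto
  qed
  hence "{0..<int p} \<subseteq> ?f ` {0..<int p}" by (intro subsetI) (drule meta_spec, fastforce simp del: atLeastLessThan_iff)
  moreover have "?f ` {0..<int p} \<subseteq> {0..<int p}" using p by auto
  ultimately have "?f ` {0..<int p} = {0..<int p}" by blast
  hence "inj_on ?f {0..<int p}" by (intro eq_card_imp_inj_on) auto
  moreover have "?f 1 = ?f (int p - 1)"
  proof -
    have "(int p - 1) ^ 2 - 1 ^ 2 = int p * (int p - 2)" by (simp add: power2_eq_square algebra_simps)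
    hence "[(int p - 1) ^ 2 = 1 ^ 2] (mod int p)" by (simp only: cong_iff_dvd_diff) simp
    thus ?thesis by (simp add: cong_def)
  qed
  ultimately have "1 = int p - 1" by (rule inj_onD) (use p in auto)
  thus False using p by simp
qed

text \<open>Grouping the quadratic sum by the value \<open>m\<close> of the square gives each
  \<open>m\<close> the multiplicity \<open>1 + Legendre m p\<close>; the constant parts sum to zero
  by orthogonality.\<close>

lemma gauss_sum_Legendre:
  assumes "coprime c (int p)"
  shows "gauss_sum p (\<lambda>n. of_int (Legendre n (int p))) c = (\<Sum>n\<in>{0..<int p}. add_char p (n ^ 2 * c))"
proof -
  have pos: "p > 0" using p by simp
  have "(\<Sum>n\<in>{0..<int p}. add_char p (n ^ 2 * c)) = (\<Sum>n\<in>{0..<int p}. add_char p ((n ^ 2 mod int p) * c))"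
    by (intro sum.cong refl add_char_cong[OF pos]) (simp add: cong_def mod_simps)
  also have "\<dots> = (\<Sum>m\<in>{0..<int p}. \<Sum>n\<in>{n \<in> {0..<int p}. n ^ 2 mod int p = m}. add_char p ((n ^ 2 mod int p) * c))"
    using pos by (intro sum.group[symmetric]) auto
  also have "\<dots> = (\<Sum>m\<in>{0..<int p}. of_int (1 + Legendre m (int p)) * add_char p (m * c))"
  proof (rule sum.cong[OF refl])
    fix m assume m: "m \<in> {0..<int p}"
    have "(\<Sum>n\<in>{n \<in> {0..<int p}. n ^ 2 mod int p = m}. add_char p ((n ^ 2 mod int p) * c))
        = of_nat (card {n \<in> {0..<int p}. n ^ 2 mod int p = m}) * add_char p (m * c)"
      by simp
    also have "of_nat (card {n \<in> {0..<int p}. n ^ 2 mod int p = m}) = (of_int (1 + Legendre m (int p)) :: complex)"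
      unfolding card_square_roots[of m, symmetric] using m by simp
    finally show "(\<Sum>n\<in>{n \<in> {0..<int p}. n ^ 2 mod int p = m}. add_char p ((n ^ 2 mod int p) * c))
      = of_int (1 + Legendre m (int p)) * add_char p (m * c)" .
  qed
  also have "\<dots> = (\<Sum>m\<in>{0..<int p}. add_char p (m * c)) + gauss_sum p (\<lambda>n. of_int (Legendre n (int p))) c"
    by (simp add: gauss_sum_def ring_distribs sum.distrib)
  also have "(\<Sum>m\<in>{0..<int p}. add_char p (m * c)) = 0"
  proof -
    have "\<not> int p dvd c" using assms p by (metis coprime_common_divisor dvd_refl not_prime_unit prime_nat_int_transfer)
    thus ?thesis using sum_add_char[OF pos, of c] by simp
  qed
  finally show ?thesis by simp
qed

end

section \<open>Jacobi symbols of squarefree modulus as Dirichlet characters\<close>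

definition odd_primes :: "nat set \<Rightarrow> bool" where
  "odd_primes P \<longleftrightarrow> finite P \<and> (\<forall>r\<in>P. prime r \<and> 2 < r)"

lemma odd_primes_insert: "odd_primes (insert r P) \<longleftrightarrow> prime r \<and> 2 < r \<and> odd_primes P"
  by (auto simp: odd_primes_def)

lemma odd_primes_induct [consumes 1, case_names empty insert]:
  assumes "odd_primes P" and "Q {}"
    and "\<And>r P. prime r \<Longrightarrow> 2 < r \<Longrightarrow> r \<notin> P \<Longrightarrow> odd_primes P \<Longrightarrow> Q P \<Longrightarrow> Q (insert r P)"
  shows "Q P"
proof -
  have "finite P" using assms(1) by (simp add: odd_primes_def)
  thus ?thesis using assms(1)
    by (induction rule: finite_induct) (auto simp: odd_primes_insert intro: assms(2,3))
qed

lemma coprime_prod_odd_primes: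
  assumes "odd_primes P" "prime r" "r \<notin> P"
  shows "coprime r (\<Prod>P)"
  using assms by (intro prod_coprime_right) (auto intro: primes_coprime simp: odd_primes_def)

text \<open>The Jacobi symbol with lower entry \<open>\<Prod>P\<close>. Indexing by a set of primes
  makes the modulus squarefree and allows induction by inserting one prime.\<close>

definition jacobi_char :: "nat set \<Rightarrow> int \<Rightarrow> complex" where
  "jacobi_char P n = of_int (\<Prod>r\<in>P. Legendre n (int r))"

lemma jacobi_char_insert:
  "odd_primes P \<Longrightarrow> r \<notin> P \<Longrightarrow> jacobi_char (insert r P) n = of_int (Legendre n (int r)) * jacobi_char P n"
  by (simp add: jacobi_char_def odd_primes_def)

lemma jacobi_char_nonzero_iff:
  assumes "odd_primes P"
  shows "jacobi_char P n \<noteq> 0 \<longleftrightarrow> coprime n (int (\<Prod>P))"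
  using assms
proof (induction rule: odd_primes_induct)
  case empty
  show ?case by (simp add: jacobi_char_def)
next
  case (insert r P)
  have "prime (int r)" using insert.hyps by simp
  hence "coprime n (int r) \<longleftrightarrow> \<not> int r dvd n"
    by (metis coprime_commute coprime_absorb_left not_prime_unit prime_imp_coprime)
  moreover have "finite P" using insert by (simp add: odd_primes_def)
  ultimately show ?case using insert Legendre_eq_0_iff[of r n]
    by (simp add: jacobi_char_insert)
qed

lemma dirichlet_char_jacobi:
  assumes P: "odd_primes P"
  shows "dirichlet_char (\<Prod>P) (jacobi_char P)"
  unfolding dirichlet_char_def
proof (intro conjI allI)
  show "0 < \<Prod>P" using P by (auto intro!: prod_pos simp: prime_gt_0_nat odd_primes_def)
  show "jacobi_char P n \<noteq> 0 \<longleftrightarrow> coprime n (int (\<Prod>P))" for n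
    by (rule jacobi_char_nonzero_iff[OF P])
  show "jacobi_char P (m * n) = jacobi_char P m * jacobi_char P n" for m n
    using P by (simp add: jacobi_char_def Legendre_mult prod.distrib odd_primes_def)
  show "jacobi_char P (n + int (\<Prod>P)) = jacobi_char P n" for n
  proof -
    have "Legendre (n + int (\<Prod>P)) (int r) = Legendre n (int r)" if "r \<in> P" for r
    proof (rule Legendre_cong)
      have "r dvd \<Prod>P" using that P by (intro dvd_prodI) (auto simp: odd_primes_def)
      hence "int r dvd int (\<Prod>P)" by (simp only: int_dvd_int_iff)
      thus "[n + int (\<Prod>P) = n] (mod int r)" by (simp add: cong_iff_dvd_diff)
    qed (use P that in \<open>auto simp: odd_primes_def\<close>)
    thus ?thesis by (simp add: jacobi_char_def)
  qed
qed

lemma jacobi_char_values: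
  assumes "odd_primes P"
  shows "jacobi_char P n \<in> {-1, 0, 1}"
  using assms
proof (induction rule: odd_primes_induct)
  case (insert r P)
  thus ?case using Legendre_values[of r n] by (auto simp: jacobi_char_insert)
qed (simp add: jacobi_char_def)

lemma jacobi_char_square:
  assumes "odd_primes P" "coprime n (int (\<Prod>P))"
  shows "jacobi_char P n * jacobi_char P n = 1"
proof -
  have "jacobi_char P n \<noteq> 0" using jacobi_char_nonzero_iff assms by blast
  thus ?thesis using jacobi_char_values[OF assms(1), of n] by auto
qed

text \<open>The Chinese remainder theorem combines a nonresidue modulo \<open>r\<close> with 1
  modulo the other primes, so exactly one Legendre factor is -1.\<close>

lemma jacobi_char_exists_nonresidue:
  assumes P: "odd_primes P" "r \<in> P"
  shows "\<exists>u. [u = 1] (mod int (\<Prod>(P - {r}))) \<and> jacobi_char P u = -1"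
proof -
  have r: "prime r" "2 < r" and fin: "finite P" using P by (auto simp: odd_primes_def)
  have P': "odd_primes (P - {r})" using P by (auto simp: odd_primes_def)
  obtain v where v: "Legendre v (int r) = -1" using exists_nonresidue[OF r] by blast
  have "coprime (int (\<Prod>(P - {r}))) (int r)"
    using coprime_prod_odd_primes[OF P' r(1)] by (simp only: coprime_int_iff coprime_commute) simp
  then obtain u where u: "[u = 1] (mod int (\<Prod>(P - {r})))" "[u = v] (mod int r)"
    using binary_chinese_remainder_int by blast
  have "Legendre u (int t) = 1" if t: "t \<in> P - {r}" for t
  proof -
    have "t dvd \<Prod>(P - {r})" using t fin by (intro dvd_prodI) auto
    hence "[u = 1] (mod int t)" using u(1) by (meson cong_dvd_modulus int_dvd_int_iff)
    thus ?thesis using Legendre_cong[of t u 1] Legendre_one[of t] P t by (auto simp: odd_primes_def)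
  qed
  moreover have "Legendre u (int r) = -1" using Legendre_cong[OF r u(2)] v by simp
  ultimately have "jacobi_char P u = -1"
    using fin P(2) by (simp add: jacobi_char_def prod.remove)
  thus ?thesis using u by blast
qed

text \<open>A proper divisor \<open>d\<close> of the squarefree modulus misses some prime
  \<open>r\<close> of \<open>P\<close>, hence divides \<open>\<Prod>(P - {r})\<close>; a unit that
  is 1 modulo that product and has symbol -1 shows that the symbol is not induced from
  \<open>d\<close>.\<close>

lemma primitive_char_jacobi:
  assumes P: "odd_primes P"
  shows "primitive_char (\<Prod>P) (jacobi_char P)"
  unfolding primitive_char_def
proof (intro conjI allI impI)
  show "dirichlet_char (\<Prod>P) (jacobi_char P)" by (rule dirichlet_char_jacobi[OF P])
  fix d assume ind: "induced_from (\<Prod>P) (jacobi_char P) d"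
  hence d: "d dvd \<Prod>P" by (simp add: induced_from_def)
  show "d = \<Prod>P"
  proof (rule ccontr)
    assume "d \<noteq> \<Prod>P"
    have "\<Prod>P dvd d" if "\<forall>r\<in>P. r dvd d"
      using P that
    proof (induction rule: odd_primes_induct)
      case (insert r P)
      have "finite P" using insert by (simp add: odd_primes_def)
      thus ?case using insert coprime_prod_odd_primes[of P r] by (simp add: divides_mult)
    qed auto
    then obtain r where r: "r \<in> P" "\<not> r dvd d" using d \<open>d \<noteq> \<Prod>P\<close> dvd_antisym by blast
    have "prime r" "finite P" using P r by (auto simp: odd_primes_def)
    hence "coprime d r" using r by (metis coprime_commute prime_imp_coprime)
    moreover have "d dvd r * \<Prod>(P - {r})" using d r \<open>finite P\<close> by (simp add: prod.remove)
    ultimately have dd: "d dvd \<Prod>(P - {r})" by (simp add: coprime_dvd_mult_right_iff)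
    obtain u where u: "[u = 1] (mod int (\<Prod>(P - {r})))" "jacobi_char P u = -1"
      using jacobi_char_exists_nonresidue[OF P r(1)] by blast
    have "[u = 1] (mod int d)" using u(1) dd by (meson cong_dvd_modulus int_dvd_int_iff)
    moreover have "coprime u (int (\<Prod>P))" using u(2) jacobi_char_nonzero_iff[OF P, of u] by simp
    ultimately show False using induced_from_trivial[OF ind] u(2) by simp
  qed
qed

lemma quadratic_char_jacobi:
  assumes P: "odd_primes P" and ne: "P \<noteq> {}"
  shows "quadratic_char (\<Prod>P) (jacobi_char P)"
  unfolding quadratic_char_def
proof (intro conjI allI)
  show "dirichlet_char (\<Prod>P) (jacobi_char P)" by (rule dirichlet_char_jacobi[OF P])
  show "jacobi_char P n \<in> \<real>" for n by (simp add: jacobi_char_def)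
  show "(\<lambda>n. jacobi_char P n ^ 2) = principal_char (\<Prod>P)"
  proof
    show "jacobi_char P n ^ 2 = principal_char (\<Prod>P) n" for n
      using jacobi_char_square[OF P, of n] jacobi_char_nonzero_iff[OF P, of n]
      by (auto simp: principal_char_def power2_eq_square)
  qed
  obtain r where "r \<in> P" using ne by blast
  then obtain u where "jacobi_char P u = -1" using jacobi_char_exists_nonresidue[OF P] by blast
  moreover have "principal_char (\<Prod>P) u \<noteq> -1" by (simp add: principal_char_def)
  ultimately show "jacobi_char P \<noteq> principal_char (\<Prod>P)" by metis
qed

text \<open>Both sides factor over the primes. The twists from \<open>gauss_sum_mult\<close> are
  absorbed by dilating the two frequencies by \<open>s\<close> and \<open>r\<close>, which produces
  squares of symbols, equal to 1; in the quadratic sum the cross term of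
  \<open>(x * s + y * r) ^ 2\<close> vanishes modulo \<open>r * s\<close>. The dilations change the
  frequency, so the induction needs arbitrary \<open>c\<close>.\<close>

lemma gauss_sum_jacobi:
  assumes "odd_primes P" "coprime c (int (\<Prod>P))"
  shows "gauss_sum (\<Prod>P) (jacobi_char P) c = (\<Sum>n\<in>{0..<int (\<Prod>P)}. add_char (\<Prod>P) (n ^ 2 * c))"
  using assms
proof (induction arbitrary: c rule: odd_primes_induct)
  case empty
  have "{0..<1::int} = {0}" by auto
  thus ?case by (simp add: gauss_sum_def jacobi_char_def)
next
  case (insert r P)
  define s where "s = \<Prod>P"
  define \<xi> where "\<xi> = (\<lambda>n. complex_of_int (Legendre n (int r)))"
  note r = insert.hyps(1,2) and P = insert.hyps(4)
  have R: "odd_primes {r}" using r by (simp add: odd_primes_def)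
  have "finite P" using P by (simp add: odd_primes_def)
  hence prod: "\<Prod>(insert r P) = r * s" using insert.hyps by (simp add: s_def)
  have co: "coprime r s" unfolding s_def using insert coprime_prod_odd_primes by blast
  have dP: "dirichlet_char s (jacobi_char P)" unfolding s_def by (rule dirichlet_char_jacobi[OF P])
  have \<xi>: "jacobi_char {r} = \<xi>" by (simp add: jacobi_char_def \<xi>_def fun_eq_iff)
  hence dr: "dirichlet_char r \<xi>" using dirichlet_char_jacobi[OF R] by simp
  have pos: "r > 0" "s > 0" using dr dP by (auto simp: dirichlet_char_def)
  have c: "coprime c (int r)" "coprime c (int s)" using insert.prems unfolding prod by auto
  have cor: "coprime (int s) (int r)" "coprime (int r) (int s)" using co by (simp_all add: coprime_commute)
  have "jacobi_char (insert r P) = (\<lambda>n. \<xi> n * jacobi_char P n)"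
    using jacobi_char_insert[OF P insert.hyps(3)] by (simp add: \<xi>_def fun_eq_iff)
  hence "gauss_sum (r * s) (jacobi_char (insert r P)) c
      = \<xi> (int s) * jacobi_char P (int r) * gauss_sum r \<xi> c * gauss_sum s (jacobi_char P) c"
    using gauss_sum_mult[OF dr dP co, of c] by simp
  also have "\<dots> = (\<xi> (int s) * \<xi> (int s)) * (jacobi_char P (int r) * jacobi_char P (int r))
      * gauss_sum r \<xi> (int s * c) * gauss_sum s (jacobi_char P) (int r * c)"
    using gauss_sum_dilate[OF dr cor(1), of c] gauss_sum_dilate[OF dP cor(2), of c] by simp
  also have "\<xi> (int s) * \<xi> (int s) = 1"
    using jacobi_char_square[OF R, of "int s"] cor \<xi> by simp
  also have "jacobi_char P (int r) * jacobi_char P (int r) = 1"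
    using cor by (intro jacobi_char_square[OF P]) (simp only: s_def)
  also have "gauss_sum r \<xi> (int s * c) = (\<Sum>n\<in>{0..<int r}. add_char r (n ^ 2 * (int s * c)))"
    unfolding \<xi>_def by (rule gauss_sum_Legendre) (use r c cor in auto)
  also have "gauss_sum s (jacobi_char P) (int r * c) = (\<Sum>n\<in>{0..<int s}. add_char s (n ^ 2 * (int r * c)))"
    using insert.IH[of "int r * c"] c cor unfolding s_def by (simp only: coprime_mult_left_iff)
  finally have L: "gauss_sum (r * s) (jacobi_char (insert r P)) c =
      (\<Sum>x\<in>{0..<int r}. \<Sum>y\<in>{0..<int s}. add_char r (x ^ 2 * (int s * c)) * add_char s (y ^ 2 * (int r * c)))"
    by (simp add: sum_product)
  have "(\<Sum>n\<in>{0..<int (r * s)}. add_char (r * s) (n ^ 2 * c))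
     = (\<Sum>x\<in>{0..<int r}. \<Sum>y\<in>{0..<int s}. add_char (r * s) ((x * int s + y * int r) ^ 2 * c))"
  proof (rule sum_residues_CRT[symmetric, OF pos _ co])
    fix n
    have "[n mod int (r * s) = n] (mod int (r * s))" by (simp add: cong_def)
    hence "[(n mod int (r * s)) ^ 2 * c = n ^ 2 * c] (mod int (r * s))"
      by (intro cong_mult cong_pow cong_refl)
    thus "add_char (r * s) ((n mod int (r * s)) ^ 2 * c) = add_char (r * s) (n ^ 2 * c)"
      using pos by (intro add_char_cong) auto
  qed
  also have "\<dots> = (\<Sum>x\<in>{0..<int r}. \<Sum>y\<in>{0..<int s}. add_char r (x ^ 2 * (int s * c)) * add_char s (y ^ 2 * (int r * c)))"
  proof (intro sum.cong refl)
    fix x y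
    have "(x * int s + y * int r) ^ 2 * c - ((x ^ 2 * (int s * c)) * int s + (y ^ 2 * (int r * c)) * int r)
       = int (r * s) * (2 * x * y * c)" by (simp add: power2_eq_square algebra_simps)
    hence "add_char (r * s) ((x * int s + y * int r) ^ 2 * c)
      = add_char (r * s) ((x ^ 2 * (int s * c)) * int s + (y ^ 2 * (int r * c)) * int r)"
      using pos by (intro add_char_cong) (auto simp: cong_iff_dvd_diff)
    thus "add_char (r * s) ((x * int s + y * int r) ^ 2 * c) =
      add_char r (x ^ 2 * (int s * c)) * add_char s (y ^ 2 * (int r * c))"
      using add_char_mult_cancel[of r s "y ^ 2 * (int r * c)"] add_char_mult_cancel[of s r "x ^ 2 * (int s * c)"] pos
      by (simp only: add_char_add mult.commute[of s r])
  qed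
  finally show ?case using L by (simp only: prod)
qed

section \<open>Reciprocity, and an odd symbol that is trivial on \<open>{1..N}\<close>\<close>

lemma minus_one_power_half_mult:
  fixes m n :: nat
  assumes "odd m" "odd n"
  shows "(-1::'a::comm_ring_1) ^ ((m * n - 1) div 2) = (-1) ^ ((m - 1) div 2) * (-1) ^ ((n - 1) div 2)"
proof -
  obtain i j where ij: "m = 2 * i + 1" "n = 2 * j + 1" using assms by (metis oddE)
  have "(m * n - 1) div 2 = 2 * (i * j) + i + j" by (simp add: ij algebra_simps)
  thus ?thesis by (simp add: ij power_add power_mult)
qed

lemma odd_prod_odd_primes: "odd_primes P \<Longrightarrow> odd (\<Prod>P)"
proof (induction rule: odd_primes_induct)
  case (insert r P)
  thus ?case using prime_odd_nat[of r] by (simp add: odd_primes_def)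
qed simp

lemma jacobi_char_minus_one:
  "odd_primes P \<Longrightarrow> jacobi_char P (- 1) = (-1) ^ ((\<Prod>P - 1) div 2)"
proof (induction rule: odd_primes_induct)
  case empty
  show ?case by (simp add: jacobi_char_def)
next
  case (insert r P)
  have "\<Prod>(insert r P) = r * \<Prod>P" using insert by (simp add: odd_primes_def)
  moreover have "odd r" using insert prime_odd_nat by blast
  ultimately show ?case
    using insert odd_prod_odd_primes[of P] Legendre_minus_one[of r]
      minus_one_power_half_mult[of r "\<Prod>P", where 'a = complex]
    by (simp add: jacobi_char_insert)
qed

text \<open>Quadratic reciprocity is applied at each prime \<open>r\<close> of \<open>P\<close> and
  solved for the symbol of \<open>p\<close> modulo \<open>r\<close>, since the symbol of
  \<open>r\<close> modulo \<open>p\<close> is its own inverse. The exponents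
  \<open>(r - 1) div 2\<close> add up to \<open>(\<Prod>P - 1) div 2\<close> modulo 2.\<close>

lemma jacobi_char_reciprocity:
  assumes "odd_primes P" and p: "prime p" "2 < p" "p \<notin> P"
  shows "jacobi_char P (int p)
     = of_int (Legendre (int (\<Prod>P)) (int p)) * (-1) ^ ((p - 1) div 2 * ((\<Prod>P - 1) div 2))"
  using assms(1,4)
proof (induction rule: odd_primes_induct)
  case empty
  show ?case using Legendre_one[OF p(1,2)] by (simp add: jacobi_char_def)
next
  case (insert r P)
  let ?L = "\<lambda>a b. complex_of_int (Legendre (int a) (int b))"
  have prod: "\<Prod>(insert r P) = r * \<Prod>P" using insert by (simp add: odd_primes_def)
  have "odd r" using insert prime_odd_nat by blast
  have "p \<noteq> r" using insert.prems by auto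
  have "Legendre (int p) (int r) * Legendre (int r) (int p) = (-1) ^ ((p - 1) div 2 * ((r - 1) div 2))"
    using Quadratic_Reciprocity[of p r] p insert \<open>p \<noteq> r\<close> by simp
  hence QR: "?L p r * ?L r p = (-1) ^ ((p - 1) div 2 * ((r - 1) div 2))"
    by (metis of_int_1 of_int_minus of_int_mult of_int_power)
  have "\<not> int p dvd int r"
    using primes_dvd_imp_eq[of p r] p(1) insert.hyps(1) \<open>p \<noteq> r\<close> by auto
  hence "?L r p * ?L r p = 1"
    using Legendre_eq_0_iff[of p "int r"] Legendre_values[of p "int r"] p by auto
  hence "?L p r = ?L r p * (-1) ^ ((p - 1) div 2 * ((r - 1) div 2))"
    unfolding QR[symmetric] by (simp add: algebra_simps)
  moreover have "?L (r * \<Prod>P) p = ?L r p * ?L (\<Prod>P) p"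
    using Legendre_mult[OF p(1,2), of "int r" "int (\<Prod>P)"] by (simp del: of_nat_prod)
  moreover have "(-1::complex) ^ ((p - 1) div 2 * ((r * \<Prod>P - 1) div 2)) =
     (-1) ^ ((p - 1) div 2 * ((r - 1) div 2)) * (-1) ^ ((p - 1) div 2 * ((\<Prod>P - 1) div 2))"
    using minus_one_power_half_mult[of r "\<Prod>P", where 'a = complex] \<open>odd r\<close> odd_prod_odd_primes[of P] insert
    by (simp only: power_mult mult.commute[of "(p - 1) div 2"]) (simp add: power_mult_distrib)
  ultimately show ?case
    using insert unfolding prod by (simp add: jacobi_char_insert del: of_nat_prod)
qed

lemma prod_prime_factors_squarefree:
  fixes s :: nat
  assumes "squarefree s"
  shows "\<Prod>(prime_factors s) = s"
proof -
  have "s > 0" using assms by (auto intro: Nat.gr0I)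
  moreover have "multiplicity p s = 1" if p: "p \<in> prime_factors s" for p
  proof -
    have "multiplicity p s \<le> 1"
      using assms p by (auto simp: squarefree_factorial_semiring'' in_prime_factors_iff)
    moreover have "multiplicity p s \<noteq> 0"
      using p by (simp add: prime_factors_multiplicity)
    ultimately show ?thesis by simp
  qed
  ultimately show ?thesis using prod_prime_factors[of s] by simp
qed

lemma jacobi_char_eq_1_smooth:
  assumes P: "odd_primes P" and one: "\<And>p. prime p \<Longrightarrow> p \<le> N \<Longrightarrow> jacobi_char P (int p) = 1"
    and n: "1 \<le> n" "n \<le> N"
  shows "jacobi_char P (int n) = 1"
  using n
proof (induction n rule: less_induct)
  case (less n)
  have mult: "jacobi_char P (x * y) = jacobi_char P x * jacobi_char P y" for x y
    using dirichlet_char_jacobi[OF P] by (simp add: dirichlet_char_def)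
  show ?case
  proof (cases "n = 1")
    case True
    thus ?thesis using dirichlet_char_one[OF dirichlet_char_jacobi[OF P]] by simp
  next
    case False
    then obtain p where p: "prime p" "p dvd n" using prime_factor_nat by blast
    then obtain m where m: "n = p * m" by auto
    have "p \<ge> 2" using p prime_ge_2_nat by blast
    have "m \<ge> 1" using less.prems m by (cases m) auto
    have "p * 1 \<le> n" unfolding m by (rule mult_le_mono2[OF \<open>m \<ge> 1\<close>])
    have "2 * m \<le> n" unfolding m by (rule mult_le_mono1[OF \<open>p \<ge> 2\<close>])
    have "jacobi_char P (int m) = 1" using less.IH[of m] less.prems \<open>m \<ge> 1\<close> \<open>2 * m \<le> n\<close> by simp
    thus ?thesis using one[OF p(1)] less.prems \<open>p * 1 \<le> n\<close> by (simp add: m mult)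
  qed
qed

text \<open>
  Write \<open>2 M\<^sup>2 - 1 = s f\<^sup>2\<close> with \<open>s\<close> squarefree. Every prime dividing \<open>s\<close> sees \<open>2\<close> as a quadratic residue,
  since \<open>2 M\<^sup>2 \<equiv> 1\<close>; and since \<open>s f\<^sup>2 \<equiv> -1\<close> modulo every prime dividing \<open>M\<close>, reciprocity makes
  the symbol trivial on those primes.
\<close>

lemma exists_odd_jacobi_char:
  assumes N: "N \<ge> 2" "b \<le> N" "b > 0"
  defines "M \<equiv> b * \<Prod>{p. prime p \<and> p \<le> N}"
  shows "\<exists>P. odd_primes P \<and> 4 dvd \<Prod>P + 1 \<and> coprime (\<Prod>P) b \<and> (\<exists>f. [int (\<Prod>P) * f ^ 2 = -1] (mod int b)) \<and>
     jacobi_char P (- 1) = -1 \<and> (\<forall>n. 1 \<le> n \<longrightarrow> n \<le> N \<longrightarrow> jacobi_char P (int n) = 1) \<and>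
     N < \<Prod>P \<and> \<Prod>P \<le> 2 * M ^ 2"
proof -
  define A where "A = {p. prime p \<and> p \<le> N}"
  have finA: "finite A" unfolding A_def by (rule finite_subset[of _ "{..N}"]) auto
  have dvdM: "p dvd M" if "prime p" "p \<le> N" for p
  proof -
    have "p dvd \<Prod>A" using finA that by (intro dvd_prodI) (auto simp: A_def)
    thus ?thesis by (simp add: M_def A_def)
  qed
  have "\<Prod>A > 0" by (intro prod_pos) (auto simp: A_def prime_gt_0_nat)
  hence M: "M > 0" using N by (simp add: M_def A_def)
  have "2 dvd M" using dvdM[of 2] N two_is_prime_nat by simp
  have "b dvd M" by (simp add: M_def)
  define L where "L = 2 * M ^ 2 - 1"
  have L: "L + 1 = 2 * M ^ 2" using M by (simp add: L_def)
  define s where "s = squarefree_part L"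
  define f where "f = square_part L"
  have Ls: "L = s * f ^ 2" unfolding s_def f_def by (rule squarefree_decompose)
  obtain m where m: "M = 2 * m" using \<open>2 dvd M\<close> by blast
  have "L + 1 = 8 * m ^ 2" unfolding L m by (simp add: power2_eq_square)
  hence "8 dvd L + 1" by simp
  have sf: "squarefree s" unfolding s_def by simp
  define P where "P = prime_factors s"
  have prodP: "\<Prod>P = s" unfolding P_def by (rule prod_prime_factors_squarefree[OF sf])
  have "odd L" using \<open>8 dvd L + 1\<close> by presburger
  hence "odd s" "odd f" unfolding Ls by auto
  have P: "odd_primes P"
    unfolding odd_primes_def
  proof (intro conjI ballI)
    show "finite P" by (simp add: P_def)
    fix r assume r: "r \<in> P"
    show "prime r" using r by (auto simp: P_def)
    have "r dvd s" using r by (auto simp: P_def)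
    hence "r \<noteq> 2" using \<open>odd s\<close> by auto
    thus "2 < r" using prime_ge_2_nat[OF \<open>prime r\<close>] by simp
  qed
  have L0: "L > 0" using \<open>odd L\<close> by (auto intro: Nat.gr0I)
  \<comment> \<open>The odd square \<open>f ^ 2\<close> is 1 modulo 4, so \<open>s\<close> inherits
    the residue 3 of \<open>L\<close>. This makes the symbol odd and fixes the sign in
    reciprocity.\<close>
  have s4: "4 dvd s + 1"
  proof -
    obtain j where j: "f = 2 * j + 1" using \<open>odd f\<close> by (rule oddE)
    have "f ^ 2 = 4 * (j ^ 2 + j) + 1" by (simp add: j power2_eq_square algebra_simps)
    hence "f ^ 2 mod 4 = 1" by simp
    hence "(s * f ^ 2) mod 4 = s mod 4" by (metis mod_mult_right_eq mult.right_neutral)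
    hence "L mod 4 = s mod 4" by (simp add: Ls)
    moreover have "L mod 4 = 3" using \<open>8 dvd L + 1\<close> by presburger
    ultimately show ?thesis by presburger
  qed
  have half_odd: "odd ((s - 1) div 2)" using s4 by presburger
  have coM: "coprime s M"
  proof -
    have "coprime L M"
    proof (rule coprimeI)
      fix c assume "c dvd L" "c dvd M"
      hence "c dvd L + 1" unfolding L by (simp add: power2_eq_square)
      thus "is_unit c" using \<open>c dvd L\<close> dvd_add_right_iff by blast
    qed
    thus ?thesis unfolding Ls by simp
  qed
  have cong: "[int s * int f ^ 2 = -1] (mod int d)" if "d dvd M" for d
  proof -
    have "d dvd L + 1" using that unfolding L by (simp add: power2_eq_square)
    hence "int d dvd int (L + 1)" by (simp only: int_dvd_int_iff)
    thus ?thesis by (simp add: cong_iff_dvd_diff Ls add.commute)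
  qed
  have p1: "jacobi_char P (int p) = 1" if p: "prime p" "p \<le> N" for p
  proof (cases "p = 2")
    case True
    have "Legendre 2 (int r) = 1" if "r \<in> P" for r
    proof -
      have r: "prime r" "2 < r" using P that by (auto simp: odd_primes_def)
      have "r dvd s" using that by (auto simp: P_def)
      hence "r dvd L" by (simp add: Ls)
      hence "int r dvd int (L + 1) - 1" by simp
      hence "[2 * int M ^ 2 = 1] (mod int r)" unfolding L by (simp add: cong_iff_dvd_diff)
      hence "Legendre (2 * int M ^ 2) (int r) = 1"
        using Legendre_cong[OF r] Legendre_one[OF r] by metis
      moreover have "\<not> int r dvd int M"
      proof
        assume "int r dvd int M"
        hence "r dvd M" by simp
        thus False using \<open>r dvd s\<close> coM r by (meson coprime_common_divisor not_prime_unit)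
      qed
      ultimately show ?thesis using Legendre_mult[OF r, of 2 "int M ^ 2"] Legendre_square[OF r, of "int M"] by simp
    qed
    thus ?thesis using True by (simp add: jacobi_char_def)
  next
    case False
    hence p2: "2 < p" using prime_ge_2_nat[OF p(1)] by simp
    have "p dvd M" using dvdM p by blast
    have "\<not> p dvd s" using \<open>p dvd M\<close> coM p by (meson coprime_common_divisor not_prime_unit)
    hence "p \<notin> P" by (auto simp: P_def)
    have "\<not> p dvd f"
    proof
      assume "p dvd f"
      hence "p dvd L" by (simp add: Ls power2_eq_square)
      moreover have "p dvd L + 1" using \<open>p dvd M\<close> unfolding L by (simp add: power2_eq_square)
      ultimately have "p dvd 1" using dvd_add_right_iff by blast
      thus False using p by simp
    qed
    hence "Legendre (int f ^ 2) (int p) = 1" by (intro Legendre_square p p2) simp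
    hence "Legendre (int s) (int p) = Legendre (int s * int f ^ 2) (int p)"
      using Legendre_mult[OF p(1) p2] by simp
    also have "\<dots> = Legendre (-1) (int p)" by (rule Legendre_cong[OF p(1) p2 cong[OF \<open>p dvd M\<close>]])
    also have "\<dots> = (-1) ^ ((p - 1) div 2)" by (rule Legendre_minus_one[OF p(1) p2])
    finally have "jacobi_char P (int p) = (-1) ^ ((p - 1) div 2) * (-1) ^ ((p - 1) div 2 * ((s - 1) div 2))"
      using jacobi_char_reciprocity[OF P p(1) p2 \<open>p \<notin> P\<close>] unfolding prodP by simp
    \<comment> \<open>As \<open>(s - 1) div 2\<close> is odd, the reciprocity sign equals the
      Legendre symbol of -1 and the two cancel.\<close>
    also have "\<dots> = 1" using half_odd by (cases "even ((p - 1) div 2)") (auto simp: power_mult)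
    finally show ?thesis .
  qed
  have n1: "jacobi_char P (int n) = 1" if "1 \<le> n" "n \<le> N" for n
    by (rule jacobi_char_eq_1_smooth[OF P p1]) (use that in auto)
  have m1: "jacobi_char P (- 1) = -1"
    using jacobi_char_minus_one[OF P] half_odd unfolding prodP by simp
  \<comment> \<open>A squarefree part could be small. But for \<open>s \<le> N\<close> the number
    \<open>s - 1\<close> would lie in the range where the symbol is 1, although it is congruent to
    -1.\<close>
  have "N < s"
  proof (rule ccontr)
    assume "\<not> N < s"
    have "s \<ge> 3" using dvd_imp_le[OF s4] by simp
    hence "jacobi_char P (int (s - 1)) = 1" using \<open>\<not> N < s\<close> by (intro n1) auto
    moreover have "jacobi_char P (int (s - 1)) = jacobi_char P (-1)"
      using \<open>s \<ge> 3\<close> by (intro dirichlet_char_cong[OF dirichlet_char_jacobi[OF P]]) (simp add: prodP cong_iff_dvd_diff of_nat_diff)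
    ultimately show False using m1 by simp
  qed
  moreover have "s \<le> 2 * M ^ 2"
  proof -
    have "s \<le> L" using L0 Ls by (intro dvd_imp_le) auto
    thus ?thesis by (simp add: L_def)
  qed
  moreover have "coprime s b" using coM by (simp add: M_def)
  ultimately show ?thesis
    using P s4 m1 n1 cong[OF \<open>b dvd M\<close>] unfolding prodP[symmetric] by blast
qed

subsection \<open>The product of the primes up to \<open>n\<close>\<close>

text \<open>Row \<open>2 * m + 1\<close> has two equal central entries, and the whole row sums to
  \<open>2 * 4 ^ m\<close>.\<close>

lemma central_odd_binomial_le: "(2 * m + 1) choose m \<le> 4 ^ m"
proof -
  have "2 * ((2 * m + 1) choose m) = ((2 * m + 1) choose m) + ((2 * m + 1) choose (m + 1))"
    using binomial_symmetric[of m "2 * m + 1"] by simp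
  also have "\<dots> = (\<Sum>k\<in>{m, m + 1}. (2 * m + 1) choose k)" by simp
  also have "\<dots> \<le> (\<Sum>k\<le>2 * m + 1. (2 * m + 1) choose k)" by (rule sum_mono2) auto
  also have "\<dots> = 2 * 4 ^ m" by (simp only: choose_row_sum power_add power_mult) simp
  finally show ?thesis by simp
qed

lemma finite_primes_le: "finite {p::nat. prime p \<and> a < p \<and> p \<le> n}" "finite {p::nat. prime p \<and> p \<le> n}"
  by (rule finite_subset[of _ "{..n}"]; auto)+

text \<open>These primes divide \<open>(2 * m + 1)!\<close> but neither \<open>m!\<close> nor
  \<open>(m + 1)!\<close>, and distinct primes are coprime.\<close>

lemma prod_primes_dvd_binomial: "\<Prod>{p. prime p \<and> m + 1 < p \<and> p \<le> 2 * m + 1} dvd ((2 * m + 1) choose m)"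
proof -
  let ?C = "(2 * m + 1) choose m"
  have dvd: "p dvd ?C" if p: "prime p" "m + 1 < p" "p \<le> 2 * m + 1" for p
  proof -
    have "fact m * fact (2 * m + 1 - m) * ?C = (fact (2 * m + 1) :: nat)"
      by (rule binomial_fact_lemma) simp
    moreover have "p dvd (fact (2 * m + 1) :: nat)" using p by (simp only: prime_dvd_fact_iff)
    moreover have "\<not> p dvd fact m" "\<not> p dvd fact (2 * m + 1 - m)"
      unfolding prime_dvd_fact_iff[OF p(1)] using p by auto
    ultimately show ?thesis using p(1) by (metis prime_dvd_mult_iff)
  qed
  have "\<Prod>B dvd ?C" if "finite B" "B \<subseteq> {p. prime p \<and> m + 1 < p \<and> p \<le> 2 * m + 1}" for B
    using that
  proof (induction B rule: finite_induct)
    case (insert p B)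
    have "coprime p (\<Prod>B)"
      using insert by (intro prod_coprime_right primes_coprime) auto
    thus ?case using insert dvd[of p] by (auto intro!: divides_mult)
  qed simp
  thus ?thesis using finite_primes_le(1) by blast
qed

text \<open>Erdos's induction: an even \<open>n > 2\<close> adds no prime; for
  \<open>n = 2 * m + 1\<close> the primes up to \<open>m + 1\<close> fall under the induction
  hypothesis and the others divide a binomial coefficient of size at most
  \<open>4 ^ m\<close>.\<close>

lemma primorial_le: "\<Prod>{p::nat. prime p \<and> p \<le> n} \<le> 4 ^ n"
proof (induction n rule: less_induct)
  case (less n)
  consider "n \<le> 1" | "n = 2" | "n > 2" "even n" | "n > 2" "odd n" by linarith
  thus ?case
  proof cases
    case 1
    hence "{p::nat. prime p \<and> p \<le> n} = {}" by (auto dest: prime_ge_2_nat)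
    thus ?thesis by (simp only:) simp
  next
    case 2
    hence "{p::nat. prime p \<and> p \<le> n} = {2}" by (auto dest: prime_ge_2_nat)
    thus ?thesis using 2 by (simp only:) simp
  next
    case 3
    hence "\<not> prime n" using prime_odd_nat by blast
    hence "{p::nat. prime p \<and> p \<le> n} = {p. prime p \<and> p \<le> n - 1}"
      using 3 by (auto simp: le_less)
    hence "\<Prod>{p::nat. prime p \<and> p \<le> n} \<le> 4 ^ (n - 1)" using less[of "n - 1"] 3 by simp
    also have "\<dots> \<le> 4 ^ n" by (rule power_increasing) auto
    finally show ?thesis .
  next
    case 4
    then obtain m where m: "n = 2 * m + 1" by (metis oddE)
    have "{p::nat. prime p \<and> p \<le> n} =
        {p. prime p \<and> p \<le> m + 1} \<union> {p. prime p \<and> m + 1 < p \<and> p \<le> 2 * m + 1}"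
      using m by auto
    hence "\<Prod>{p::nat. prime p \<and> p \<le> n}
        = \<Prod>{p. prime p \<and> p \<le> m + 1} * \<Prod>{p. prime p \<and> m + 1 < p \<and> p \<le> 2 * m + 1}"
      using finite_primes_le by (simp only:) (intro prod.union_disjoint, auto)
    also have "\<dots> \<le> 4 ^ (m + 1) * 4 ^ m"
    proof (rule mult_le_mono)
      show "\<Prod>{p. prime p \<and> p \<le> m + 1} \<le> 4 ^ (m + 1)" using less[of "m + 1"] m 4 by simp
      have "\<Prod>{p. prime p \<and> m + 1 < p \<and> p \<le> 2 * m + 1} \<le> (2 * m + 1) choose m"
        by (rule dvd_imp_le[OF prod_primes_dvd_binomial]) (simp add: zero_less_binomial)
      thus "\<Prod>{p. prime p \<and> m + 1 < p \<and> p \<le> 2 * m + 1} \<le> 4 ^ m"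
        using central_odd_binomial_le[of m] by linarith
    qed
    also have "\<dots> = 4 ^ n" by (simp add: m power_add power_mult power2_eq_square mult_2)
    finally show ?thesis .
  qed
qed

subsection \<open>The sign of a quadratic Gauss sum\<close>

text \<open>Summation by parts: the weights have total variation \<open>c 0 - c n\<close> and the
  boundary terms cost \<open>c 0 + c n\<close>. It serves both the oscillating phases and the
  periodic sums below.\<close>

lemma norm_sum_abel_le:
  fixes D :: "nat \<Rightarrow> 'a::real_normed_vector" and c :: "nat \<Rightarrow> real"
  assumes D: "\<And>i. norm (D i) \<le> B" and c: "\<And>i. i < n \<Longrightarrow> c (Suc i) \<le> c i" "\<And>i. i \<le> n \<Longrightarrow> c i \<ge> 0"
  shows "norm (\<Sum>i\<le>n. c i *\<^sub>R (D (Suc i) - D i)) \<le> 2 * c 0 * B"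
proof -
  have "norm ((\<Sum>i\<le>m. c i *\<^sub>R (D (Suc i) - D i)) - c m *\<^sub>R D (Suc m)) \<le> (2 * c 0 - c m) * B" if "m \<le> n" for m
    using that
  proof (induction m)
    case 0
    have "norm (c 0 *\<^sub>R D 0) \<le> c 0 * B" using D[of 0] c(2)[of 0] by (simp add: mult_left_mono)
    thus ?case by (simp add: scaleR_diff_right)
  next
    case (Suc m)
    have "(\<Sum>i\<le>Suc m. c i *\<^sub>R (D (Suc i) - D i)) - c (Suc m) *\<^sub>R D (Suc (Suc m))
      = ((\<Sum>i\<le>m. c i *\<^sub>R (D (Suc i) - D i)) - c m *\<^sub>R D (Suc m)) + (c m - c (Suc m)) *\<^sub>R D (Suc m)"
      by (simp add: scaleR_diff_right scaleR_diff_left)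
    also have "norm \<dots> \<le> (2 * c 0 - c m) * B + (c m - c (Suc m)) * B"
      using Suc c(1)[of m] D[of "Suc m"] by (intro norm_triangle_mono) (auto intro: mult_left_mono)
    finally show ?case by (simp add: algebra_simps)
  qed
  from this[of n] have "norm (\<Sum>i\<le>n. c i *\<^sub>R (D (Suc i) - D i)) \<le> (2 * c 0 - c n) * B + norm (c n *\<^sub>R D (Suc n))"
    by (smt (verit) norm_triangle_sub order_refl)
  also have "norm (c n *\<^sub>R D (Suc n)) \<le> c n * B" using D[of "Suc n"] c(2)[of n] by (simp add: mult_left_mono)
  finally show ?thesis by (simp add: algebra_simps)
qed

text \<open>Concavity (Jordan's inequality): a violation at \<open>u\<close> would make the
  derivative of \<open>sin (pi / 2 * u) - u\<close> negative somewhere before \<open>u\<close> and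
  positive somewhere after it, but that derivative is decreasing.\<close>

lemma sin_half_pi_ge:
  assumes "0 \<le> u" "u \<le> (1::real)"
  shows "u \<le> sin (pi / 2 * u)"
proof (rule ccontr)
  assume neg: "\<not> u \<le> sin (pi / 2 * u)"
  hence u: "0 < u" "u < 1" using assms by (auto simp: less_le)
  let ?g = "\<lambda>u. sin (pi / 2 * u) - u" and ?g' = "\<lambda>u. pi / 2 * cos (pi / 2 * u) - 1"
  have der: "(?g has_real_derivative ?g' x) (at x)" for x
    by (auto intro!: derivative_eq_intros)
  obtain y where y: "0 < y" "y < u" "?g u - ?g 0 = (u - 0) * ?g' y"
    using MVT2[OF u(1), of ?g ?g'] der by blast
  obtain z where z: "u < z" "z < 1" "?g 1 - ?g u = (1 - u) * ?g' z"
    using MVT2[OF u(2), of ?g ?g'] der by blast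
  have "u * ?g' y < 0" using y(3) neg by simp
  hence "?g' y < 0" using u by (simp add: mult_less_0_iff)
  moreover have "(1 - u) * ?g' z > 0" using z(3) neg by simp
  hence "?g' z > 0" using u by (simp add: zero_less_mult_iff)
  moreover have "cos (pi / 2 * z) \<le> cos (pi / 2 * y)"
    using y z pi_gt_zero by (intro cos_monotone_0_pi_le) (auto simp: field_simps)
  hence "?g' z \<le> ?g' y" by (intro diff_right_mono mult_left_mono) auto
  ultimately show False by linarith
qed

lemma cos_half_pi_ge:
  assumes "0 \<le> u" "u \<le> (1::real)"
  shows "1 - u \<le> cos (pi / 2 * u)"
proof -
  have "sin (pi / 2 * (1 - u)) = cos (pi / 2 * u)" by (simp add: right_diff_distrib sin_diff)
  thus ?thesis using sin_half_pi_ge[of "1 - u"] assms by simp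
qed

lemma inverse_sin_le:
  assumes "0 < x" "x \<le> 1 / 2"
  shows "1 / sin (pi * x) \<le> 1 / (2 * x)" "0 < sin (pi * x)"
proof -
  have "2 * x \<le> sin (pi * x)" using sin_half_pi_ge[of "2 * x"] assms by simp
  thus "1 / sin (pi * x) \<le> 1 / (2 * x)" "0 < sin (pi * x)"
    using assms by (auto intro!: divide_left_mono mult_pos_pos)
qed

text \<open>The phases at \<open>x - 1\<close> and \<open>x + 1\<close> differ by
  \<open>2 * pi * x / k\<close>, so each term is a constant of modulus 1 times
  \<open>1 / (2 * sin (pi * x / k))\<close> times a difference of consecutive \<open>D\<close>.
  These weights decrease as long as \<open>x / k \<le> 1 / 2\<close>, so summation by parts leaves
  only the first weight.\<close>

lemma norm_quadratic_phase_sum_le: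
  fixes k m :: real
  assumes "0 < m" "0 < k" "m + 2 * real n \<le> k / 2"
  shows "norm (\<Sum>i\<le>n. cis (pi * (m + 2 * real i) ^ 2 / (2 * k))) \<le> k / (2 * m)"
proof -
  define x where "x i = m + 2 * real i" for i
  define D where "D i = cis (pi * (x i - 1) ^ 2 / (2 * k))" for i
  define c where "c i = 1 / (2 * sin (pi * (x i / k)))" for i
  have xk: "0 < x i / k" "x i / k \<le> 1 / 2" if "i \<le> n" for i
    using assms that by (auto simp: x_def field_simps)
  have phase: "cis (pi * x i ^ 2 / (2 * k)) = (cis (- (pi / (2 * k))) / \<i>) * (c i *\<^sub>R (D (Suc i) - D i))"
    if "i \<le> n" for i
  proof -
    let ?y = "pi * x i ^ 2 / (2 * k)" and ?d = "pi * (x i / k)" and ?e = "pi / (2 * k)"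
    have s: "sin ?d > 0" using inverse_sin_le[OF xk[OF that]] by simp
    have "pi * (x (Suc i) - 1) ^ 2 / (2 * k) = ?y + ?e + ?d"
      "pi * (x i - 1) ^ 2 / (2 * k) = ?y + ?e - ?d"
      using assms by (simp_all add: x_def power2_eq_square field_simps)
    hence "D (Suc i) - D i = cis (?y + ?e + ?d) - cis (?y + ?e - ?d)" by (simp only: D_def)
    also have "\<dots> = cis (?y + ?e) * (2 * \<i> * of_real (sin ?d))"
      by (simp add: complex_eq_iff cos_add sin_add cos_diff sin_diff)
    also have "cis (?y + ?e) = cis ?y * cis ?e" by (simp add: cis_mult)
    finally have "c i *\<^sub>R (D (Suc i) - D i) = cis ?y * cis ?e * \<i>"
      using s by (simp add: c_def scaleR_conv_of_real)
    moreover have "cis (- ?e) * cis ?e = 1" by (simp add: cis_mult)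
    ultimately show ?thesis by (simp add: mult_ac)
  qed
  have "(\<Sum>i\<le>n. cis (pi * x i ^ 2 / (2 * k))) = (cis (- (pi / (2 * k))) / \<i>) * (\<Sum>i\<le>n. c i *\<^sub>R (D (Suc i) - D i))"
    using phase by (simp add: sum_distrib_left)
  hence "norm (\<Sum>i\<le>n. cis (pi * x i ^ 2 / (2 * k))) = norm (\<Sum>i\<le>n. c i *\<^sub>R (D (Suc i) - D i))"
    by (simp add: norm_mult norm_divide)
  also have "\<dots> \<le> 2 * c 0 * 1"
  proof (rule norm_sum_abel_le)
    show "norm (D i) \<le> 1" for i by (simp add: D_def)
    show "c i \<ge> 0" if "i \<le> n" for i using inverse_sin_le[OF xk[OF that]] by (simp add: c_def)
    show "c (Suc i) \<le> c i" if "i < n" for i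
    proof -
      have "x i / k \<le> x (Suc i) / k" using assms by (simp add: x_def divide_right_mono)
      hence "pi * (x i / k) \<le> pi * (x (Suc i) / k)" by (intro mult_left_mono) auto
      moreover have "pi * (x (Suc i) / k) \<le> pi * (1 / 2)"
        using xk[of "Suc i"] that by (intro mult_left_mono) auto
      moreover have "0 < pi * (x i / k)" using xk[of i] that by (intro mult_pos_pos) auto
      ultimately have "sin (pi * (x i / k)) \<le> sin (pi * (x (Suc i) / k))"
        using pi_gt_zero by (intro sin_monotone_2pi_le) linarith+
      thus ?thesis using inverse_sin_le[OF xk[of i]] that unfolding c_def
        by (intro divide_left_mono) auto
    qed
  qed
  also have "\<dots> \<le> k / (2 * m)"
    using inverse_sin_le(1)[OF xk[of 0]] by (simp add: c_def x_def)
  finally show ?thesis by (simp add: x_def)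
qed

lemma sum_ge_main_minus_tail:
  fixes a l :: "nat \<Rightarrow> real"
  assumes "\<And>j. j \<in> {0<..t} \<Longrightarrow> l j \<le> a j" "\<And>j. j \<in> {t<..T} \<Longrightarrow> 0 \<le> a j" "t \<le> T" "t \<le> J"
    and "T < J \<Longrightarrow> \<bar>\<Sum>j\<in>{T<..J}. a j\<bar> \<le> B" "0 \<le> B"
  shows "(\<Sum>j\<in>{0<..t}. l j) - B \<le> (\<Sum>j\<in>{0<..J}. a j)"
proof -
  \<comment> \<open>The cut \<open>T\<close> may lie beyond \<open>J\<close>; then the tail is empty
    and its contribution is 0.\<close>
  define T' where "T' = min T J"
  have "{0<..J} = {0<..t} \<union> ({t<..T'} \<union> {T'<..J})" using assms(3,4) by (auto simp: T'_def)
  hence "(\<Sum>j\<in>{0<..J}. a j) = (\<Sum>j\<in>{0<..t}. a j) + ((\<Sum>j\<in>{t<..T'}. a j) + (\<Sum>j\<in>{T'<..J}. a j))"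
    using assms(3,4) by (simp only:) (subst sum.union_disjoint, auto simp: T'_def)+
  moreover have "(\<Sum>j\<in>{0<..t}. l j) \<le> (\<Sum>j\<in>{0<..t}. a j)" by (rule sum_mono[OF assms(1)])
  moreover have "0 \<le> (\<Sum>j\<in>{t<..T'}. a j)" using assms(2) by (intro sum_nonneg) (auto simp: T'_def)
  moreover have "-B \<le> (\<Sum>j\<in>{T'<..J}. a j)"
    using assms(5,6) by (cases "T < J") (auto simp: T'_def)
  ultimately show ?thesis by linarith
qed

lemma sum_tail_shift:
  fixes a :: "nat \<Rightarrow> 'a::comm_monoid_add"
  assumes "T < J"
  shows "(\<Sum>j\<in>{T<..J}. a j) = (\<Sum>i\<le>J - T - 1. a (T + 1 + i))"
  by (rule sum.reindex_bij_witness[of _ "\<lambda>i. T + 1 + i" "\<lambda>j. j - T - 1"]) (use assms in auto)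

lemma sum_symmetric_interval:
  fixes G :: "nat \<Rightarrow> real"
  shows "(\<Sum>n\<in>{- int h..int h}. G (nat \<bar>n\<bar>)) = G 0 + 2 * (\<Sum>j\<in>{0<..h}. G j)"
proof (induction h)
  case (Suc h)
  have "{- int (Suc h)..int (Suc h)} = insert (int (Suc h)) (insert (- int (Suc h)) {- int h..int h})"
    by auto
  moreover have "{0<..Suc h} = insert (Suc h) {0<..h}" by auto
  moreover have "nat \<bar>- int (Suc h)\<bar> = Suc h" "nat \<bar>int (Suc h)\<bar> = Suc h" by auto
  ultimately show ?case using Suc by (simp del: of_nat_Suc)
qed simp

lemma sum_split_parity:
  fixes G :: "nat \<Rightarrow> real"
  shows "(\<Sum>n\<in>{0<..2 * J + 1}. G n) = (\<Sum>j\<in>{0<..J}. G (2 * j)) + (\<Sum>j\<in>{0<..J + 1}. G (2 * j - 1))"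
proof (induction J)
  case 0
  have "{0<..Suc 0} = {Suc 0}" by auto
  thus ?case by simp
next
  case (Suc J)
  have "{0<..2 * Suc J + 1} = insert (Suc (Suc (Suc (2 * J)))) (insert (Suc (Suc (2 * J))) {0<..2 * J + 1})"
    "{0<..Suc J} = insert (Suc J) {0<..J}" "{0<..Suc J + 1} = insert (J + 2) {0<..J + 1}" by auto
  thus ?case using Suc by simp
qed

lemma sin_add_2npi: "sin (x + 2 * pi * real n) = sin x"
proof -
  have "2 * pi * real n = 2 * real n * pi" by simp
  hence "sin (2 * pi * real n) = 0" "cos (2 * pi * real n) = 1" by (simp_all only: sin_2npi cos_2npi)
  thus ?thesis by (simp add: sin_add)
qed

text \<open>
  With \<open>n\<^sup>2 (k + 1) / (4 k) = n\<^sup>2 / 4 + n\<^sup>2 / (4 k)\<close> the imaginary part becomes a sum of sines over even \<open>n\<close>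
  and of cosines over odd \<open>n\<close>. The terms with \<open>n \<le> \<surd>k\<close> contribute at least \<open>\<surd>k / 2 - 1\<close>, and partial summation
  bounds the oscillating tails.
\<close>

lemma quadratic_gauss_sum_Im_gt:
  fixes J :: nat
  defines "k \<equiv> 4 * J + 3"
  assumes k64: "64 \<le> k"
  shows "- sqrt (real k) < Im (\<Sum>n\<in>{0..<int k}. add_char k (n ^ 2 * int (J + 1)))"
proof -
  define R where "R = sqrt (real k)"
  have kR: "real k = R ^ 2" by (simp add: R_def)
  have "sqrt 64 \<le> R" unfolding R_def using k64 by (intro real_sqrt_le_mono) simp
  moreover have "sqrt 64 = (8::real)" by (rule real_sqrt_unique) auto
  ultimately have R8: "8 \<le> R" by simp
  have kpos: "0 < real k" using k64 by simp
  define \<theta> where "\<theta> n = pi * real n ^ 2 / (2 * real k)" for n :: nat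
  define G where "G n = (if even n then sin (\<theta> n) else cos (\<theta> n))" for n
  have Im: "Im (add_char k (n ^ 2 * int (J + 1))) = G (nat \<bar>n\<bar>)" for n
  proof -
    define m where "m = nat \<bar>n\<bar>"
    \<comment> \<open>As \<open>J + 1 = (k + 1) / 4\<close>, the phase is the slow angle
      \<open>\<theta> m\<close> plus \<open>pi * m ^ 2 / 2\<close>. The latter is a multiple of
      \<open>2 * pi\<close> for even \<open>m\<close> and \<open>pi / 2\<close> modulo
      \<open>2 * pi\<close> for odd \<open>m\<close>.\<close>
    have "2 * pi * real_of_int (n ^ 2 * int (J + 1)) / real k = 2 * pi * (real m ^ 2 * (real k + 1) / 4) / real k"
      by (simp add: m_def k_def field_simps)
    also have "\<dots> = \<theta> m + pi * real m ^ 2 / 2"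
      using kpos by (simp add: \<theta>_def field_simps)
    finally have arg: "Im (add_char k (n ^ 2 * int (J + 1))) = sin (\<theta> m + pi * real m ^ 2 / 2)"
      by (simp add: add_char_def)
    show ?thesis
    proof (cases "even m")
      case True
      then obtain j where j: "m = 2 * j" by blast
      have "pi * real m ^ 2 / 2 = 2 * pi * real (j ^ 2)" by (simp add: j power2_eq_square)
      hence "sin (\<theta> m + pi * real m ^ 2 / 2) = sin (\<theta> m)"
        by (simp only: sin_add_2npi)
      thus ?thesis using True arg by (simp add: G_def m_def)
    next
      case False
      then obtain j where j: "m = 2 * j + 1" by (rule oddE)
      have "pi * real m ^ 2 / 2 = 2 * pi * real (j ^ 2 + j) + pi / 2" by (simp add: j power2_eq_square field_simps)
      hence "sin (\<theta> m + pi * real m ^ 2 / 2) = sin (\<theta> m + pi / 2 + 2 * pi * real (j ^ 2 + j))"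
        by (simp only: add_ac)
      also have "\<dots> = sin (\<theta> m + pi / 2)"
        by (rule sin_add_2npi)
      finally show ?thesis using False arg by (simp add: G_def m_def sin_add)
    qed
  qed
  let ?f = "\<lambda>n. add_char k (n ^ 2 * int (J + 1))"
  define h where "h = 2 * J + 1"
  have kh: "k = 2 * h + 1" by (simp add: k_def h_def)
  have "(\<Sum>n\<in>{0..<int k}. ?f n) = (\<Sum>n\<in>{- int h..int h}. ?f n)"
  proof (rule sum_complete_residues[where f = ?f and g = "\<lambda>n. n", symmetric])
    show "0 < k" using k64 by simp
    show "?f (n mod int k) = ?f n" for n
    proof (rule add_char_cong)
      show "[(n mod int k) ^ 2 * int (J + 1) = n ^ 2 * int (J + 1)] (mod int k)"
        by (intro cong_mult cong_pow cong_refl) (simp add: cong_def)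
    qed (use k64 in simp)
    show "card {- int h..int h} = k" by (simp add: kh)
    show "inj_on (\<lambda>x. x mod int k) {- int h..int h}"
    proof (rule inj_onI)
      fix x y assume xy: "x \<in> {- int h..int h}" "y \<in> {- int h..int h}" "x mod int k = y mod int k"
      hence "int k dvd \<bar>x - y\<bar>" by (simp add: mod_eq_dvd_iff)
      moreover have "\<bar>x - y\<bar> < int k" using xy by (auto simp: kh)
      ultimately show "x = y" using zdvd_imp_le[of "int k" "\<bar>x - y\<bar>"] by force
    qed
  qed
  hence "Im (\<Sum>n\<in>{0..<int k}. ?f n) = (\<Sum>n\<in>{- int h..int h}. G (nat \<bar>n\<bar>))"
    by (simp only: Im_sum Im)
  also have "\<dots> = G 0 + 2 * (\<Sum>j\<in>{0<..h}. G j)" by (rule sum_symmetric_interval)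
  also have "(\<Sum>j\<in>{0<..h}. G j) = (\<Sum>j\<in>{0<..J}. G (2 * j)) + (\<Sum>j\<in>{0<..J + 1}. G (2 * j - 1))"
    unfolding h_def by (rule sum_split_parity)
  finally have ImG: "Im (\<Sum>n\<in>{0..<int k}. ?f n)
     = 2 * ((\<Sum>j\<in>{0<..J}. sin (\<theta> (2 * j))) + (\<Sum>j\<in>{0<..J + 1}. cos (\<theta> (2 * j - 1))))"
    by (simp add: G_def \<theta>_def)
  have floor: "real (nat \<lfloor>x\<rfloor>) \<le> x" "x < real (nat \<lfloor>x\<rfloor>) + 1" if "0 \<le> x" for x :: real
    using that by (simp_all add: of_nat_nat)
  \<comment> \<open>Cut-offs in \<open>j\<close>: up to \<open>t\<close> both \<open>2 * j\<close>
    and \<open>2 * j - 1\<close> are at most \<open>R\<close>; up to \<open>T\<close> the angle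
    \<open>\<theta> (2 * j)\<close> is at most \<open>pi\<close>, so its sine is nonnegative; up to
    \<open>T'\<close> the angle \<open>\<theta> (2 * j - 1)\<close> is at most
    \<open>pi / 2\<close>, so its cosine is nonnegative.\<close>
  define t where "t = nat \<lfloor>R / 2\<rfloor>"
  have t: "real t \<le> R / 2" "R / 2 < real t + 1" using floor[of "R / 2"] R8 by (simp_all add: t_def)
  define T where "T = nat \<lfloor>sqrt (real k / 2)\<rfloor>"
  have T: "real T \<le> sqrt (real k / 2)" "sqrt (real k / 2) < real T + 1"
    using floor[of "sqrt (real k / 2)"] by (simp_all add: T_def)
  define T' where "T' = nat \<lfloor>(R + 1) / 2\<rfloor>"
  have T': "real T' \<le> (R + 1) / 2" "(R + 1) / 2 < real T' + 1"
    using floor[of "(R + 1) / 2"] R8 by (simp_all add: T'_def)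
  have R7: "7 / 10 * R \<le> sqrt (real k / 2)"
    by (rule real_le_rsqrt) (simp add: kR power2_eq_square)
  have "8 * R \<le> real k" using mult_right_mono[OF R8, of R] R8 by (simp add: kR power2_eq_square)
  hence tJ: "t \<le> J" using t R8 by (simp add: k_def)
  have "real t < real T + 1" using t T R7 R8 by linarith
  hence tT: "t \<le> T" by linarith
  have "real t < real T' + 1" using t(1) T'(2) by (simp add: field_simps)
  hence tT': "t \<le> T'" by linarith
  have le1: "real n ^ 2 / real k \<le> 1" if "real n \<le> R" for n
    using that kpos by (simp add: kR power_mono)
  \<comment> \<open>The tail starts at \<open>m \<ge> 14 / 10 * R\<close>, with
    \<open>7 / 10\<close> a rational lower bound for \<open>1 / sqrt 2\<close>; hence
    \<open>k / (2 * m) \<le> R / 2.8\<close>, rounded up to \<open>36 / 100 * R\<close>.\<close>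
  have E: "(\<Sum>j\<in>{0<..t}. real (2 * j) ^ 2 / real k) - 36 / 100 * R \<le> (\<Sum>j\<in>{0<..J}. sin (\<theta> (2 * j)))"
  proof (rule sum_ge_main_minus_tail[OF _ _ tT tJ])
    fix j assume "j \<in> {0<..t}"
    hence "real (2 * j) \<le> R" using t by simp
    from le1[OF this] show "real (2 * j) ^ 2 / real k \<le> sin (\<theta> (2 * j))"
      using sin_half_pi_ge[of "real (2 * j) ^ 2 / real k"] by (simp add: \<theta>_def)
  next
    fix j assume "j \<in> {t<..T}"
    hence "real j \<le> sqrt (real k / 2)" using T by simp
    hence "real j ^ 2 \<le> sqrt (real k / 2) ^ 2" by (intro power_mono) auto
    hence "2 * real j ^ 2 / real k \<le> 1" using kpos by simp
    hence "pi * (2 * real j ^ 2 / real k) \<le> pi * 1" by (intro mult_left_mono) auto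
    moreover have "\<theta> (2 * j) = pi * (2 * real j ^ 2 / real k)" by (simp add: \<theta>_def power2_eq_square)
    ultimately show "0 \<le> sin (\<theta> (2 * j))" using kpos by (intro sin_ge_zero) auto
  next
    assume TJ: "T < J"
    define m where "m = 2 * (real T + 1)"
    let ?z = "\<Sum>i\<le>J - T - 1. cis (pi * (m + 2 * real i) ^ 2 / (2 * real k))"
    have m: "14 / 10 * R \<le> m" using T R7 by (simp add: m_def)
    have "(\<Sum>j\<in>{T<..J}. sin (\<theta> (2 * j))) = Im ?z"
      unfolding sum_tail_shift[OF TJ] by (simp add: \<theta>_def m_def algebra_simps)
    moreover have "norm ?z \<le> real k / (2 * m)"
      using TJ kpos by (intro norm_quadratic_phase_sum_le) (auto simp: m_def k_def of_nat_diff)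
    ultimately have "\<bar>\<Sum>j\<in>{T<..J}. sin (\<theta> (2 * j))\<bar> \<le> real k / (2 * m)"
      using abs_Im_le_cmod[of ?z] by linarith
    also have "\<dots> \<le> real k / (2 * (14 / 10 * R))" using m R8 kpos by (intro divide_left_mono) auto
    also have "\<dots> \<le> 36 / 100 * R" using R8 by (simp add: kR power2_eq_square)
    finally show "\<bar>\<Sum>j\<in>{T<..J}. sin (\<theta> (2 * j))\<bar> \<le> 36 / 100 * R" .
  qed (use R8 in auto)
  have O: "(\<Sum>j\<in>{0<..t}. 1 - real (2 * j - 1) ^ 2 / real k) - R / 2 \<le> (\<Sum>j\<in>{0<..J + 1}. cos (\<theta> (2 * j - 1)))"
  proof (rule sum_ge_main_minus_tail[OF _ _ tT'])
    fix j assume "j \<in> {0<..t}"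
    hence "real (2 * j - 1) \<le> R" using t by (simp add: of_nat_diff)
    from le1[OF this] show "1 - real (2 * j - 1) ^ 2 / real k \<le> cos (\<theta> (2 * j - 1))"
      using cos_half_pi_ge[of "real (2 * j - 1) ^ 2 / real k"] by (simp add: \<theta>_def)
  next
    fix j assume "j \<in> {t<..T'}"
    hence "real (2 * j - 1) \<le> R" using T' by (simp add: of_nat_diff)
    from le1[OF this] show "0 \<le> cos (\<theta> (2 * j - 1))"
      using cos_half_pi_ge[of "real (2 * j - 1) ^ 2 / real k"] by (simp add: \<theta>_def)
  next
    assume TJ: "T' < J + 1"
    define m where "m = 2 * real T' + 1"
    let ?z = "\<Sum>i\<le>J + 1 - T' - 1. cis (pi * (m + 2 * real i) ^ 2 / (2 * real k))"
    have m: "R \<le> m" using T' by (simp add: m_def)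
    have "(\<Sum>j\<in>{T'<..J + 1}. cos (\<theta> (2 * j - 1))) = Re ?z"
      unfolding sum_tail_shift[OF TJ] by (simp add: \<theta>_def m_def algebra_simps)
    moreover have "norm ?z \<le> real k / (2 * m)"
      using TJ kpos by (intro norm_quadratic_phase_sum_le) (auto simp: m_def k_def of_nat_diff)
    ultimately have "\<bar>\<Sum>j\<in>{T'<..J + 1}. cos (\<theta> (2 * j - 1))\<bar> \<le> real k / (2 * m)"
      using abs_Re_le_cmod[of ?z] by linarith
    also have "\<dots> \<le> real k / (2 * R)" using m R8 kpos by (intro divide_left_mono) auto
    also have "\<dots> = R / 2" using R8 by (simp add: kR power2_eq_square)
    finally show "\<bar>\<Sum>j\<in>{T'<..J + 1}. cos (\<theta> (2 * j - 1))\<bar> \<le> R / 2" .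
  qed (use R8 tJ in auto)
  \<comment> \<open>The lower bounds for the terms \<open>2 * j\<close> and \<open>2 * j - 1\<close>
    are paired: the larger square is added and the smaller one subtracted, so each pair gives at
    least 1.\<close>
  have "real t = (\<Sum>j\<in>{0<..t}. 1)" by simp
  also have "\<dots> \<le> (\<Sum>j\<in>{0<..t}. real (2 * j) ^ 2 / real k + (1 - real (2 * j - 1) ^ 2 / real k))"
  proof (rule sum_mono)
    fix j
    have "real (2 * j - 1) ^ 2 / real k \<le> real (2 * j) ^ 2 / real k"
      by (intro divide_right_mono power_mono) auto
    thus "1 \<le> real (2 * j) ^ 2 / real k + (1 - real (2 * j - 1) ^ 2 / real k)" by simp
  qed
  also have "\<dots> = (\<Sum>j\<in>{0<..t}. real (2 * j) ^ 2 / real k) + (\<Sum>j\<in>{0<..t}. 1 - real (2 * j - 1) ^ 2 / real k)"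
    by (rule sum.distrib)
  finally have "2 * (real t - 86 / 100 * R) \<le> Im (\<Sum>n\<in>{0..<int k}. ?f n)" using E O ImG by (simp add: field_simps)
  \<comment> \<open>From \<open>t > R / 2 - 1\<close> the right side exceeds
    \<open>- 0.72 * R - 2\<close>, which is above \<open>- R\<close> once \<open>R \<ge> 8\<close>;
    hence the assumption \<open>64 \<le> k\<close>.\<close>
  moreover have "- R < 2 * (real t - 86 / 100 * R)" using t(2) R8 by (simp add: field_simps)
  ultimately show ?thesis unfolding R_def by linarith
qed

subsection \<open>Averages of character sums over short windows\<close>

text \<open>This is \<open>char_sum_below\<close> at integer points. The oriented second sum makes
  the unit-step relation hold on all integers, so windows may lie around negative or zero positions
  as well.\<close>

definition partial_sum :: "(int \<Rightarrow> complex) \<Rightarrow> int \<Rightarrow> complex" where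
  "partial_sum \<chi> m = (\<Sum>n\<in>{1..<m}. \<chi> n) - (\<Sum>n\<in>{m..0}. \<chi> n)"

lemma partial_sum_step: "partial_sum \<chi> (m + 1) = partial_sum \<chi> m + \<chi> m"
proof (cases "m \<ge> 1")
  case True
  have "{1..<m + 1} = insert m {1..<m}" using True by auto
  thus ?thesis using True by (simp add: partial_sum_def)
next
  case False
  have "{m..0} = insert m {m + 1..0}" using False by auto
  thus ?thesis using False by (simp add: partial_sum_def)
qed

lemma sin_pi_frac_pos: "0 < k \<Longrightarrow> k < int q \<Longrightarrow> 0 < sin (pi * (of_int k / real q))"
  by (intro sin_gt_zero) (auto simp: field_simps)

text \<open>Both sides vanish at \<open>m = 1\<close> and have the same increments: the sine
  quotient grows by \<open>cos (2 * pi * k * m / q)\<close>, whose sum against the even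
  \<open>\<chi>\<close> is \<open>\<chi> m\<close> times the Gauss sum, and the Gauss sum squares to
  \<open>q\<close>. Integer induction then runs in both directions from 1.\<close>

lemma partial_sum_eq_sine_sum:
  assumes prim: "primitive_char q \<chi>" and quad: "quadratic_char q \<chi>" and even: "even_char \<chi>"
  shows "partial_sum \<chi> m = gauss_sum q \<chi> 1 / of_nat q * (\<Sum>k\<in>{0<..<int q}. \<chi> k *
           of_real (sin ((2 * of_int m - 1) * (pi * (of_int k / real q))) / (2 * sin (pi * (of_int k / real q)))))"
    (is "_ = ?c * ?T m")
proof -
  have d: "dirichlet_char q \<chi>" using prim by (simp add: primitive_char_def)
  have q: "q > 0" using d by (simp add: dirichlet_char_def)
  \<comment> \<open>This gives \<open>\<chi> 0 = 0\<close>, which removes the frequency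
    \<open>k = 0\<close>, where the sine in the denominator vanishes.\<close>
  have "q \<noteq> 1"
  proof
    assume "q = 1"
    hence "\<chi> n = 1" for n
      using dirichlet_char_cong[OF d, of n 1] dirichlet_char_one[OF d] by simp
    hence "\<chi> = principal_char q" using \<open>q = 1\<close> by (simp add: principal_char_def fun_eq_iff)
    thus False using quad by (simp add: quadratic_char_def)
  qed
  hence "\<not> coprime 0 (int q)" by simp
  hence \<chi>0: "\<chi> 0 = 0" using d unfolding dirichlet_char_def by blast
  have ins: "{0..<int q} = insert 0 {0<..<int q}" using q by auto
  let ?\<tau> = "gauss_sum q \<chi> 1"
  have \<tau>2: "?\<tau> * ?\<tau> = of_nat q"
    using gauss_sum_square[OF prim quad] even by (simp add: even_char_def power2_eq_square)
  have gs: "(\<Sum>k\<in>{0<..<int q}. \<chi> k * add_char q (k * n)) = \<chi> n * ?\<tau>" for n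
    using gauss_sum_primitive[OF prim quad, of n] by (simp add: gauss_sum_def ins \<chi>0)
  have ev: "\<chi> (- n) = \<chi> n" for n
  proof -
    have "\<chi> (- 1 * n) = \<chi> (- 1) * \<chi> n" using d unfolding dirichlet_char_def by metis
    thus ?thesis using even by (simp add: even_char_def)
  qed
  have step: "?T (m + 1) = ?T m + \<chi> m * ?\<tau>" for m
  proof -
    have "?T (m + 1) - ?T m = (\<Sum>k\<in>{0<..<int q}. \<chi> k * ((add_char q (k * m) + add_char q (k * (- m))) / 2))"
      unfolding sum_subtractf[symmetric]
    proof (intro sum.cong refl)
      fix k assume k: "k \<in> {0<..<int q}"
      define x where "x = pi * (of_int k / real q)"
      have s: "sin x > 0" using sin_pi_frac_pos k by (simp add: x_def)
      have "sin ((2 * of_int (m + 1) - 1) * x) - sin ((2 * of_int m - 1) * x) = 2 * cos (2 * of_int m * x) * sin x"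
        using sin_add[of "2 * of_int m * x" x] sin_diff[of "2 * of_int m * x" x] by (simp add: algebra_simps)
      hence "sin ((2 * of_int (m + 1) - 1) * x) / (2 * sin x) - sin ((2 * of_int m - 1) * x) / (2 * sin x) = cos (2 * of_int m * x)"
        using s by (simp add: diff_divide_distrib[symmetric])
      moreover have "(add_char q (k * m) + add_char q (k * (- m))) / 2 = of_real (cos (2 * of_int m * x))"
        by (simp add: add_char_def x_def complex_eq_iff mult_ac)
      ultimately show "\<chi> k * of_real (sin ((2 * of_int (m + 1) - 1) * (pi * (of_int k / real q))) / (2 * sin (pi * (of_int k / real q))))
          - \<chi> k * of_real (sin ((2 * of_int m - 1) * (pi * (of_int k / real q))) / (2 * sin (pi * (of_int k / real q))))
          = \<chi> k * ((add_char q (k * m) + add_char q (k * (- m))) / 2)"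
        unfolding x_def[symmetric] by (metis of_real_diff right_diff_distrib)
    qed
    also have "\<dots> = ((\<Sum>k\<in>{0<..<int q}. \<chi> k * add_char q (k * m)) + (\<Sum>k\<in>{0<..<int q}. \<chi> k * add_char q (k * (- m)))) / 2"
      unfolding sum.distrib[symmetric] sum_divide_distrib by (simp add: ring_distribs)
    also have "\<dots> = \<chi> m * ?\<tau>" unfolding gs ev by simp
    finally show ?thesis by (simp add: algebra_simps)
  qed
  have T1: "?T 1 = 0"
  proof -
    have "?T 1 = (\<Sum>k\<in>{0<..<int q}. \<chi> k * add_char q (k * 0)) / 2"
      unfolding sum_divide_distrib
    proof (intro sum.cong refl)
      fix k assume "k \<in> {0<..<int q}"
      hence "sin (pi * (of_int k / real q)) > 0" using sin_pi_frac_pos by simp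
      thus "\<chi> k * of_real (sin ((2 * of_int 1 - 1) * (pi * (of_int k / real q))) / (2 * sin (pi * (of_int k / real q))))
        = \<chi> k * add_char q (k * 0) / 2" by simp
    qed
    thus ?thesis unfolding gs by (simp add: \<chi>0)
  qed
  have cstep: "?c * ?T (m + 1) = ?c * ?T m + \<chi> m" for m
  proof -
    have "?c * (\<chi> m * ?\<tau>) = \<chi> m * (?\<tau> * ?\<tau>) / of_nat q" by simp
    thus ?thesis unfolding step using q \<tau>2 by (simp add: distrib_left)
  qed
  show ?thesis
  proof (induction m rule: int_induct[where k = 1])
    case base
    show ?case by (simp only: T1) (simp add: partial_sum_def)
  next
    case (step1 i)
    thus ?case using partial_sum_step[of \<chi> i] cstep[of i] by simp
  next
    case (step2 i)
    thus ?case using partial_sum_step[of \<chi> "i - 1"] cstep[of "i - 1"] by simp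
  qed
qed

text \<open>Enlarging the window adds \<open>2 * sin y * cos z\<close>, and
  \<open>2 * cos z * sin x\<close> telescopes as \<open>sin (z + x) - sin (z - x)\<close>. The
  resulting bound does not grow with \<open>H\<close>, which is the gain from averaging.\<close>

lemma sum_sin_window:
  fixes x :: real
  shows "(\<Sum>m\<in>{m0 - int H..m0 + int H}. sin ((2 * of_int m - 1) * x)) * sin x
          = sin ((2 * of_int m0 - 1) * x) * sin ((2 * real H + 1) * x)"
proof (induction H)
  case (Suc H)
  define y where "y = (2 * of_int m0 - 1) * x"
  define z where "z = (2 * real H + 2) * x"
  have "{m0 - int (Suc H)..m0 + int (Suc H)} = insert (m0 + int (Suc H)) (insert (m0 - int (Suc H)) {m0 - int H..m0 + int H})"
    by auto
  hence "(\<Sum>m\<in>{m0 - int (Suc H)..m0 + int (Suc H)}. sin ((2 * of_int m - 1) * x)) * sin x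
     = (sin (y + z) + sin (y - z)) * sin x
       + (\<Sum>m\<in>{m0 - int H..m0 + int H}. sin ((2 * of_int m - 1) * x)) * sin x"
    by (simp add: y_def z_def algebra_simps)
  also have "\<dots> = (sin (y + z) + sin (y - z)) * sin x + sin y * sin (z - x)"
    unfolding Suc by (simp add: y_def z_def algebra_simps)
  also have "\<dots> = sin y * sin (z + x)" by (simp add: sin_add sin_diff algebra_simps)
  finally show ?case by (simp add: y_def z_def algebra_simps)
qed simp

lemma abs_sum_sin_window_le:
  fixes x :: real
  assumes "sin x > 0"
  shows "\<bar>\<Sum>m\<in>{m0 - int H..m0 + int H}. sin ((2 * of_int m - 1) * x)\<bar> \<le> 1 / sin x"
proof -
  let ?S = "\<Sum>m\<in>{m0 - int H..m0 + int H}. sin ((2 * of_int m - 1) * x)"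
  have "\<bar>?S\<bar> * sin x = \<bar>sin ((2 * of_int m0 - 1) * x)\<bar> * \<bar>sin ((2 * real H + 1) * x)\<bar>"
    using sum_sin_window[of x m0 H] assms by (metis abs_mult abs_of_pos)
  also have "\<dots> \<le> 1 * 1" by (intro mult_mono) auto
  finally show ?thesis using assms by (simp add: field_simps)
qed

lemma sum_inverse_square_le:
  assumes "N \<ge> 1"
  shows "(\<Sum>k\<in>{int N<..<M}. 1 / (of_int k)\<^sup>2) \<le> 1 / real N"
proof (cases "M \<le> int N + 1")
  case True
  hence "{int N<..<M} = {}" by auto
  thus ?thesis by (simp only:) simp
next
  case False
  have "(\<Sum>k\<in>{int N<..<int N + 1 + int j}. 1 / (of_int k)\<^sup>2) \<le> 1 / real N - 1 / real (N + j)" for j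
  proof (induction j)
    case 0
    have "{int N<..<int N + 1 + int 0} = {}" by auto
    thus ?case by (simp only:) simp
  next
    case (Suc j)
    have "{int N<..<int N + 1 + int (Suc j)} = insert (int (N + j + 1)) {int N<..<int N + 1 + int j}" by auto
    moreover have "1 / (real (N + j + 1))\<^sup>2 \<le> 1 / real (N + j) - 1 / real (N + j + 1)"
    proof -
      have "1 / real (N + j) - 1 / real (N + j + 1) = 1 / (real (N + j) * real (N + j + 1))"
        using assms by (simp add: field_simps)
      thus ?thesis using assms by (simp add: power2_eq_square frac_le)
    qed
    ultimately show ?case using Suc by simp
  qed
  from this[of "nat (M - int N - 1)"] False
  have "(\<Sum>k\<in>{int N<..<M}. 1 / (of_int k)\<^sup>2) \<le> 1 / real N - 1 / real (N + nat (M - int N - 1))" by simp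
  also have "\<dots> \<le> 1 / real N" by simp
  finally show ?thesis .
qed

text \<open>From \<open>x * cos x \<le> sin x\<close> and \<open>1 \<le> sin x + cos x\<close> one
  gets \<open>x - sin x \<le> x * sin x\<close>, which is the numerator against the denominator of
  the difference.\<close>

lemma inverse_sin_minus_inverse_le:
  assumes "0 < x" "x \<le> pi / 2"
  shows "\<bar>1 / sin x - 1 / x\<bar> \<le> 1"
proof -
  have s: "0 < sin x" using assms pi_gt_zero by (intro sin_gt_zero) linarith+
  obtain z where z: "0 < z" "z < x" "sin x - sin 0 = (x - 0) * cos z"
    using MVT2[OF assms(1), of sin cos] DERIV_sin by blast
  have "cos x \<le> cos z" using z assms by (intro cos_monotone_0_pi_le) auto
  hence xc: "x * cos x \<le> sin x" using z assms by (simp add: mult_left_mono)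
  have "0 \<le> cos x" using assms by (intro cos_ge_zero) auto
  have "1 \<le> sin x + cos x"
  proof (rule power2_le_imp_le)
    have "(sin x + cos x) ^ 2 = 1 + 2 * sin x * cos x"
      using sin_cos_squared_add[of x] by (simp add: power2_sum)
    thus "1 ^ 2 \<le> (sin x + cos x) ^ 2" using s \<open>0 \<le> cos x\<close> by simp
  qed (use s \<open>0 \<le> cos x\<close> in simp)
  hence "x \<le> x * sin x + x * cos x" using assms by (metis distrib_left less_imp_le mult.right_neutral mult_left_mono)
  hence "x - sin x \<le> x * sin x" using xc by linarith
  moreover have "sin x \<le> x" using assms by (intro sin_x_le_x) auto
  moreover have "1 / sin x - 1 / x = (x - sin x) / (x * sin x)" using s assms by (simp add: field_simps)
  ultimately show ?thesis using s assms by simp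
qed

lemma abs_sin_diff_le: "\<bar>sin u - sin v\<bar> \<le> \<bar>u - v\<bar>" for u v :: real
proof -
  have "sin u - sin v = 2 * sin ((u - v) / 2) * cos ((u + v) / 2)" by (simp add: sin_diff_sin)
  hence "\<bar>sin u - sin v\<bar> = 2 * \<bar>sin ((u - v) / 2)\<bar> * \<bar>cos ((u + v) / 2)\<bar>" by (simp add: abs_mult)
  also have "\<dots> \<le> 2 * \<bar>(u - v) / 2\<bar> * 1"
    by (intro mult_mono abs_sin_x_le_abs_x) auto
  finally show ?thesis by simp
qed

text \<open>A discrete intermediate value argument: if every value were more than 1 away from
  \<open>A\<close>, a step of size at most 1 could not cross from one side to the other, so all
  values would lie on one side of their own average.\<close>

lemma exists_near_average:
  fixes S :: "int \<Rightarrow> real"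
  assumes step: "\<And>m. \<bar>S (m + 1) - S m\<bar> \<le> 1" and "l \<le> u"
    and avg: "(\<Sum>m\<in>{l..u}. S m) = of_int (u - l + 1) * A"
  shows "\<exists>m\<in>{l..u}. \<bar>S m - A\<bar> \<le> 1"
proof (rule ccontr)
  assume "\<not> ?thesis"
  hence far: "\<bar>S m - A\<bar> > 1" if "m \<in> {l..u}" for m using that by force
  have sum0: "(\<Sum>m\<in>{l..u}. S m - A) = 0" using avg \<open>l \<le> u\<close> by (simp add: sum_subtractf)
  show False
  proof (cases "S l > A")
    case True
    have "m \<le> u \<longrightarrow> S m > A" if "l \<le> m" for m
      using that
    proof (induction m rule: int_ge_induct)
      case (step i)
      thus ?case using far[of i] assms(1)[of i] by auto
    qed (use True in simp)
    hence "(\<Sum>m\<in>{l..u}. S m - A) > 0" using \<open>l \<le> u\<close> by (intro sum_pos) auto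
    thus False using sum0 by simp
  next
    case False
    have "m \<le> u \<longrightarrow> S m < A" if "l \<le> m" for m
      using that
    proof (induction m rule: int_ge_induct)
      case base
      show ?case using False far[of l] \<open>l \<le> u\<close> by auto
    next
      case (step i)
      thus ?case using far[of i] assms(1)[of i] by auto
    qed
    hence "(\<Sum>m\<in>{l..u}. A - S m) > 0" using \<open>l \<le> u\<close> by (intro sum_pos) auto
    thus False using sum0 by (simp add: sum_subtractf)
  qed
qed

section \<open>Harmonic sums with periodic coefficients\<close>

lemma ln_le_harmonic_sum: "ln (real N + 1) \<le> (\<Sum>k\<in>{1..N}. 1 / real k)"
proof (induction N)
  case (Suc n)
  have "ln (real (Suc n) + 1) = ln (real n + 1) + ln (1 + 1 / (real n + 1))"
  proof -
    have "real (Suc n) + 1 = (real n + 1) * (1 + 1 / (real n + 1))" by (simp add: field_simps)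
    thus ?thesis by (simp only:) (rule ln_mult_pos, auto simp: add_pos_nonneg)
  qed
  also have "ln (1 + 1 / (real n + 1)) \<le> 1 / (real n + 1)" by (intro ln_add_one_self_le_self) simp
  finally show ?case using Suc by (simp add: add.commute)
qed simp

lemma harmonic_sum_le_ln:
  assumes "N \<ge> 1"
  shows "(\<Sum>k\<in>{1..N}. 1 / real k) \<le> 1 + ln (real N)"
  using assms
proof (induction N rule: nat_induct_at_least)
  case (Suc n)
  have "ln (real n) = ln (real (Suc n)) + ln (1 + - 1 / real (Suc n))"
  proof -
    have "real n = real (Suc n) * (1 + - 1 / real (Suc n))" by (simp add: field_simps)
    moreover have "1 + - 1 / real (Suc n) > 0" using Suc.hyps by (simp add: field_simps)
    ultimately show ?thesis by (metis ln_mult_pos of_nat_0_less_iff zero_less_Suc)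
  qed
  also have "ln (1 + - 1 / real (Suc n)) \<le> - 1 / real (Suc n)"
    using Suc.hyps by (intro ln_add_one_self_le_self2) (simp add: field_simps)
  finally show ?case using Suc.IH by simp
qed simp

text \<open>After subtracting the mean, the partial sums \<open>D\<close> are
  \<open>b\<close>-periodic and at most \<open>2 * b\<close>, so summation by parts against
  \<open>1 / k\<close> costs \<open>4 * b\<close>. The mean itself meets the harmonic sum, which is
  within 1 of \<open>ln N\<close>.\<close>

lemma periodic_sum_ln:
  fixes g :: "int \<Rightarrow> real" and b N :: nat
  assumes b: "b > 0" and per: "\<And>n. g (n mod int b) = g n" and g1: "\<And>n. \<bar>g n\<bar> \<le> 1"
    and mean: "(\<Sum>k\<in>{0..<int b}. g k) = real b * \<mu>" and N: "N \<ge> 1"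
  shows "\<bar>(\<Sum>k\<in>{1..N}. g (int k) / real k) - \<mu> * ln (real N)\<bar> \<le> 4 * real b + 1"
proof -
  have "real b * \<bar>\<mu>\<bar> = \<bar>\<Sum>k\<in>{0..<int b}. g k\<bar>" using mean by (simp add: abs_mult)
  also have "\<dots> \<le> (\<Sum>k\<in>{0..<int b}. \<bar>g k\<bar>)" by (rule sum_abs)
  also have "\<dots> \<le> (\<Sum>k\<in>{0..<int b}. 1)" using g1 by (intro sum_mono)
  finally have \<mu>: "\<bar>\<mu>\<bar> \<le> 1" using b by simp
  define D where "D i = (\<Sum>j<i. g (int j + 1) - \<mu>)" for i
  have D_per: "D (i + b) = D i" for i
  proof -
    have "(\<Sum>j<b. g (int (i + j) + 1)) = (\<Sum>k\<in>{0..<int b}. g k)"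
    proof (rule sum_complete_residues[where f = g and g = "\<lambda>j. int (i + j) + 1"])
      show "inj_on (\<lambda>j. (int (i + j) + 1) mod int b) {..<b}"
      proof (rule inj_onI)
        fix x y assume xy: "x \<in> {..<b}" "y \<in> {..<b}" and "(int (i + x) + 1) mod int b = (int (i + y) + 1) mod int b"
        hence "[int x + (int i + 1) = int y + (int i + 1)] (mod int b)" by (simp add: cong_def add_ac)
        hence "[int x = int y] (mod int b)" by (simp only: cong_add_rcancel)
        thus "x = y" using xy by (simp add: cong_def)
      qed
    qed (use b per in auto)
    moreover have "D (i + b) = D i + (\<Sum>j<b. g (int (i + j) + 1) - \<mu>)"
      unfolding D_def by (simp only: sum.nat_group[symmetric] lessThan_atLeast0 sum.atLeastLessThan_concat[symmetric, of 0 i "i + b"])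
         (use sum.shift_bounds_nat_ivl[of "\<lambda>j. g (int j + 1) - \<mu>" 0 i b] in \<open>simp add: add.commute\<close>)
    ultimately show ?thesis using mean by (simp add: sum_subtractf)
  qed
  have D: "\<bar>D i\<bar> \<le> 2 * real b" for i
  proof (induction i rule: less_induct)
    case (less i)
    show ?case
    proof (cases "i < b")
      case True
      have "\<bar>D i\<bar> \<le> (\<Sum>j<i. \<bar>g (int j + 1) - \<mu>\<bar>)" unfolding D_def by (rule sum_abs)
      also have "\<dots> \<le> (\<Sum>j<i. 2)"
      proof (rule sum_mono)
        show "\<bar>g (int j + 1) - \<mu>\<bar> \<le> 2" for j using g1[of "int j + 1"] \<mu> by linarith
      qed
      also have "\<dots> \<le> 2 * real b" using True by simp
      finally show ?thesis .
    next
      case False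
      thus ?thesis using less[of "i - b"] D_per[of "i - b"] b by simp
    qed
  qed
  obtain n where n: "N = Suc n" using N by (cases N) auto
  have "(\<Sum>k\<in>{1..N}. (g (int k) - \<mu>) / real k) = (\<Sum>i\<le>n. (1 / real (Suc i)) *\<^sub>R (D (Suc i) - D i))"
    unfolding n One_nat_def sum.atLeast_Suc_atMost_Suc_shift atLeast0AtMost by (simp add: D_def add.commute)
  also have "\<bar>\<dots>\<bar> \<le> 2 * (1 / real (Suc 0)) * (2 * real b)"
    unfolding real_norm_def[symmetric]
    by (rule norm_sum_abel_le) (use D in \<open>auto simp: field_simps\<close>)
  finally have 1: "\<bar>\<Sum>k\<in>{1..N}. (g (int k) - \<mu>) / real k\<bar> \<le> 4 * real b" by simp
  have "\<bar>\<mu> * ((\<Sum>k\<in>{1..N}. 1 / real k) - ln (real N))\<bar> \<le> 1 * 1"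
  proof -
    have "ln (real N) \<le> ln (real N + 1)" using N by simp
    hence "\<bar>(\<Sum>k\<in>{1..N}. 1 / real k) - ln (real N)\<bar> \<le> 1"
      using ln_le_harmonic_sum[of N] harmonic_sum_le_ln[OF N] by linarith
    thus ?thesis unfolding abs_mult using \<mu> by (intro mult_mono) auto
  qed
  moreover have "(\<Sum>k\<in>{1..N}. g (int k) / real k) - \<mu> * ln (real N) =
     (\<Sum>k\<in>{1..N}. (g (int k) - \<mu>) / real k) + \<mu> * ((\<Sum>k\<in>{1..N}. 1 / real k) - ln (real N))"
    by (simp add: diff_divide_distrib sum_subtractf right_diff_distrib sum_distrib_left)
  ultimately show ?thesis using 1 by linarith
qed

text \<open>Frequencies near \<open>q\<close> fold onto those near 0; the factor 2 will cancel the 2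
  in the denominator \<open>2 * sin\<close>.\<close>

lemma sum_reflect_split:
  fixes F :: "int \<Rightarrow> real"
  assumes refl: "\<And>k. F (int q - k) = F k" and N: "2 * N < q"
  shows "(\<Sum>k\<in>{0<..<int q}. F k) = 2 * (\<Sum>k\<in>{1..N}. F (int k)) + (\<Sum>k\<in>{int N<..<int q - int N}. F k)"
proof -
  have "{0<..<int q} = {0<..int N} \<union> ({int N<..<int q - int N} \<union> {int q - int N..<int q})"
    using N by auto
  hence "(\<Sum>k\<in>{0<..<int q}. F k) = (\<Sum>k\<in>{0<..int N}. F k) +
      ((\<Sum>k\<in>{int N<..<int q - int N}. F k) + (\<Sum>k\<in>{int q - int N..<int q}. F k))"
    using N by (simp only:) (subst sum.union_disjoint, auto)+
  moreover have "(\<Sum>k\<in>{0<..int N}. F k) = (\<Sum>k\<in>{1..N}. F (int k))"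
    by (rule sum.reindex_bij_witness[of _ int nat]) auto
  moreover have "(\<Sum>k\<in>{int q - int N..<int q}. F k) = (\<Sum>k\<in>{0<..int N}. F k)"
    by (rule sum.reindex_bij_witness[of _ "\<lambda>k. int q - k" "\<lambda>k. int q - k"]) (auto simp: refl)
  ultimately show ?thesis by simp
qed

text \<open>On \<open>{0<..1/2}\<close> the sine of \<open>pi * x\<close> is at least
  \<open>2 * x\<close>. For each \<open>k\<close> one of \<open>k\<close> and \<open>q - k\<close>
  is at most \<open>q / 2\<close>, and adding the bounds for both gives two equal sums of inverse
  squares beyond \<open>N\<close>.\<close>

lemma sum_inverse_sin_square_le:
  assumes "1 \<le> N" "2 * N < q"
  shows "(\<Sum>k\<in>{int N<..<int q - int N}. 1 / (sin (pi * (of_int k / real q)))\<^sup>2) \<le> (real q)\<^sup>2 / (2 * real N)"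
proof -
  have q: "real q > 0" using assms by simp
  have half: "1 / (sin (pi * (of_int k / real q)))\<^sup>2 \<le> (real q)\<^sup>2 / 4 * (1 / (of_int k)\<^sup>2)"
    if "0 < k" "2 * k \<le> int q" for k
  proof -
    have "1 / sin (pi * (of_int k / real q)) \<le> 1 / (2 * (of_int k / real q))"
      "0 < sin (pi * (of_int k / real q))"
      using that q by (intro inverse_sin_le; simp add: field_simps)+
    hence "(1 / sin (pi * (of_int k / real q))) ^ 2 \<le> (1 / (2 * (of_int k / real q))) ^ 2"
      by (intro power_mono) auto
    also have "\<dots> = (real q)\<^sup>2 / 4 * (1 / (of_int k)\<^sup>2)" by (simp add: power_divide power_mult_distrib)
    finally show ?thesis by (simp add: power_divide)
  qed
  have "(\<Sum>k\<in>{int N<..<int q - int N}. 1 / (sin (pi * (of_int k / real q)))\<^sup>2)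
     \<le> (\<Sum>k\<in>{int N<..<int q - int N}. (real q)\<^sup>2 / 4 * (1 / (of_int k)\<^sup>2 + 1 / (of_int (int q - k))\<^sup>2))"
  proof (rule sum_mono)
    fix k assume k: "k \<in> {int N<..<int q - int N}"
    show "1 / (sin (pi * (of_int k / real q)))\<^sup>2 \<le> (real q)\<^sup>2 / 4 * (1 / (of_int k)\<^sup>2 + 1 / (of_int (int q - k))\<^sup>2)"
    proof (cases "2 * k \<le> int q")
      case True
      have "1 / (sin (pi * (of_int k / real q)))\<^sup>2 \<le> (real q)\<^sup>2 / 4 * (1 / (of_int k)\<^sup>2)" using half[of k] True k by simp
      also have "\<dots> \<le> (real q)\<^sup>2 / 4 * (1 / (of_int k)\<^sup>2 + 1 / (of_int (int q - k))\<^sup>2)" by (intro mult_left_mono) auto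
      finally show ?thesis .
    next
      case False
      have "pi * (of_int (int q - k) / real q) = pi - pi * (of_int k / real q)"
        using q by (simp add: field_simps)
      hence "sin (pi * (of_int k / real q)) = sin (pi * (of_int (int q - k) / real q))" by simp
      hence "1 / (sin (pi * (of_int k / real q)))\<^sup>2 \<le> (real q)\<^sup>2 / 4 * (1 / (of_int (int q - k))\<^sup>2)"
        using half[of "int q - k"] False k by simp
      also have "\<dots> \<le> (real q)\<^sup>2 / 4 * (1 / (of_int k)\<^sup>2 + 1 / (of_int (int q - k))\<^sup>2)" by (intro mult_left_mono) auto
      finally show ?thesis .
    qed
  qed
  also have "\<dots> = (real q)\<^sup>2 / 4 * ((\<Sum>k\<in>{int N<..<int q - int N}. 1 / (of_int k)\<^sup>2)
       + (\<Sum>k\<in>{int N<..<int q - int N}. 1 / (of_int (int q - k))\<^sup>2))"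
    by (simp only: sum_distrib_left[symmetric] sum.distrib)
  also have "(\<Sum>k\<in>{int N<..<int q - int N}. 1 / (of_int (int q - k))\<^sup>2) = (\<Sum>k\<in>{int N<..<int q - int N}. 1 / (real_of_int k)\<^sup>2)"
    by (rule sum.reindex_bij_witness[of _ "\<lambda>k. int q - k" "\<lambda>k. int q - k"]) auto
  also have "(real q)\<^sup>2 / 4 * ((\<Sum>k\<in>{int N<..<int q - int N}. 1 / (real_of_int k)\<^sup>2)
       + (\<Sum>k\<in>{int N<..<int q - int N}. 1 / (real_of_int k)\<^sup>2)) \<le> (real q)\<^sup>2 / 4 * (1 / real N + 1 / real N)"
    using sum_inverse_square_le[OF assms(1), of "int q - int N"] by (intro mult_left_mono add_mono) auto
  finally show ?thesis by simp
qed

text \<open>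
  Averaging over a window of length about \<open>q / N\<close> damps the frequencies beyond \<open>N\<close>. As the
  partial sums move in steps of size at most one, some value in the window is close to the average.
\<close>

lemma exists_partial_sum_approx:
  assumes prim: "primitive_char q \<chi>" and quad: "quadratic_char q \<chi>" and even: "even_char \<chi>"
    and N: "1 \<le> N" "2 * N < q"
  shows "\<exists>m::int. \<bar>of_int m - \<beta> * real q\<bar> \<le> real q / real N + 2 \<and>
     norm (partial_sum \<chi> m - gauss_sum q \<chi> 1 *
        (\<Sum>k\<in>{1..N}. \<chi> (int k) * of_real (sin (2 * pi * real k * \<beta>) / (pi * real k)))) \<le> 1 + 16 * sqrt (real q)"
proof -
  have d: "dirichlet_char q \<chi>" using prim by (simp add: primitive_char_def)
  have q: "real q > 0" using N by simp
  define f where "f k = Re (\<chi> k)" for k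
  have \<chi>f: "\<chi> k = of_real (f k)" and f1: "\<bar>f k\<bar> \<le> 1" for k
    using quadratic_char_values[OF quad, of k] by (auto simp: f_def complex_eq_iff split: if_splits)
  have \<chi>neg: "\<chi> (- k) = \<chi> k" for k
  proof -
    have "\<chi> (- 1 * k) = \<chi> (- 1) * \<chi> k" using d unfolding dirichlet_char_def by metis
    thus ?thesis using even by (simp add: even_char_def)
  qed
  have frefl: "f (int q - k) = f k" for k
    using dirichlet_char_cong[OF d, of "int q - k" "- k"] \<chi>neg[of k] by (simp add: f_def cong_def)
  have "gauss_sum q \<chi> 1 ^ 2 = of_real (sqrt (real q)) ^ 2"
    using gauss_sum_square[OF prim quad] even by (simp add: even_char_def of_real_power[symmetric] del: of_real_power)
  then obtain \<rho> where \<rho>: "gauss_sum q \<chi> 1 = of_real \<rho>" "\<bar>\<rho>\<bar> = sqrt (real q)"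
    unfolding power2_eq_iff by (metis abs_minus_cancel abs_of_nonneg of_real_minus real_sqrt_ge_zero of_nat_0_le_iff)
  define x where "x k = pi * (of_int k / real q)" for k :: int
  define T where "T m = (\<Sum>k\<in>{0<..<int q}. f k * (sin ((2 * of_int m - 1) * x k) / (2 * sin (x k))))" for m :: int
  define S where "S m = \<rho> / real q * T m" for m
  have PS: "partial_sum \<chi> m = of_real (S m)" for m
    unfolding partial_sum_eq_sine_sum[OF prim quad even] \<chi>f S_def T_def x_def \<rho>(1) by simp
  have Sstep: "\<bar>S (m + 1) - S m\<bar> \<le> 1" for m
  proof -
    have "of_real (S (m + 1) - S m) = (of_real (f m) :: complex)"
      using partial_sum_step[of \<chi> m] unfolding PS \<chi>f by simp
    thus ?thesis using f1[of m] by (simp only: of_real_eq_iff)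
  qed
  \<comment> \<open>The half-width balances two demands: \<open>H \<ge> q / N\<close> damps the
    frequencies beyond \<open>N\<close>, while \<open>N * H \<le> q + N\<close> keeps the shift
    small for the frequencies up to \<open>N\<close>.\<close>
  define H where "H = q div N + 1"
  have H: "real q / real N \<le> real H" "real N * real H \<le> real q + real N" "real H \<le> real q / real N + 1"
  proof -
    have "q < N * H" using N unfolding H_def by (metis Suc_eq_plus1 dividend_less_times_div le_eq_less_or_eq less_le_trans mult_Suc_right add.commute zero_less_one)
    hence "real q < real N * real H" by (metis of_nat_less_iff of_nat_mult)
    thus "real q / real N \<le> real H" using N by (simp add: field_simps)
    have "N * H \<le> q + N" unfolding H_def by simp
    thus NH: "real N * real H \<le> real q + real N" by (metis of_nat_add of_nat_le_iff of_nat_mult)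
    thus "real H \<le> real q / real N + 1" using N by (simp add: field_simps)
  qed
  define m0 where "m0 = \<lfloor>\<beta> * real q\<rfloor>"
  define W where "W = {m0 - int H..m0 + int H}"
  have Wdist: "\<bar>of_int m - \<beta> * real q\<bar> \<le> real H + 1" if "m \<in> W" for m
  proof -
    have "of_int m0 \<le> \<beta> * real q" "\<beta> * real q < of_int m0 + 1" unfolding m0_def by linarith+
    moreover have "real_of_int m \<le> of_int m0 + real H" "of_int m0 - real H \<le> real_of_int m"
      using that unfolding W_def by auto
    ultimately show ?thesis by linarith
  qed
  define mid where "mid = {int N<..<int q - int N}"
  define Tg where "Tg = (\<Sum>k\<in>{1..N}. f (int k) * (sin (2 * pi * real k * \<beta>) * (1 / x (int k))))"
  have xk: "0 < of_int k / real q" "of_int k / real q \<le> 1 / 2" if "k \<in> {1..int N}" for k :: int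
    using that N q by (auto simp: field_simps)
  have spos: "sin (x k) > 0" if "0 < k" "k < int q" for k
    using sin_pi_frac_pos[OF that] by (simp add: x_def)
  have split: "T m = (\<Sum>k\<in>{1..N}. f (int k) * (sin ((2 * of_int m - 1) * x (int k)) * (1 / sin (x (int k)))))
      + (\<Sum>k\<in>mid. f k * (sin ((2 * of_int m - 1) * x k) / (2 * sin (x k))))" for m
  proof -
    have refl: "f (int q - k) * (sin ((2 * of_int m - 1) * x (int q - k)) / (2 * sin (x (int q - k))))
        = f k * (sin ((2 * of_int m - 1) * x k) / (2 * sin (x k)))" for k
    proof -
      have x': "x (int q - k) = pi - x k" using q by (simp add: x_def field_simps)
      \<comment> \<open>That \<open>2 * m - 1\<close> is odd matters: reflecting \<open>x k\<close>
        to \<open>pi - x k\<close> then leaves the sine unchanged instead of flipping its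
        sign.\<close>
      have "(2 * of_int m - 1) * x (int q - k) = (pi - (2 * of_int m - 1) * x k) + 2 * pi * of_int (m - 1)"
        unfolding x' by (simp add: algebra_simps)
      moreover have "sin ((pi - (2 * of_int m - 1) * x k) + 2 * pi * of_int (m - 1)) = sin (pi - (2 * of_int m - 1) * x k)"
        unfolding sin_add sin_int_2pin cos_int_2pin by simp
      ultimately have "sin ((2 * of_int m - 1) * x (int q - k)) = sin ((2 * of_int m - 1) * x k)"
        by simp
      thus ?thesis unfolding frefl x' by simp
    qed
    show ?thesis unfolding T_def sum_reflect_split[of "\<lambda>k. f k * (sin ((2 * of_int m - 1) * x k) / (2 * sin (x k)))", OF refl N(2)] mid_def
      by (simp add: sum_distrib_left)
  qed
  \<comment> \<open>Inside the window the argument moves by \<open>O(k * H / q)\<close> while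
    \<open>1 / sin\<close> is \<open>O(q / k)\<close>, so each term changes by \<open>O(H)\<close>
    whatever \<open>k\<close> is; passing from \<open>1 / sin\<close> to \<open>1 / x\<close> costs
    1 more. The total \<open>4 * N * H + 7 * N\<close> is at most \<open>4 * q + 11 * N\<close>,
    below \<open>15 * q\<close>.\<close>
  have low: "\<bar>(\<Sum>k\<in>{1..N}. f (int k) * (sin ((2 * of_int m - 1) * x (int k)) * (1 / sin (x (int k))))) - Tg\<bar> \<le> 15 * real q"
    if m: "m \<in> W" for m
  proof -
    have "\<bar>f (int k) * (sin ((2 * of_int m - 1) * x (int k)) * (1 / sin (x (int k)))) - f (int k) * (sin (2 * pi * real k * \<beta>) * (1 / x (int k)))\<bar>
        \<le> 4 * real H + 7" if k: "k \<in> {1..N}" for k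
    proof -
      define y where "y = x (int k)"
      define u where "u = (2 * of_int m - 1) * y"
      define v where "v = 2 * pi * real k * \<beta>"
      have k': "0 < real k / real q" "real k / real q \<le> 1 / 2" using xk[of "int k"] k by auto
      have y: "y = pi * (real k / real q)" by (simp add: y_def x_def)
      have "1 / sin y \<le> 1 / (2 * (real k / real q))" "sin y > 0"
        unfolding y by (intro inverse_sin_le k')+
      have "u - v = pi * (real k / real q) * (2 * (of_int m - \<beta> * real q) - 1)"
        using q by (simp add: u_def v_def y field_simps)
      moreover have "\<bar>2 * (of_int m - \<beta> * real q) - 1\<bar> \<le> 2 * real H + 3"
      proof -
        have "\<bar>2 * z - 1\<bar> \<le> 2 * real H + 3" if "\<bar>z\<bar> \<le> real H + 1" for z using that by linarith
        thus ?thesis using Wdist[OF m] by blast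
      qed
      ultimately have "\<bar>u - v\<bar> \<le> pi * (real k / real q) * (2 * real H + 3)"
        using k' by (simp only: abs_mult) (intro mult_mono, auto)
      hence uv: "\<bar>sin u - sin v\<bar> \<le> pi * (real k / real q) * (2 * real H + 3)"
        using abs_sin_diff_le[of u v] by linarith
      have "\<bar>(sin u - sin v) * (1 / sin y)\<bar> = \<bar>sin u - sin v\<bar> * (1 / sin y)"
        using \<open>sin y > 0\<close> by (simp add: abs_mult)
      also have "\<dots> \<le> (pi * (real k / real q) * (2 * real H + 3)) * (1 / (2 * (real k / real q)))"
        using uv \<open>1 / sin y \<le> _\<close> \<open>sin y > 0\<close> k' by (intro mult_mono) auto
      also have "\<dots> = pi / 2 * (2 * real H + 3)"
      proof -
        have "(pi * w * c) * (1 / (2 * w)) = pi / 2 * c" if "0 < w" for w c :: real using that by simp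
        thus ?thesis using k'(1) by blast
      qed
      also have "\<dots> \<le> 2 * (2 * real H + 3)" using pi_less_4 by (intro mult_right_mono) auto
      finally have 1: "\<bar>(sin u - sin v) * (1 / sin y)\<bar> \<le> 4 * real H + 6" by simp
      have "pi * (real k / real q) \<le> pi * (1 / 2)" using k' by (intro mult_left_mono) auto
      hence "\<bar>1 / sin y - 1 / y\<bar> \<le> 1" unfolding y using mult_pos_pos[OF pi_gt_zero k'(1)]
        by (intro inverse_sin_minus_inverse_le) simp_all
      hence "\<bar>sin v * (1 / sin y - 1 / y)\<bar> \<le> 1 * 1" unfolding abs_mult by (intro mult_mono) auto
      hence "\<bar>(sin u - sin v) * (1 / sin y) + sin v * (1 / sin y - 1 / y)\<bar> \<le> 4 * real H + 7" using 1 by linarith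
      moreover have "(sin u - sin v) * (1 / sin y) + sin v * (1 / sin y - 1 / y) = sin u * (1 / sin y) - sin v * (1 / y)"
        by (simp add: algebra_simps)
      ultimately have "\<bar>sin u * (1 / sin y) - sin v * (1 / y)\<bar> \<le> 4 * real H + 7" by simp
      hence "\<bar>f (int k)\<bar> * \<bar>sin u * (1 / sin y) - sin v * (1 / y)\<bar> \<le> 1 * (4 * real H + 7)"
        using f1 by (intro mult_mono) auto
      thus ?thesis unfolding u_def v_def y_def by (simp add: abs_mult[symmetric] right_diff_distrib)
    qed
    hence "\<bar>(\<Sum>k\<in>{1..N}. f (int k) * (sin ((2 * of_int m - 1) * x (int k)) * (1 / sin (x (int k))))) - Tg\<bar>
       \<le> (\<Sum>k\<in>{1..N}. 4 * real H + 7)"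
      unfolding Tg_def sum_subtractf[symmetric] by (intro order_trans[OF sum_abs] sum_mono)
    also have "\<dots> = 4 * (real N * real H) + 7 * real N" by (simp add: algebra_simps)
    also have "\<dots> \<le> 15 * real q" using H(2) N by simp
    finally show ?thesis .
  qed
  have cardW: "real (card W) = 2 * real H + 1" by (simp add: W_def)
  \<comment> \<open>The window sum of each sine is at most \<open>1 / sin (x k)\<close> however long
    the window is, so the total is at most \<open>q ^ 2 / (2 * N) \<le> H * q / 2\<close>, that is,
    less than \<open>q\<close> per point of the window.\<close>
  have high: "\<bar>\<Sum>m\<in>W. \<Sum>k\<in>mid. f k * (sin ((2 * of_int m - 1) * x k) / (2 * sin (x k)))\<bar> \<le> (2 * real H + 1) * real q"
  proof -
    have "(\<Sum>m\<in>W. \<Sum>k\<in>mid. f k * (sin ((2 * of_int m - 1) * x k) / (2 * sin (x k))))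
       = (\<Sum>k\<in>mid. f k / (2 * sin (x k)) * (\<Sum>m\<in>W. sin ((2 * of_int m - 1) * x k)))"
      by (subst sum.swap) (simp add: sum_distrib_left)
    also have "\<bar>\<dots>\<bar> \<le> (\<Sum>k\<in>mid. 1 / (sin (x k))\<^sup>2)"
    proof (intro order_trans[OF sum_abs] sum_mono)
      fix k assume "k \<in> mid"
      hence s: "sin (x k) > 0" using N by (intro spos) (auto simp: mid_def)
      have "\<bar>f k / (2 * sin (x k))\<bar> \<le> 1 / sin (x k)"
        using f1[of k] s by (simp add: abs_mult field_simps)
      moreover have "\<bar>\<Sum>m\<in>W. sin ((2 * of_int m - 1) * x k)\<bar> \<le> 1 / sin (x k)"
        unfolding W_def by (rule abs_sum_sin_window_le[OF s])
      ultimately have "\<bar>f k / (2 * sin (x k))\<bar> * \<bar>\<Sum>m\<in>W. sin ((2 * of_int m - 1) * x k)\<bar> \<le> 1 / sin (x k) * (1 / sin (x k))"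
        using s by (intro mult_mono) auto
      thus "\<bar>f k / (2 * sin (x k)) * (\<Sum>m\<in>W. sin ((2 * of_int m - 1) * x k))\<bar> \<le> 1 / (sin (x k))\<^sup>2"
        by (simp add: abs_mult power2_eq_square)
    qed
    also have "\<dots> \<le> (real q)\<^sup>2 / (2 * real N)"
      unfolding mid_def x_def by (rule sum_inverse_sin_square_le[OF N])
    also have "\<dots> = (real q / real N) * real q / 2" by (simp add: power2_eq_square)
    also have "\<dots> \<le> real H * real q / 2" using H(1) q by (intro divide_right_mono mult_right_mono) auto
    also have "\<dots> \<le> (2 * real H + 1) * real q" using q by (simp add: field_simps)
    finally show ?thesis .
  qed
  define A where "A = (\<Sum>m\<in>W. S m) / (2 * real H + 1)"
  have "\<exists>m\<in>W. \<bar>S m - A\<bar> \<le> 1"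
    unfolding W_def
    by (rule exists_near_average) (use Sstep in \<open>auto simp: A_def W_def[symmetric]\<close>)
  then obtain m where m: "m \<in> W" "\<bar>S m - A\<bar> \<le> 1" by blast
  have "(\<Sum>m\<in>W. T m) - (2 * real H + 1) * Tg = (\<Sum>m\<in>W. (\<Sum>k\<in>{1..N}. f (int k) * (sin ((2 * of_int m - 1) * x (int k)) * (1 / sin (x (int k))))) - Tg)
      + (\<Sum>m\<in>W. \<Sum>k\<in>mid. f k * (sin ((2 * of_int m - 1) * x k) / (2 * sin (x k))))"
    unfolding split sum.distrib sum_subtractf by (simp add: cardW)
  moreover have "\<bar>\<Sum>m\<in>W. (\<Sum>k\<in>{1..N}. f (int k) * (sin ((2 * of_int m - 1) * x (int k)) * (1 / sin (x (int k))))) - Tg\<bar> \<le> (\<Sum>m\<in>W. 15 * real q)"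
    by (intro order_trans[OF sum_abs] sum_mono low)
  moreover have "(\<Sum>m\<in>W. 15 * real q) = (2 * real H + 1) * (15 * real q)" by (simp add: cardW)
  ultimately have "\<bar>(\<Sum>m\<in>W. T m) - (2 * real H + 1) * Tg\<bar> \<le> (2 * real H + 1) * (16 * real q)"
    using high by (simp add: algebra_simps)
  hence "\<bar>((\<Sum>m\<in>W. T m) - (2 * real H + 1) * Tg) / (2 * real H + 1)\<bar> \<le> 16 * real q"
    by (simp add: abs_divide field_simps)
  moreover have "((\<Sum>m\<in>W. T m) - (2 * real H + 1) * Tg) / (2 * real H + 1) = (\<Sum>m\<in>W. T m) / (2 * real H + 1) - Tg"
    by (simp add: diff_divide_distrib)
  ultimately have TT: "\<bar>(\<Sum>m\<in>W. T m) / (2 * real H + 1) - Tg\<bar> \<le> 16 * real q" by simp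
  \<comment> \<open>The prefactor has absolute value \<open>1 / sqrt q\<close> and turns the error
    \<open>16 * q\<close> into \<open>16 * sqrt q\<close>.\<close>
  have "A - \<rho> / real q * Tg = \<rho> / real q * ((\<Sum>m\<in>W. T m) / (2 * real H + 1) - Tg)"
  proof -
    have "(\<Sum>m\<in>W. S m) = \<rho> / real q * (\<Sum>m\<in>W. T m)" by (simp only: S_def sum_distrib_left)
    thus ?thesis by (simp add: A_def right_diff_distrib)
  qed
  also have "\<bar>\<dots>\<bar> \<le> sqrt (real q) / real q * (16 * real q)"
    using TT \<rho>(2) q unfolding abs_mult by (intro mult_mono) auto
  also have "\<dots> = 16 * sqrt (real q)" using q by simp
  finally have "\<bar>S m - \<rho> / real q * Tg\<bar> \<le> 1 + 16 * sqrt (real q)" using m(2) by linarith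
  moreover have "gauss_sum q \<chi> 1 * (\<Sum>k\<in>{1..N}. \<chi> (int k) * of_real (sin (2 * pi * real k * \<beta>) / (pi * real k))) = of_real (\<rho> / real q * Tg)"
    unfolding \<chi>f \<rho>(1) Tg_def sum_distrib_left of_real_sum x_def
    using q by (intro sum.cong refl) (simp add: field_simps)
  ultimately have "norm (partial_sum \<chi> m - gauss_sum q \<chi> 1 *
        (\<Sum>k\<in>{1..N}. \<chi> (int k) * of_real (sin (2 * pi * real k * \<beta>) / (pi * real k)))) \<le> 1 + 16 * sqrt (real q)"
    unfolding PS by (simp only: of_real_diff[symmetric] norm_of_real)
  moreover have "\<bar>of_int m - \<beta> * real q\<bar> \<le> real q / real N + 2" using Wdist[OF m(1)] H(3) by linarith
  ultimately show ?thesis by blast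
qed

subsection \<open>Products of characters\<close>

lemma dirichlet_char_mult:
  assumes "dirichlet_char r \<chi>" "dirichlet_char s \<xi>"
  shows "dirichlet_char (r * s) (\<lambda>n. \<chi> n * \<xi> n)"
  unfolding dirichlet_char_def
proof (intro conjI allI)
  show "0 < r * s" using assms by (simp add: dirichlet_char_def)
  show "\<chi> (n + int (r * s)) * \<xi> (n + int (r * s)) = \<chi> n * \<xi> n" for n
    using dirichlet_char_cong[OF assms(1), of "n + int (r * s)" n]
      dirichlet_char_cong[OF assms(2), of "n + int (r * s)" n] by (simp add: cong_def)
  show "\<chi> (m * n) * \<xi> (m * n) = \<chi> m * \<xi> m * (\<chi> n * \<xi> n)" for m n
    using assms by (simp add: dirichlet_char_def)
  show "\<chi> n * \<xi> n \<noteq> 0 \<longleftrightarrow> coprime n (int (r * s))" for n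
    using assms by (simp add: dirichlet_char_def)
qed

text \<open>If \<open>r\<close> does not divide \<open>d\<close>, primitivity gives \<open>u\<close>
  congruent to 1 modulo \<open>gcd d r\<close> with \<open>\<chi> u \<noteq> 1\<close>. Lifting it
  to \<open>v\<close>, congruent to \<open>u\<close> modulo \<open>r\<close> and to 1 modulo
  \<open>s\<close>, isolates \<open>\<chi>\<close>; and \<open>v\<close> is 1 modulo
  \<open>d\<close> because \<open>d\<close> divides \<open>gcd d r * s\<close>.\<close>

lemma induced_from_mult_modulus_dvd:
  assumes \<chi>: "primitive_char r \<chi>" and \<xi>: "dirichlet_char s \<xi>" and co: "coprime r s"
    and ind: "induced_from (r * s) (\<lambda>n. \<chi> n * \<xi> n) d"
  shows "r dvd d"
proof (rule ccontr)
  assume "\<not> r dvd d"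
  define d1 where "d1 = gcd d r"
  have "d1 dvd r" "d1 \<noteq> r" using \<open>\<not> r dvd d\<close> by (auto simp: d1_def gcd_nat.absorb_iff2[symmetric])
  then obtain u where u: "coprime u (int r)" "[u = 1] (mod int d1)" "\<chi> u \<noteq> 1"
    using primitive_char_nontrivial[OF \<chi>] by blast
  obtain v where v: "[v = u] (mod int r)" "[v = 1] (mod int s)"
    using binary_chinese_remainder_int[of "int r" "int s" u 1] co by auto
  have dir: "dirichlet_char r \<chi>" using \<chi> by (simp add: primitive_char_def)
  have "d dvd r * s" using ind by (simp add: induced_from_def)
  hence "d dvd d1 * s" unfolding d1_def by (metis dvd_triv_left gcd_greatest gcd_mult_distrib_nat mult.commute)
  moreover have "[v = 1] (mod int (d1 * s))"
  proof -
    have "[v = 1] (mod int d1)"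
      using v(1) u(2) \<open>d1 dvd r\<close> by (meson cong_dvd_modulus cong_trans int_dvd_int_iff)
    moreover have "coprime (int d1) (int s)"
      using co \<open>d1 dvd r\<close> by (meson coprime_divisors coprime_int_iff dvd_refl)
    ultimately show ?thesis using v(2) by (simp add: coprime_cong_mult)
  qed
  ultimately have "[v = 1] (mod int d)" by (meson cong_dvd_modulus int_dvd_int_iff)
  moreover have "coprime v (int (r * s))"
  proof -
    have "coprime v (int r)" using u(1) v(1) by (metis cong_imp_coprime cong_sym)
    moreover have "coprime v (int s)" using v(2) by (metis cong_imp_coprime cong_sym coprime_1_left)
    ultimately show ?thesis by simp
  qed
  ultimately have "\<chi> v * \<xi> v = 1" using induced_from_trivial[OF ind] by simp
  moreover have "\<chi> v = \<chi> u" "\<xi> v = 1"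
    using dirichlet_char_cong[OF dir v(1)] dirichlet_char_cong[OF \<xi> v(2)] dirichlet_char_one[OF \<xi>] by auto
  ultimately show False using u(3) by simp
qed

lemma primitive_char_mult:
  assumes \<chi>: "primitive_char r \<chi>" and \<xi>: "primitive_char s \<xi>" and co: "coprime r s"
  shows "primitive_char (r * s) (\<lambda>n. \<chi> n * \<xi> n)"
  unfolding primitive_char_def
proof (intro conjI allI impI)
  have dir: "dirichlet_char r \<chi>" "dirichlet_char s \<xi>" using \<chi> \<xi> by (simp_all add: primitive_char_def)
  show "dirichlet_char (r * s) (\<lambda>n. \<chi> n * \<xi> n)" by (rule dirichlet_char_mult[OF dir])
  fix d assume ind: "induced_from (r * s) (\<lambda>n. \<chi> n * \<xi> n) d"
  have "r dvd d" by (rule induced_from_mult_modulus_dvd[OF \<chi> dir(2) co ind])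
  moreover have "s dvd d"
    by (rule induced_from_mult_modulus_dvd[OF \<xi> dir(1)]) (use co ind in \<open>simp_all add: mult.commute coprime_commute\<close>)
  ultimately have "r * s dvd d" using co by (simp add: divides_mult)
  thus "d = r * s" using ind by (auto simp: induced_from_def intro: dvd_antisym)
qed

text \<open>Primitivity at the divisor 1 supplies a unit on which the product is not 1, so the
  product is not principal.\<close>

lemma quadratic_char_mult:
  assumes "quadratic_char r \<chi>" "quadratic_char s \<xi>"
    and prim: "primitive_char (r * s) (\<lambda>n. \<chi> n * \<xi> n)" and "r * s \<noteq> 1"
  shows "quadratic_char (r * s) (\<lambda>n. \<chi> n * \<xi> n)"
  unfolding quadratic_char_def
proof (intro conjI allI)
  show "dirichlet_char (r * s) (\<lambda>n. \<chi> n * \<xi> n)" using prim by (simp add: primitive_char_def)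
  show "\<chi> n * \<xi> n \<in> \<real>" for n using assms(1,2) by (simp add: quadratic_char_def)
  obtain u where "coprime u (int (r * s))" "\<chi> u * \<xi> u \<noteq> 1"
    using primitive_char_nontrivial[OF prim, of 1] \<open>r * s \<noteq> 1\<close> by auto
  thus "(\<lambda>n. \<chi> n * \<xi> n) \<noteq> principal_char (r * s)" unfolding fun_eq_iff principal_char_def by metis
  show "(\<lambda>n. (\<chi> n * \<xi> n) ^ 2) = principal_char (r * s)"
  proof
    fix n
    have "\<chi> n ^ 2 = principal_char r n" "\<xi> n ^ 2 = principal_char s n"
      using assms(1,2) unfolding quadratic_char_def by metis+
    thus "(\<chi> n * \<xi> n) ^ 2 = principal_char (r * s) n"
      by (simp add: power_mult_distrib principal_char_def)
  qed
qed

lemma square_eq_neg_real_cases: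
  assumes "z ^ 2 = - complex_of_real x" "0 \<le> x"
  shows "z = \<i> * of_real (sqrt x) \<or> z = - (\<i> * of_real (sqrt x))"
proof -
  have "z ^ 2 = (\<i> * of_real (sqrt x)) ^ 2"
    using assms by (simp add: power_mult_distrib flip: of_real_power)
  thus ?thesis by (simp only: power2_eq_iff)
qed

text \<open>The square \<open>- s\<close> leaves two candidates. For \<open>s = 4 * J + 3\<close>
  the frequency \<open>J + 1\<close> is inverse to 4, so its symbol is 1 and the Gauss sum there is
  the same; the estimate of the quadratic sum at this frequency rules out the negative
  candidate.\<close>

lemma gauss_sum_jacobi_eq:
  assumes P: "odd_primes P" and s4: "4 dvd \<Prod>P + 1" and s64: "64 \<le> \<Prod>P"
  shows "gauss_sum (\<Prod>P) (jacobi_char P) 1 = \<i> * of_real (sqrt (real (\<Prod>P)))"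
proof -
  define s where "s = \<Prod>P"
  define \<xi> where "\<xi> = jacobi_char P"
  obtain j where j: "s + 1 = 4 * j" using s4 by (auto simp: s_def)
  hence "s = 4 * (j - 1) + 3" by simp
  then obtain J where J: "s = 4 * J + 3" by blast
  have "P \<noteq> {}" using s64 by auto
  hence quad: "quadratic_char s \<xi>" and prim: "primitive_char s \<xi>" and dir: "dirichlet_char s \<xi>"
    using quadratic_char_jacobi[OF P] primitive_char_jacobi[OF P] dirichlet_char_jacobi[OF P]
    by (auto simp: s_def \<xi>_def)
  have mult: "\<xi> (m * n) = \<xi> m * \<xi> n" for m n using dir by (simp add: dirichlet_char_def)
  have "odd ((s - 1) div 2)" unfolding J by simp
  hence "\<xi> (- 1) = -1" using jacobi_char_minus_one[OF P] by (simp add: \<xi>_def s_def)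
  hence "gauss_sum s \<xi> 1 ^ 2 = - of_real (real s)" using gauss_sum_square[OF prim quad] by simp
  from square_eq_neg_real_cases[OF this]
  have cases: "gauss_sum s \<xi> 1 = \<i> * of_real (sqrt (real s)) \<or> gauss_sum s \<xi> 1 = - (\<i> * of_real (sqrt (real s)))"
    by simp
  have co2: "coprime 2 (int s)" unfolding J by (simp add: coprime_left_2_iff_odd)
  have "\<xi> 2 * \<xi> 2 = 1" unfolding \<xi>_def by (rule jacobi_char_square[OF P]) (use co2 in \<open>simp only: s_def\<close>)
  hence "\<xi> (int (J + 1)) = \<xi> (2 * (2 * int (J + 1)))" by (simp only: mult) (simp add: mult.assoc[symmetric])
  also have "\<dots> = \<xi> 1" by (rule dirichlet_char_cong[OF dir]) (simp add: J cong_iff_dvd_diff add.commute)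
  finally have t1: "\<xi> (int (J + 1)) = 1" using dirichlet_char_one[OF dir] by simp
  hence co: "coprime (int (J + 1)) (int s)" using dir unfolding dirichlet_char_def by (metis zero_neq_one)
  have "gauss_sum s \<xi> 1 = gauss_sum s \<xi> (int (J + 1))"
    using gauss_sum_primitive[OF prim quad, of "int (J + 1)"] t1 by simp
  also have "\<dots> = (\<Sum>n\<in>{0..<int s}. add_char s (n ^ 2 * int (J + 1)))"
    unfolding \<xi>_def s_def by (rule gauss_sum_jacobi[OF P]) (use co in \<open>simp only: s_def\<close>)
  finally have "- sqrt (real s) < Im (gauss_sum s \<xi> 1)"
    using quadratic_gauss_sum_Im_gt[of J] s64 unfolding J[symmetric] by (simp add: s_def)
  hence "gauss_sum s \<xi> 1 \<noteq> - (\<i> * of_real (sqrt (real s)))" by auto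
  thus ?thesis using cases by (simp add: s_def \<xi>_def)
qed

subsection \<open>Even characters imitating an odd character\<close>

text \<open>Multiplying by an odd symbol that is 1 on \<open>{1..N}\<close> flips the parity of
  \<open>\<psi>\<close> and keeps its values there. In the product formula
  \<open>\<psi> s = -1\<close>, because \<open>s * f ^ 2\<close> is -1 modulo \<open>b\<close> and
  \<open>\<psi>\<close> is odd, and \<open>\<xi> b = 1\<close>, because \<open>b \<le> N\<close>;
  the square of the Gauss sum of \<open>\<psi>\<close> is \<open>- b\<close> whatever its
  sign.\<close>

lemma exists_even_char_agreeing:
  assumes prim: "primitive_char b \<psi>" and quad: "quadratic_char b \<psi>" and odd: "odd_char \<psi>"
    and N: "b \<le> N" "64 \<le> N"
  shows "\<exists>q \<chi>. N < q \<and> primitive_char q \<chi> \<and> quadratic_char q \<chi> \<and> even_char \<chi> \<and> ln (real q) \<le> 10 * real N \<and>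
     (\<forall>n. 1 \<le> n \<longrightarrow> n \<le> N \<longrightarrow> \<chi> (int n) = \<psi> (int n)) \<and>
     gauss_sum q \<chi> 1 * gauss_sum b \<psi> 1 = \<i> * of_real (sqrt (real b) * sqrt (real q))"
proof -
  have dir: "dirichlet_char b \<psi>" using prim by (simp add: primitive_char_def)
  have b: "b > 0" using dir by (simp add: dirichlet_char_def)
  define M where "M = b * \<Prod>{p. prime p \<and> p \<le> N}"
  obtain P where P: "odd_primes P" "4 dvd \<Prod>P + 1" "coprime (\<Prod>P) b"
    and f: "\<exists>f. [int (\<Prod>P) * f ^ 2 = -1] (mod int b)"
    and m1: "jacobi_char P (- 1) = -1" and one: "\<And>n. 1 \<le> n \<Longrightarrow> n \<le> N \<Longrightarrow> jacobi_char P (int n) = 1"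
    and sN: "N < \<Prod>P" "\<Prod>P \<le> 2 * M ^ 2"
    using exists_odd_jacobi_char[of N b] N b unfolding M_def by auto
  define s where "s = \<Prod>P"
  define \<xi> where "\<xi> = jacobi_char P"
  define q where "q = b * s"
  define \<chi> where "\<chi> n = \<psi> n * \<xi> n" for n
  have "P \<noteq> {}" using sN N by auto
  have \<xi>: "primitive_char s \<xi>" "quadratic_char s \<xi>" "dirichlet_char s \<xi>"
    using quadratic_char_jacobi[OF P(1) \<open>P \<noteq> {}\<close>] primitive_char_jacobi[OF P(1)] dirichlet_char_jacobi[OF P(1)]
    by (auto simp: s_def \<xi>_def)
  have co: "coprime b s" using P(3) by (simp add: s_def coprime_commute)
  have s: "N < s" "s \<le> 2 * M ^ 2" using sN by (auto simp: s_def)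
  have "1 * s \<le> q" unfolding q_def by (rule mult_le_mono1) (use b in simp)
  hence qN: "N < q" using s by simp
  have pq: "primitive_char q \<chi>" unfolding q_def \<chi>_def by (rule primitive_char_mult[OF prim \<xi>(1) co])
  have "q \<noteq> 1" using qN N by simp
  have qq: "quadratic_char q \<chi>" unfolding q_def \<chi>_def
    by (rule quadratic_char_mult[OF quad \<xi>(2)]) (use pq \<open>q \<noteq> 1\<close> in \<open>simp_all add: q_def \<chi>_def[abs_def]\<close>)
  have ev: "even_char \<chi>" using odd m1 by (simp add: even_char_def odd_char_def \<chi>_def \<xi>_def)
  have agree: "\<chi> (int n) = \<psi> (int n)" if "1 \<le> n" "n \<le> N" for n
    using one[OF that] by (simp add: \<chi>_def \<xi>_def)
  have mult: "\<psi> (m * n) = \<psi> m * \<psi> n" for m n using dir by (simp add: dirichlet_char_def)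
  have \<psi>s: "\<psi> (int s) = -1"
  proof -
    obtain f where f: "[int s * f ^ 2 = -1] (mod int b)" using f by (auto simp: s_def)
    have "\<psi> (int s) * (\<psi> f * \<psi> f) = -1"
      using dirichlet_char_cong[OF dir f] odd by (simp add: mult power2_eq_square odd_char_def)
    moreover from this have "\<psi> f \<noteq> 0" by auto
    hence "\<psi> f * \<psi> f = 1" using quadratic_char_values[OF quad, of f] by (auto split: if_splits)
    ultimately show ?thesis by simp
  qed
  have \<xi>b: "\<xi> (int b) = 1" using one[of b] N b by (simp add: \<xi>_def)
  have \<tau>\<xi>: "gauss_sum s \<xi> 1 = \<i> * of_real (sqrt (real s))"
    unfolding s_def \<xi>_def by (rule gauss_sum_jacobi_eq) (use P sN N in auto)
  have \<tau>\<psi>: "gauss_sum b \<psi> 1 * gauss_sum b \<psi> 1 = - of_nat b"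
    using gauss_sum_square[OF prim quad] odd by (simp add: odd_char_def power2_eq_square)
  have "gauss_sum q \<chi> 1 = \<psi> (int s) * \<xi> (int b) * gauss_sum b \<psi> 1 * gauss_sum s \<xi> 1"
    unfolding q_def \<chi>_def by (rule gauss_sum_mult[OF dir \<xi>(3) co])
  hence "gauss_sum q \<chi> 1 * gauss_sum b \<psi> 1
      = \<psi> (int s) * \<xi> (int b) * (gauss_sum b \<psi> 1 * gauss_sum b \<psi> 1) * gauss_sum s \<xi> 1" by simp
  also have "\<dots> = \<i> * of_nat b * of_real (sqrt (real s))" unfolding \<psi>s \<xi>b \<tau>\<xi> \<tau>\<psi> by simp
  also have "\<dots> = \<i> * of_real (real b * sqrt (real s))" by simp
  also have "real b * sqrt (real s) = sqrt (real b) * sqrt (real q)"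
    by (simp add: q_def real_sqrt_mult)
  finally have gs: "gauss_sum q \<chi> 1 * gauss_sum b \<psi> 1 = \<i> * of_real (sqrt (real b) * sqrt (real q))" .
  have "ln (real q) \<le> 10 * real N"
  proof -
    have "M \<le> b * 4 ^ N" unfolding M_def by (rule mult_le_mono2[OF primorial_le])
    hence "2 * M ^ 2 \<le> 2 * (b * 4 ^ N) ^ 2" by (intro mult_le_mono2 power_mono) auto
    hence "q \<le> b * (2 * (b * 4 ^ N) ^ 2)" unfolding q_def using s(2) by (intro mult_le_mono2) linarith
    hence "real q \<le> real (b * (2 * (b * 4 ^ N) ^ 2))" by (simp only: of_nat_le_iff)
    hence "ln (real q) \<le> ln (real b * (2 * (real b * 4 ^ N) ^ 2))" using qN by (subst ln_le_cancel_iff) auto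
    also have "\<dots> = 3 * ln (real b) + ln 2 + 2 * (real N * ln 4)"
      using b by (simp add: ln_mult ln_realpow)
    \<comment> \<open>Crude bounds \<open>ln b \<le> N\<close>, \<open>ln 2 \<le> 1\<close> and
      \<open>ln 4 \<le> 3\<close> give \<open>9 * N + 1\<close>, the origin of the 10.\<close>
    also have "\<dots> \<le> 3 * real N + 1 + 2 * (real N * 3)"
    proof -
      have "ln (real b) \<le> real N" using ln_le_minus_one[of "real b"] b N by simp
      moreover have "ln (2::real) \<le> 1" "ln (4::real) \<le> 3" using ln_le_minus_one[of 2] ln_le_minus_one[of 4] by auto
      moreover have "real N * ln 4 \<le> real N * 3" using \<open>ln 4 \<le> 3\<close> by (intro mult_left_mono) auto
      ultimately show ?thesis by linarith
    qed
    also have "\<dots> \<le> 10 * real N" using N by simp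
    finally show ?thesis .
  qed
  thus ?thesis using qN pq qq ev agree gs by blast
qed

text \<open>The same \<open>\<chi>\<close> serves every \<open>a\<close>, and the error constants
  depend on \<open>b\<close> at most, as a single sequence \<open>\<epsilon>\<close> requires;
  \<open>a\<close> enters only through the centre of the window and the Gauss sum of
  \<open>\<psi>\<close> at \<open>a\<close>.\<close>

lemma exists_large_char_sum:
  assumes prim: "primitive_char b \<psi>" and quad: "quadratic_char b \<psi>" and odd: "odd_char \<psi>"
    and \<chi>: "primitive_char q \<chi>" "quadratic_char q \<chi>" "even_char \<chi>"
    and N0: "ln (real q) \<le> 10 * real N0"
    and agree: "\<And>n. 1 \<le> n \<Longrightarrow> n \<le> N0 \<Longrightarrow> \<chi> (int n) = \<psi> (int n)"
    and gs: "gauss_sum q \<chi> 1 * gauss_sum b \<psi> 1 = \<i> * of_real (sqrt (real b) * sqrt (real q))"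
    and q20: "20 \<le> ln (real q)" and a: "coprime a (int b)"
  shows "\<exists>\<alpha> \<delta>. \<bar>\<alpha> - real_of_int a / real b\<bar> \<le> 60 / ln (real q) \<and>
     \<bar>\<delta>\<bar> \<le> ((4 * real b + 18) * pi * sqrt (real b) + 19) / ln (ln (real q)) \<and>
     char_sum_below \<chi> (\<alpha> * real q) =
       \<psi> a * complex_of_real (sqrt (real q) / (pi * sqrt (real b)) * (1 + \<delta>) * ln (ln (real q)))"
proof -
  have dir: "dirichlet_char b \<psi>" using prim by (simp add: primitive_char_def)
  have b: "b > 0" using dir by (simp add: dirichlet_char_def)
  have "dirichlet_char q \<chi>" using \<chi> by (simp add: primitive_char_def)
  hence q: "q > 0" by (simp add: dirichlet_char_def)
  have lnq: "ln (real q) < real q" using q by (intro ln_less_self) simp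
  define L2 where "L2 = ln (ln (real q))"
  have L2: "L2 > 0" using q20 by (simp add: L2_def)
  \<comment> \<open>The agreement range \<open>N0\<close> may be much longer than
    \<open>ln q\<close>, which is only bounded above by it. A cut-off tied to \<open>ln q\<close>
    itself stays within \<open>N0\<close> and makes \<open>ln N\<close> comparable to
    \<open>ln (ln q)\<close> from both sides.\<close>
  define N where "N = nat \<lfloor>ln (real q) / 10\<rfloor>"
  have N: "real N \<le> ln (real q) / 10" "ln (real q) / 10 < real N + 1"
    using q20 of_int_floor_le[of "ln (real q) / 10"] real_of_int_floor_add_one_gt[of "ln (real q) / 10"]
    by (simp_all only: N_def of_nat_nat zero_le_floor)
  \<comment> \<open>Rounding down costs at most 1, which is at most half of \<open>ln q / 10\<close>
    since \<open>ln q \<ge> 20\<close>.\<close>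
  have N20: "ln (real q) / 20 \<le> real N"
  proof -
    have "y / 20 \<le> x" if "y / 10 < x + 1" "20 \<le> y" for x y :: real using that by simp
    thus ?thesis using N(2) q20 by blast
  qed
  have N1: "1 \<le> N" using N20 q20 by (simp add: field_simps)
  have "real N \<le> real N0" using N(1) N0 by simp
  hence NN0: "N \<le> N0" by simp
  have "2 * real N < real q" using N(1) lnq q20 by simp
  hence Nq: "2 * N < q" by linarith
  define \<beta> where "\<beta> = real_of_int a / real b"
  obtain m where m: "\<bar>of_int m - \<beta> * real q\<bar> \<le> real q / real N + 2"
    and S: "norm (partial_sum \<chi> m - gauss_sum q \<chi> 1 *
        (\<Sum>k\<in>{1..N}. \<chi> (int k) * of_real (sin (2 * pi * real k * \<beta>) / (pi * real k)))) \<le> 1 + 16 * sqrt (real q)"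
    using exists_partial_sum_approx[OF \<chi> N1 Nq] by blast
  define \<alpha> where "\<alpha> = real_of_int m / real q"
  \<comment> \<open>The 60 comes from a shift of at most \<open>3 / N\<close> together with
    \<open>N \<ge> ln q / 20\<close>.\<close>
  have \<alpha>: "\<bar>\<alpha> - \<beta>\<bar> \<le> 60 / ln (real q)"
  proof -
    have "\<alpha> - \<beta> = (of_int m - \<beta> * real q) / real q" using q by (simp add: \<alpha>_def field_simps)
    hence "\<bar>\<alpha> - \<beta>\<bar> \<le> (real q / real N + 2) / real q" using m q by (simp add: divide_right_mono)
    also have "\<dots> = 1 / real N + 2 / real q" using q by (simp add: field_simps)
    also have "\<dots> \<le> 1 / real N + 2 / real N" using Nq N1 by (intro add_left_mono divide_left_mono) auto
    also have "\<dots> = 3 / real N" by simp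
    also have "\<dots> \<le> 3 / (ln (real q) / 20)" using N20 q20 N1 by (intro divide_left_mono) auto
    finally show ?thesis by simp
  qed
  have "\<alpha> * real q = of_int m" using q by (simp add: \<alpha>_def)
  hence csb: "char_sum_below \<chi> (\<alpha> * real q) = partial_sum \<chi> m"
    by (simp add: char_sum_below_def partial_sum_def)
  have real: "Im (\<chi> n) = 0" for n using quadratic_char_values[OF \<chi>(2), of n] by (auto split: if_splits)
  define Sr where "Sr = Re (partial_sum \<chi> m)"
  have Sr: "partial_sum \<chi> m = of_real Sr"
    by (simp add: Sr_def complex_eq_iff) (simp add: partial_sum_def real)
  have \<psi>v: "\<psi> n = of_real (Re (\<psi> n))" "\<bar>Re (\<psi> n)\<bar> \<le> 1" for n
    using quadratic_char_values[OF quad, of n] by (auto simp: complex_eq_iff split: if_splits)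
  define p where "p = Re (\<psi> a)"
  have p: "\<psi> a = of_real p" "p * p = 1"
    using quadratic_char_values[OF quad, of a] a by (auto simp: p_def complex_eq_iff split: if_splits)
  define g where "g n = Re (\<psi> n) * Im (add_char b (n * a))" for n
  have "gauss_sum b \<psi> 1 ^ 2 = - of_real (real b)"
    using gauss_sum_square[OF prim quad] odd by (simp add: odd_char_def)
  from square_eq_neg_real_cases[OF this of_nat_0_le_iff]
  obtain \<sigma> where \<sigma>: "gauss_sum b \<psi> 1 = \<i> * of_real \<sigma>" "\<sigma> * \<sigma> = real b"
  proof (elim disjE)
    assume "gauss_sum b \<psi> 1 = \<i> * of_real (sqrt (real b))"
    thus thesis by (intro that[of "sqrt (real b)"]) auto
  next
    assume "gauss_sum b \<psi> 1 = - (\<i> * of_real (sqrt (real b)))"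
    thus thesis by (intro that[of "- sqrt (real b)"]) auto
  qed
  \<comment> \<open>This is the imaginary part of the Gauss sum of \<open>\<psi>\<close> at
    \<open>a\<close>, divided by \<open>b\<close>. The sign of \<open>\<sigma>\<close> remains
    undetermined.\<close>
  define \<mu> where "\<mu> = p * \<sigma> / real b"
  have gmean: "(\<Sum>k\<in>{0..<int b}. g k) = real b * \<mu>"
  proof -
    have "(\<Sum>k\<in>{0..<int b}. g k) = Im (gauss_sum b \<psi> a)"
      unfolding gauss_sum_def Im_sum g_def by (intro sum.cong refl) (subst (2) \<psi>v(1), simp)
    also have "gauss_sum b \<psi> a = \<i> * of_real (p * \<sigma>)"
      using gauss_sum_coprime[OF quad a] \<sigma>(1) p(1) by simp
    finally show ?thesis using b by (simp add: \<mu>_def)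
  qed
  define G where "G = (\<Sum>k\<in>{1..N}. g (int k) / real k)"
  have G: "\<bar>G - \<mu> * ln (real N)\<bar> \<le> 4 * real b + 1"
    unfolding G_def
  proof (rule periodic_sum_ln[OF b _ _ gmean N1])
    show "g (n mod int b) = g n" for n
    proof -
      have "add_char b ((n mod int b) * a) = add_char b (n * a)"
        by (rule add_char_cong[OF b]) (simp add: cong_def mod_simps)
      thus ?thesis using dirichlet_char_mod[OF dir, of n] by (simp add: g_def)
    qed
    show "\<bar>g n\<bar> \<le> 1" for n
    proof -
      have "\<bar>Re (\<psi> n)\<bar> * \<bar>Im (add_char b (n * a))\<bar> \<le> 1 * 1"
        using \<psi>v(2)[of n] by (intro mult_mono) (auto simp: add_char_def)
      thus ?thesis by (simp add: g_def abs_mult)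
    qed
  qed
  have sum_eq: "(\<Sum>k\<in>{1..N}. \<chi> (int k) * of_real (sin (2 * pi * real k * \<beta>) / (pi * real k))) = of_real (G / pi)"
  proof -
    have "\<chi> (int k) * of_real (sin (2 * pi * real k * \<beta>) / (pi * real k)) = of_real (g (int k) / real k / pi)"
      if "k \<in> {1..N}" for k
    proof -
      have "\<chi> (int k) = of_real (Re (\<psi> (int k)))" using agree[of k] that NN0 \<psi>v(1)[of "int k"] by simp
      moreover have "Im (add_char b (int k * a)) = sin (2 * pi * real k * \<beta>)"
        by (simp add: add_char_def \<beta>_def mult_ac)
      ultimately show ?thesis by (simp add: g_def mult_ac)
    qed
    thus ?thesis unfolding G_def by (simp add: sum_divide_distrib)
  qed
  define R where "R = sqrt (real q)"
  have R1: "1 \<le> R" using q by (simp add: R_def)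
  have sb: "sqrt (real b) > 0" using b by simp
  have "gauss_sum q \<chi> 1 * of_real \<sigma> = of_real (sqrt (real b) * R)"
    using gs unfolding \<sigma>(1) R_def by (simp add: mult.left_commute)
  hence "gauss_sum q \<chi> 1 * of_real (\<sigma> * \<sigma>) = of_real (sqrt (real b) * R * \<sigma>)" by (simp add: mult.assoc[symmetric])
  hence "gauss_sum q \<chi> 1 = of_real (sqrt (real b) * R * \<sigma> / real b)"
    unfolding \<sigma>(2) using b by (simp add: field_simps)
  then obtain \<rho> where \<rho>: "gauss_sum q \<chi> 1 = of_real \<rho>" "\<rho> = sqrt (real b) * R * \<sigma> / real b" by blast
  have bb: "sqrt (real b) * sqrt (real b) = real b" by simp
  have "\<bar>\<sigma>\<bar> = sqrt (real b)" using \<sigma>(2) by (metis real_sqrt_abs2)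
  hence "\<bar>\<rho>\<bar> = (sqrt (real b) * sqrt (real b)) * R / real b"
    unfolding \<rho>(2) using R1 by (simp del: real_sqrt_mult_self add: abs_mult)
  hence \<rho>abs: "\<bar>\<rho>\<bar> = R" unfolding bb using b by simp
  define V where "V = R / (pi * sqrt (real b))"
  have V: "V > 0" using R1 sb by (simp add: V_def)
  have RV: "R = V * (pi * sqrt (real b))" using sb by (simp add: V_def)
  \<comment> \<open>Both \<open>\<rho>\<close> and \<open>\<mu>\<close> carry one factor
    \<open>\<sigma>\<close>, so its sign disappears through
    \<open>\<sigma> * \<sigma> = b\<close>.\<close>
  have \<rho>\<mu>: "\<rho> * \<mu> / pi = p * V"
  proof -
    have "\<rho> * \<mu> / pi = p * (sqrt (real b) * R * (\<sigma> * \<sigma>) / (real b * real b)) / pi"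
      unfolding \<rho>(2) \<mu>_def by simp
    also have "\<dots> = p * (sqrt (real b) * R / real b) / pi" unfolding \<sigma>(2) using b by simp
    also have "sqrt (real b) * R / real b = R / sqrt (real b)" using b by (simp add: real_div_sqrt field_simps)
    finally show ?thesis by (simp add: V_def mult_ac)
  qed
  have "norm (of_real (Sr - \<rho> * (G / pi)) :: complex) \<le> 1 + 16 * R"
    using S unfolding sum_eq Sr \<rho>(1) R_def by simp
  hence "\<bar>Sr - \<rho> * (G / pi)\<bar> \<le> 1 + 16 * R" by (simp only: norm_of_real)
  moreover have "\<rho> * (G / pi) - p * V * ln (real N) = \<rho> * (G - \<mu> * ln (real N)) / pi"
    unfolding \<rho>\<mu>[symmetric] by (simp add: field_simps)
  moreover have "\<bar>\<rho> * (G - \<mu> * ln (real N)) / pi\<bar> \<le> R * (4 * real b + 1)"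
  proof -
    have "\<bar>\<rho> * (G - \<mu> * ln (real N))\<bar> \<le> R * (4 * real b + 1)"
      unfolding abs_mult \<rho>abs using G R1 by (intro mult_left_mono) auto
    moreover have "\<bar>\<rho> * (G - \<mu> * ln (real N)) / pi\<bar> \<le> \<bar>\<rho> * (G - \<mu> * ln (real N))\<bar> / 1"
      unfolding abs_divide using pi_ge_two by (intro frac_le) auto
    ultimately show ?thesis by linarith
  qed
  moreover have "\<bar>x - z\<bar> \<le> A + B" if "\<bar>x - y\<bar> \<le> A" "y - z = e" "\<bar>e\<bar> \<le> B" for x y z e A B :: real
    using that by linarith
  ultimately have "\<bar>Sr - p * V * ln (real N)\<bar> \<le> 1 + 16 * R + R * (4 * real b + 1)" by blast
  also have "\<dots> \<le> R * (4 * real b + 18)" using R1 by (simp add: algebra_simps)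
  finally have 1: "\<bar>Sr - p * V * ln (real N)\<bar> \<le> R * (4 * real b + 18)" .
  have lnN: "\<bar>ln (real N) - L2\<bar> \<le> 19"
  proof -
    have "ln (real N) \<le> L2" unfolding L2_def using N(1) N1 q20 by (subst ln_le_cancel_iff) auto
    moreover have "L2 - ln 20 \<le> ln (real N)"
    proof -
      have "L2 - ln 20 = ln (ln (real q) / 20)" unfolding L2_def using q20 by (simp add: ln_div)
      also have "\<dots> \<le> ln (real N)" using N20 N1 q20 by (subst ln_le_cancel_iff) auto
      finally show ?thesis .
    qed
    moreover have "ln (20::real) \<le> 19" using ln_le_minus_one[of 20] by simp
    ultimately show ?thesis by linarith
  qed
  \<comment> \<open>Since \<open>p\<close> is 1 or -1, it is its own inverse and
    \<open>\<delta>\<close> is the exact relative error: the required equation holds by construction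
    and only the size of \<open>\<delta>\<close> remains to be bounded.\<close>
  define \<delta> where "\<delta> = p * Sr / (V * L2) - 1"
  have "V * (1 + \<delta>) * L2 = p * Sr" using V L2 by (simp add: \<delta>_def)
  hence "p * (V * (1 + \<delta>) * L2) = p * p * Sr" by simp
  hence eq: "Sr = p * (V * (1 + \<delta>) * L2)" using p(2) by simp
  have "\<bar>\<delta>\<bar> \<le> ((4 * real b + 18) * pi * sqrt (real b) + 19) / L2"
  proof -
    have absp: "\<bar>p\<bar> = 1" using p(2) square_eq_1_iff[of p] by auto
    have "p * Sr - V * L2 = p * (Sr - p * V * ln (real N)) + V * (ln (real N) - L2)"
      using p(2) by (simp add: algebra_simps)
    also have "\<bar>\<dots>\<bar> \<le> \<bar>p * (Sr - p * V * ln (real N))\<bar> + \<bar>V * (ln (real N) - L2)\<bar>" by (rule abs_triangle_ineq)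
    also have "\<dots> \<le> R * (4 * real b + 18) + V * 19"
    proof (rule add_mono)
      show "\<bar>p * (Sr - p * V * ln (real N))\<bar> \<le> R * (4 * real b + 18)" using 1 by (simp add: abs_mult absp)
      show "\<bar>V * (ln (real N) - L2)\<bar> \<le> V * 19" using lnN V by (simp add: abs_mult)
    qed
    also have "\<dots> = V * ((4 * real b + 18) * pi * sqrt (real b) + 19)" unfolding RV by (simp add: algebra_simps)
    finally have "\<bar>p * Sr - V * L2\<bar> \<le> V * ((4 * real b + 18) * pi * sqrt (real b) + 19)" .
    hence "\<bar>p * Sr - V * L2\<bar> / (V * L2) \<le> V * ((4 * real b + 18) * pi * sqrt (real b) + 19) / (V * L2)"
      using V L2 by (intro divide_right_mono) auto
    moreover have "\<delta> = (p * Sr - V * L2) / (V * L2)" using V L2 by (simp add: \<delta>_def diff_divide_distrib)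
    hence "\<bar>\<delta>\<bar> = \<bar>p * Sr - V * L2\<bar> / (V * L2)" using V L2 by (simp add: abs_mult)
    ultimately have "\<bar>\<delta>\<bar> \<le> V * ((4 * real b + 18) * pi * sqrt (real b) + 19) / (V * L2)" by simp
    thus ?thesis using V by simp
  qed
  moreover have "char_sum_below \<chi> (\<alpha> * real q) = \<psi> a * of_real (sqrt (real q) / (pi * sqrt (real b)) * (1 + \<delta>) * ln (ln (real q)))"
    unfolding csb Sr eq p(1) V_def R_def L2_def by (simp only: of_real_mult)
  ultimately show ?thesis using \<alpha> unfolding \<beta>_def L2_def by blast
qed

theorem theorem5:
  fixes b :: nat and \<psi> :: "int \<Rightarrow> complex"
  assumes "primitive_char b \<psi>" and "quadratic_char b \<psi>" and "odd_char \<psi>"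
  shows "\<exists>(q :: nat \<Rightarrow> nat) (\<chi> :: nat \<Rightarrow> int \<Rightarrow> complex) (C :: real) (\<epsilon> :: nat \<Rightarrow> real).
           strict_mono q \<and>
           (\<forall>k. primitive_char (q k) (\<chi> k) \<and> quadratic_char (q k) (\<chi> k) \<and> even_char (\<chi> k)) \<and>
           \<epsilon> \<longlonglongrightarrow> 0 \<and>
           (\<forall>k. \<forall>a :: int. coprime a (int b) \<longrightarrow>
              (\<exists>(\<alpha> :: real) (\<delta> :: real).
                 \<bar>\<alpha> - real_of_int a / real b\<bar> \<le> C / ln (real (q k)) \<and>
                 \<bar>\<delta>\<bar> \<le> \<epsilon> k \<and>
                 char_sum_below (\<chi> k) (\<alpha> * real (q k)) =
                   \<psi> a * complex_of_real
                     (sqrt (real (q k)) / (pi * sqrt (real b)) * (1 + \<delta>) * ln (ln (real (q k))))))"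
proof -
  define K where "K = (4 * real b + 18) * pi * sqrt (real b) + 19"
  define good where "good q \<chi> \<longleftrightarrow> primitive_char q \<chi> \<and> quadratic_char q \<chi> \<and> even_char \<chi> \<and>
     (\<forall>a. coprime a (int b) \<longrightarrow> (\<exists>\<alpha> \<delta>. \<bar>\<alpha> - real_of_int a / real b\<bar> \<le> 60 / ln (real q) \<and>
        \<bar>\<delta>\<bar> \<le> K / ln (ln (real q)) \<and>
        char_sum_below \<chi> (\<alpha> * real q) =
          \<psi> a * complex_of_real (sqrt (real q) / (pi * sqrt (real b)) * (1 + \<delta>) * ln (ln (real q)))))" for q \<chi>
  \<comment> \<open>It is enough that these moduli are unbounded: enumerating them in increasing
    order yields the strictly monotone sequence.\<close>
  define Q where "Q = {q. \<exists>\<chi>. good q \<chi>}"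
  have "\<exists>q>n. q \<in> Q" for n
  proof -
    define n20 where "n20 = nat \<lceil>exp 20 :: real\<rceil>"
    \<comment> \<open>Here \<open>n\<close> pushes \<open>q\<close> beyond any bound,
      \<open>n20\<close> gives \<open>ln q \<ge> 20\<close>, and \<open>b\<close> and 64 are
      demanded by the construction of \<open>\<chi>\<close>.\<close>
    define N where "N = max (max n n20) (max b 64)"
    have N: "b \<le> N" "64 \<le> N" "n \<le> N" "n20 \<le> N" by (auto simp: N_def)
    obtain q \<chi> where q: "N < q" "primitive_char q \<chi>" "quadratic_char q \<chi>" "even_char \<chi>" "ln (real q) \<le> 10 * real N"
      "\<forall>n. 1 \<le> n \<longrightarrow> n \<le> N \<longrightarrow> \<chi> (int n) = \<psi> (int n)"
      "gauss_sum q \<chi> 1 * gauss_sum b \<psi> 1 = \<i> * of_real (sqrt (real b) * sqrt (real q))"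
      using exists_even_char_agreeing[OF assms N(1,2)] by blast
    have "exp 20 \<le> real q"
    proof -
      have "exp 20 \<le> real n20" unfolding n20_def by (rule real_nat_ceiling_ge)
      also have "\<dots> \<le> real q" using q(1) N(4) by simp
      finally show ?thesis .
    qed
    hence "20 \<le> ln (real q)" using q(1) by (subst ln_ge_iff) auto
    have "good q \<chi>" unfolding good_def K_def
    proof (intro conjI allI impI)
      fix a assume "coprime a (int b)"
      show "\<exists>\<alpha> \<delta>. \<bar>\<alpha> - real_of_int a / real b\<bar> \<le> 60 / ln (real q) \<and>
          \<bar>\<delta>\<bar> \<le> ((4 * real b + 18) * pi * sqrt (real b) + 19) / ln (ln (real q)) \<and>
          char_sum_below \<chi> (\<alpha> * real q) =
            \<psi> a * complex_of_real (sqrt (real q) / (pi * sqrt (real b)) * (1 + \<delta>) * ln (ln (real q)))"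
        by (rule exists_large_char_sum[OF assms q(2-5) _ q(7)]) (use q(6) \<open>20 \<le> ln (real q)\<close> \<open>coprime a (int b)\<close> in auto)
    qed (use q in auto)
    thus ?thesis using q(1) N(3) by (intro exI[of _ q]) (auto simp: Q_def)
  qed
  hence "infinite Q" by (meson infinite_nat_iff_unbounded)
  define q where "q = enumerate Q"
  have mono: "strict_mono q" unfolding q_def by (rule strict_mono_enumerate[OF \<open>infinite Q\<close>])
  have "\<exists>\<chi>. good (q k) \<chi>" for k
    using enumerate_in_set[OF \<open>infinite Q\<close>, of k] by (simp add: q_def Q_def)
  then obtain \<chi> where \<chi>: "\<And>k. good (q k) (\<chi> k)" by metis
  have "filterlim (\<lambda>k. ln (ln (real (q k)))) at_top sequentially"
    by (intro filterlim_compose[OF ln_at_top] filterlim_compose[OF filterlim_real_sequentially]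
        filterlim_subseq[OF mono])
  hence lim: "(\<lambda>k. K / ln (ln (real (q k)))) \<longlonglongrightarrow> 0"
    by (intro tendsto_divide_0[OF tendsto_const] filterlim_at_top_imp_at_infinity)
  show ?thesis
  proof (rule exI[of _ q], rule exI[of _ \<chi>], rule exI[of _ 60],
      rule exI[of _ "\<lambda>k. K / ln (ln (real (q k)))"], intro conjI allI impI)
    show "strict_mono q" by (rule mono)
    show "(\<lambda>k. K / ln (ln (real (q k)))) \<longlonglongrightarrow> 0" by (rule lim)
    fix k
    show "primitive_char (q k) (\<chi> k)" "quadratic_char (q k) (\<chi> k)" "even_char (\<chi> k)"
      using \<chi>[of k] by (auto simp: good_def)
    fix a assume "coprime a (int b)"
    with \<chi>[of k] have "\<exists>\<alpha> \<delta>. \<bar>\<alpha> - real_of_int a / real b\<bar> \<le> 60 / ln (real (q k)) \<and>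
        \<bar>\<delta>\<bar> \<le> K / ln (ln (real (q k))) \<and>
        char_sum_below (\<chi> k) (\<alpha> * real (q k)) =
          \<psi> a * complex_of_real (sqrt (real (q k)) / (pi * sqrt (real b)) * (1 + \<delta>) * ln (ln (real (q k))))"
      unfolding good_def by blast
    thus "\<exists>\<alpha> \<delta>. \<bar>\<alpha> - real_of_int a / real b\<bar> \<le> 60 / ln (real (q k)) \<and>
        \<bar>\<delta>\<bar> \<le> K / ln (ln (real (q k))) \<and>
        char_sum_below (\<chi> k) (\<alpha> * real (q k)) =
          \<psi> a * complex_of_real (sqrt (real (q k)) / (pi * sqrt (real b)) * (1 + \<delta>) * ln (ln (real (q k))))" .
  qed
qed

end
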